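(* Let $R>0$ and $K>0$ be given, let $y_0\in L^2(\Omega)$, let $\rho,\rho_0$ be the Carleman weights described in the context and let $\rho_R:=\min(R,\rho)$. For $(y,v,q)\in L^2(Q)\times\mathcal U\times L^2(Q)$ define the Lagrangian $$\mathcal L_R(y,v,q):=\frac12\iint_Q\rho_R^2|y|^2\,dx\,dt+\frac12\iint_{Q_\omega}\rho_0^2|v|^2\,dx\,dt-(q,Mv+\overline y-y)_{L^2(Q)}$$ and the Augmented Lagrangian $$\mathcal L_{R,K}(y,v,q):=\mathcal L_R(y,v,q)+\frac K2\|Mv+\overline y-y\|_{L^2(Q)}^2 .$$ Then: (a) Every saddle-point of $\mathcal L_R$ is a saddle-point of $\mathcal L_{R,K}$ and conversely. Consequently, there exists a unique saddle-point $(y_R,v_R,q_R)$ of $\mathcal L_{R,K}$, and it satisfies $$y_R=-\rho_R^{-2}q_R,\qquad v_R=\rho_0^{-2}M^*q_R .$$ (b) Furthermore, $\mathcal L_{R,K}(y_R,v_R,q_R)=\mathcal L_R(y_R,v_R,q_R)$.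
   Context: Setting. $\Omega\subset\mathbb R^d$ ($d\ge1$) is a bounded domain with $C^2$ boundary, $T>0$, $\omega\subset\Omega$ is a non-empty open set, $Q=\Omega\times(0,T)$, $\Sigma=\partial\Omega\times(0,T)$, $Q_\omega=\omega\times(0,T)$. Coefficients: $a\in W^{1,\infty}(Q)$ with $a\ge a_0>0$ in $Q$, and $b\in L^\infty(Q)$. Operators: $Ly=\partial_t y-\mathrm{div}(a\nabla y)+by$ and $L^*z=-\partial_t z-\mathrm{div}(a\nabla z)+bz$. $M:L^2(Q_\omega)\to L^2(Q)$ sends $v$ to the weak solution $y$ of $Ly=v\mathbb 1_\omega$ in $Q$, $y=0$ on $\Sigma$, $y(\cdot,0)=0$ in $\Omega$ (here $v\mathbb 1_\omega$ is the extension of $v$ by zero). Its adjoint $M^*:L^2(Q)\to L^2(Q_\omega)$ is $M^*q=z|_{Q_\omega}$, where $z$ is the weak solution of $L^*z=q$ in $Q$, $z=0$ on $\Sigma$, $z(\cdot,T)=0$ in $\Omega$. $\overline y$ is the weak solution of $L\overline y=0$ in $Q$, $\overline y=0$ on $\Sigma$, $\overline y(\cdot,0)=y_0$ in $\Omega$. Weights. $\eta^0\in C^2(\overline\Omega)$ satisfies $\eta^0=0$ on $\partial\Omega$, $|\nabla\eta^0|>0$ in $\Omega\setminus\overline\omega$, $\partial_\nu\eta^0<0$ on $\partial\Omega$. With constants $K_1,K_2>0$ sufficiently large, $$\alpha(x,t)=K_1\frac{e^{K_2}-e^{\eta^0(x)}}{T-t},\quad \rho=e^{\alpha},\quad \rho_0=(T-t)^{3/2}\rho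 .$$ In particular $\rho,\rho_0$ are continuous in $Q$, bounded below by some $\rho_*>0$, and $\min_{x\in\overline\Omega}\rho(x,t)\to+\infty$, $\min_{x\in\overline\Omega}\rho_0(x,t)\to+\infty$ as $t\to T^-$. $\mathcal U=\{v\in L^2(Q_\omega):\rho_0v\in L^2(Q_\omega)\}$, a Hilbert space with norm $\|\rho_0v\|_{L^2(Q_\omega)}$. Saddle-point. A saddle-point of a function $\mathcal L$ on $L^2(Q)\times\mathcal U\times L^2(Q)$ is a triple $(y,v,q)$ such that $\mathcal L(y,v,p)\le\mathcal L(y,v,q)\le\mathcal L(z,w,q)$ for all $p\in L^2(Q)$ and all $(z,w)\in L^2(Q)\times\mathcal U$. *)

theory Defs
  imports "HOL-Analysis.Analysis"
begin

text \<open>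
  Space-time points are pairs \<open>(x, t) :: 'a \<times> real\<close>, with \<open>'a :: euclidean_space\<close> in the role of
  R^d. Elements of Lebesgue and Sobolev spaces over a set S are represented by functions on the
  whole type of which only the values on S, up to null sets, are relevant.
\<close>

section \<open>Function spaces\<close>

definition L2 :: "'b::euclidean_space set \<Rightarrow> ('b \<Rightarrow> 'c::euclidean_space) set" where
  "L2 S = {f. f \<in> borel_measurable (lebesgue_on S) \<and> integrable (lebesgue_on S) (\<lambda>z. (norm (f z))\<^sup>2)}"

definition Linf :: "'b::euclidean_space set \<Rightarrow> ('b \<Rightarrow> 'c::euclidean_space) set" where
  "Linf S = {f. f \<in> borel_measurable (lebesgue_on S) \<and> (\<exists>C. AE z in lebesgue_on S. norm (f z) \<le> C)}"

text \<open>\<open>C1c S \<phi> D\<close>: the function \<open>\<phi>\<close> is continuously differentiable on the whole space with gradient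
  field \<open>D\<close>, and its support is compact and contained in \<open>S\<close>. For \<open>\<phi>\<close> on space-time,
  \<open>fst (D z)\<close> is the spatial gradient and \<open>snd (D z)\<close> the time derivative.\<close>

definition C1c :: "'b::euclidean_space set \<Rightarrow> ('b \<Rightarrow> real) \<Rightarrow> ('b \<Rightarrow> 'b) \<Rightarrow> bool" where
  "C1c S \<phi> D \<longleftrightarrow>
     (\<forall>z. GDERIV \<phi> z :> D z) \<and> continuous_on UNIV D \<and>
     compact (closure {z. \<phi> z \<noteq> 0}) \<and> closure {z. \<phi> z \<noteq> 0} \<subseteq> S"

definition W1inf :: "'b::euclidean_space set \<Rightarrow> ('b \<Rightarrow> real) set" where
  "W1inf S = {f. f \<in> Linf S \<and>
     (\<exists>g :: 'b \<Rightarrow> 'b. g \<in> Linf S \<and>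
        (\<forall>\<phi> D. C1c S \<phi> D \<longrightarrow> (\<forall>i\<in>Basis.
           (LINT z|lebesgue_on S. f z * (D z \<bullet> i)) = - (LINT z|lebesgue_on S. (g z \<bullet> i) * \<phi> z))))}"

text \<open>\<open>C2bar S f g H\<close>: the function \<open>f\<close> belongs to C^2 of the closure of the open set \<open>S\<close>; it is
  twice differentiable in \<open>S\<close> with gradient \<open>g\<close> and Hessian \<open>H\<close>, and \<open>f\<close>, \<open>g\<close>, \<open>H\<close> are continuous up
  to the boundary.\<close>

definition C2bar ::
  "'a::euclidean_space set \<Rightarrow> ('a \<Rightarrow> real) \<Rightarrow> ('a \<Rightarrow> 'a) \<Rightarrow> ('a \<Rightarrow> 'a \<Rightarrow>\<^sub>L 'a) \<Rightarrow> bool" where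
  "C2bar S f g H \<longleftrightarrow>
     continuous_on (closure S) f \<and> continuous_on (closure S) g \<and> continuous_on (closure S) H \<and>
     (\<forall>x\<in>S. (GDERIV f x :> g x) \<and> (g has_derivative blinfun_apply (H x)) (at x))"

section \<open>Domains\<close>

text \<open>Near each of its boundary points, \<open>\<Omega>\<close> is the region on one side of the graph of a C^2
  function over the hyperplane orthogonal to some unit vector \<open>e\<close>.\<close>

definition C2_boundary :: "'a::euclidean_space set \<Rightarrow> bool" where
  "C2_boundary \<Omega> \<longleftrightarrow>
     (\<forall>x0\<in>frontier \<Omega>. \<exists>r>0. \<exists>e \<gamma> g H. norm e = 1 \<and> C2bar UNIV \<gamma> g H \<and>
        \<Omega> \<inter> ball x0 r = {x \<in> ball x0 r. x \<bullet> e > \<gamma> (x - (x \<bullet> e) *\<^sub>R e)})"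

text \<open>For a set with C^2 boundary the following condition determines \<open>\<nu>\<close>: vectors forming an
  obtuse angle with \<open>\<nu>\<close> point into \<open>\<Omega>\<close>, those forming an acute angle point out of it.\<close>

definition outward_unit_normal :: "'a::euclidean_space set \<Rightarrow> 'a \<Rightarrow> 'a \<Rightarrow> bool" where
  "outward_unit_normal \<Omega> x \<nu> \<longleftrightarrow>
     norm \<nu> = 1 \<and>
     (\<forall>h. h \<bullet> \<nu> < 0 \<longrightarrow> (\<forall>\<^sub>F s in at_right 0. x + s *\<^sub>R h \<in> \<Omega>)) \<and>
     (\<forall>h. h \<bullet> \<nu> > 0 \<longrightarrow> (\<forall>\<^sub>F s in at_right 0. x + s *\<^sub>R h \<notin> closure \<Omega>))"

definition cyl :: "'a set \<Rightarrow> real \<Rightarrow> ('a \<times> real) set" where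
  "cyl \<Omega> T = \<Omega> \<times> {0<..<T}"

section \<open>Weak solutions\<close>

text \<open>\<open>L2H01 \<Omega> T y g\<close>: the function \<open>y\<close> belongs to the space L^2(0,T; H^1_0(\<open>\<Omega>\<close>)) and has spatial
  gradient \<open>g\<close>. The space is taken as the closure of C^1_c(\<open>\<Omega> \<times> (0,T)\<close>) in the norm of
  L^2(0,T; H^1(\<open>\<Omega>\<close>)).\<close>

definition L2H01 ::
  "'a::euclidean_space set \<Rightarrow> real \<Rightarrow> ('a \<times> real \<Rightarrow> real) \<Rightarrow> ('a \<times> real \<Rightarrow> 'a) \<Rightarrow> bool" where
  "L2H01 \<Omega> T y g \<longleftrightarrow>
     y \<in> L2 (cyl \<Omega> T) \<and> g \<in> L2 (cyl \<Omega> T) \<and>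
     (\<exists>\<phi> D. (\<forall>n::nat. C1c (cyl \<Omega> T) (\<phi> n) (D n)) \<and>
        (\<lambda>n. LINT z|lebesgue_on (cyl \<Omega> T). (\<phi> n z - y z)\<^sup>2) \<longlonglongrightarrow> 0 \<and>
        (\<lambda>n. LINT z|lebesgue_on (cyl \<Omega> T). (norm (fst (D n z) - g z))\<^sup>2) \<longlonglongrightarrow> 0)"

text \<open>Weak solution of \<open>\<partial>\<^sub>t y - div (a \<nabla>y) + b y = f\<close> in \<open>\<Omega> \<times> (0,T)\<close>, \<open>y = 0\<close> on the lateral boundary,
  \<open>y(\<cdot>,0) = y0\<close>. The test functions vanish near the lateral boundary and near \<open>t = T\<close>, but not
  necessarily at \<open>t = 0\<close>, so that the integral identity contains the initial condition.\<close>

definition weak_solution ::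
  "'a::euclidean_space set \<Rightarrow> real \<Rightarrow> ('a \<times> real \<Rightarrow> real) \<Rightarrow> ('a \<times> real \<Rightarrow> real) \<Rightarrow>
   ('a \<times> real \<Rightarrow> real) \<Rightarrow> ('a \<Rightarrow> real) \<Rightarrow> ('a \<times> real \<Rightarrow> real) \<Rightarrow> bool" where
  "weak_solution \<Omega> T a b f y0 y \<longleftrightarrow>
     (\<exists>g. L2H01 \<Omega> T y g \<and>
       (\<forall>\<phi> D. C1c (\<Omega> \<times> {..<T}) \<phi> D \<longrightarrow>
          (LINT z|lebesgue_on (cyl \<Omega> T).
             - y z * snd (D z) + a z * (g z \<bullet> fst (D z)) + b z * y z * \<phi> z)
          = (LINT z|lebesgue_on (cyl \<Omega> T). f z * \<phi> z)
            + (LINT x|lebesgue_on \<Omega>. y0 x * \<phi> (x, 0))))"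

text \<open>Weak solution of the backward problem \<open>-\<partial>\<^sub>t z - div (a \<nabla>z) + b z = q\<close>, \<open>z = 0\<close> on the lateral
  boundary, \<open>z(\<cdot>,T) = 0\<close>. Here the test functions need not vanish at \<open>t = T\<close>.\<close>

definition weak_solution_adj ::
  "'a::euclidean_space set \<Rightarrow> real \<Rightarrow> ('a \<times> real \<Rightarrow> real) \<Rightarrow> ('a \<times> real \<Rightarrow> real) \<Rightarrow>
   ('a \<times> real \<Rightarrow> real) \<Rightarrow> ('a \<times> real \<Rightarrow> real) \<Rightarrow> bool" where
  "weak_solution_adj \<Omega> T a b q z \<longleftrightarrow>
     (\<exists>g. L2H01 \<Omega> T z g \<and>
       (\<forall>\<phi> D. C1c (\<Omega> \<times> {0<..}) \<phi> D \<longrightarrow>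
          (LINT w|lebesgue_on (cyl \<Omega> T).
             z w * snd (D w) + a w * (g w \<bullet> fst (D w)) + b w * z w * \<phi> w)
          = (LINT w|lebesgue_on (cyl \<Omega> T). q w * \<phi> w)))"

text \<open>Weak solutions are unique up to null sets; the operators below choose a representative.\<close>

definition Mop ::
  "'a::euclidean_space set \<Rightarrow> 'a set \<Rightarrow> real \<Rightarrow> ('a \<times> real \<Rightarrow> real) \<Rightarrow> ('a \<times> real \<Rightarrow> real) \<Rightarrow>
   ('a \<times> real \<Rightarrow> real) \<Rightarrow> ('a \<times> real \<Rightarrow> real)" where
  "Mop \<Omega> \<omega> T a b v =
     (SOME y. weak_solution \<Omega> T a b (\<lambda>z. if z \<in> cyl \<omega> T then v z else 0) (\<lambda>x. 0) y)"

text \<open>The value of the adjoint is an element of L^2(\<open>\<omega> \<times> (0,T)\<close>): the restriction to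
  \<open>\<omega> \<times> (0,T)\<close> is expressed by extending by 0 from there.\<close>

definition Mop_adj ::
  "'a::euclidean_space set \<Rightarrow> 'a set \<Rightarrow> real \<Rightarrow> ('a \<times> real \<Rightarrow> real) \<Rightarrow> ('a \<times> real \<Rightarrow> real) \<Rightarrow>
   ('a \<times> real \<Rightarrow> real) \<Rightarrow> ('a \<times> real \<Rightarrow> real)" where
  "Mop_adj \<Omega> \<omega> T a b q =
     (let z = (SOME z. weak_solution_adj \<Omega> T a b q z)
      in (\<lambda>w. if w \<in> cyl \<omega> T then z w else 0))"

definition ybar ::
  "'a::euclidean_space set \<Rightarrow> real \<Rightarrow> ('a \<times> real \<Rightarrow> real) \<Rightarrow> ('a \<times> real \<Rightarrow> real) \<Rightarrow>
   ('a \<Rightarrow> real) \<Rightarrow> ('a \<times> real \<Rightarrow> real)" where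
  "ybar \<Omega> T a b y0 = (SOME y. weak_solution \<Omega> T a b (\<lambda>z. 0) y0 y)"

section \<open>Carleman weights\<close>

definition carleman_eta :: "'a::euclidean_space set \<Rightarrow> 'a set \<Rightarrow> ('a \<Rightarrow> real) \<Rightarrow> bool" where
  "carleman_eta \<Omega> \<omega> \<eta> \<longleftrightarrow>
     (\<exists>g H. C2bar \<Omega> \<eta> g H \<and>
        (\<forall>x\<in>frontier \<Omega>. \<eta> x = 0) \<and>
        (\<forall>x\<in>\<Omega> - closure \<omega>. norm (g x) > 0) \<and>
        (\<forall>x\<in>frontier \<Omega>. \<forall>\<nu>. outward_unit_normal \<Omega> x \<nu> \<longrightarrow> g x \<bullet> \<nu> < 0))"

definition carleman_alpha :: "real \<Rightarrow> real \<Rightarrow> real \<Rightarrow> ('a \<Rightarrow> real) \<Rightarrow> 'a \<times> real \<Rightarrow> real" where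
  "carleman_alpha K1 K2 T \<eta> = (\<lambda>(x, t). K1 * (exp K2 - exp (\<eta> x)) / (T - t))"

definition carleman_rho :: "real \<Rightarrow> real \<Rightarrow> real \<Rightarrow> ('a \<Rightarrow> real) \<Rightarrow> 'a \<times> real \<Rightarrow> real" where
  "carleman_rho K1 K2 T \<eta> = (\<lambda>z. exp (carleman_alpha K1 K2 T \<eta> z))"

definition carleman_rho0 :: "real \<Rightarrow> real \<Rightarrow> real \<Rightarrow> ('a \<Rightarrow> real) \<Rightarrow> 'a \<times> real \<Rightarrow> real" where
  "carleman_rho0 K1 K2 T \<eta> = (\<lambda>z. (T - snd z) powr (3/2) * carleman_rho K1 K2 T \<eta> z)"

definition rho_trunc :: "real \<Rightarrow> ('b \<Rightarrow> real) \<Rightarrow> 'b \<Rightarrow> real" where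
  "rho_trunc R \<rho> = (\<lambda>z. min R (\<rho> z))"

section \<open>Lagrangians and saddle points\<close>

definition Uspace ::
  "'a::euclidean_space set \<Rightarrow> real \<Rightarrow> ('a \<times> real \<Rightarrow> real) \<Rightarrow> ('a \<times> real \<Rightarrow> real) set" where
  "Uspace \<omega> T \<rho>0 = {v \<in> L2 (cyl \<omega> T). (\<lambda>z. \<rho>0 z * v z) \<in> L2 (cyl \<omega> T)}"

definition Lagr ::
  "'a::euclidean_space set \<Rightarrow> 'a set \<Rightarrow> real \<Rightarrow> ('a \<times> real \<Rightarrow> real) \<Rightarrow> ('a \<times> real \<Rightarrow> real) \<Rightarrow>
   ('a \<Rightarrow> real) \<Rightarrow> ('a \<times> real \<Rightarrow> real) \<Rightarrow> ('a \<times> real \<Rightarrow> real) \<Rightarrow> real \<Rightarrow>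
   ('a \<times> real \<Rightarrow> real) \<Rightarrow> ('a \<times> real \<Rightarrow> real) \<Rightarrow> ('a \<times> real \<Rightarrow> real) \<Rightarrow> real" where
  "Lagr \<Omega> \<omega> T a b y0 \<rho> \<rho>0 R y v q =
     1/2 * (LINT z|lebesgue_on (cyl \<Omega> T). (rho_trunc R \<rho> z)\<^sup>2 * \<bar>y z\<bar>\<^sup>2)
     + 1/2 * (LINT z|lebesgue_on (cyl \<omega> T). (\<rho>0 z)\<^sup>2 * \<bar>v z\<bar>\<^sup>2)
     - (LINT z|lebesgue_on (cyl \<Omega> T). q z * (Mop \<Omega> \<omega> T a b v z + ybar \<Omega> T a b y0 z - y z))"

definition Lagr_aug ::
  "'a::euclidean_space set \<Rightarrow> 'a set \<Rightarrow> real \<Rightarrow> ('a \<times> real \<Rightarrow> real) \<Rightarrow> ('a \<times> real \<Rightarrow> real) \<Rightarrow>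
   ('a \<Rightarrow> real) \<Rightarrow> ('a \<times> real \<Rightarrow> real) \<Rightarrow> ('a \<times> real \<Rightarrow> real) \<Rightarrow> real \<Rightarrow> real \<Rightarrow>
   ('a \<times> real \<Rightarrow> real) \<Rightarrow> ('a \<times> real \<Rightarrow> real) \<Rightarrow> ('a \<times> real \<Rightarrow> real) \<Rightarrow> real" where
  "Lagr_aug \<Omega> \<omega> T a b y0 \<rho> \<rho>0 R K y v q =
     Lagr \<Omega> \<omega> T a b y0 \<rho> \<rho>0 R y v q
     + K/2 * (LINT z|lebesgue_on (cyl \<Omega> T).
                (Mop \<Omega> \<omega> T a b v z + ybar \<Omega> T a b y0 z - y z)\<^sup>2)"

definition saddle_point ::
  "'y set \<Rightarrow> 'v set \<Rightarrow> 'q set \<Rightarrow> ('y \<Rightarrow> 'v \<Rightarrow> 'q \<Rightarrow> real) \<Rightarrow> 'y \<Rightarrow> 'v \<Rightarrow> 'q \<Rightarrow> bool" where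
  "saddle_point Y V P L y v q \<longleftrightarrow>
     y \<in> Y \<and> v \<in> V \<and> q \<in> P \<and>
     (\<forall>p\<in>P. L y v p \<le> L y v q) \<and> (\<forall>z\<in>Y. \<forall>w\<in>V. L y v q \<le> L z w q)"

end

theory Submission
  imports Defs
begin

text \<open>
  For every \<open>K \<ge> 0\<close> the saddle points of the augmented Lagrangian are characterised by the same
  optimality system: the constraint \<open>Mv + ybar = y\<close> (supremum over \<open>q\<close>) together with
  \<open>\<rho>\<^sub>R\<^sup>2 y + q = 0\<close> and \<open>\<rho>\<^sub>0\<^sup>2 v = M\<^sup>*q\<close> (infimum over \<open>(y, v)\<close>; the augmentation is of second order on the
  constraint set). Eliminating \<open>y\<close> and \<open>v\<close> leaves the dual equation
  \<open>M(\<rho>\<^sub>0\<^sup>-\<^sup>2 M\<^sup>*q) + \<rho>\<^sub>R\<^sup>-\<^sup>2 q = - ybar\<close>, which is symmetric and coercive because \<open>\<rho>\<^sub>R\<close> is bounded, so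
  that it is solved by the Riesz representation theorem.

  Weak solutions exist by Lions' projection argument. That \<open>M\<close> and \<open>M\<^sup>*\<close> are adjoint is shown by
  testing the forward equation with forward Steklov averages of the adjoint state, and the adjoint
  equation with backward averages of the state: the difference quotients in time agree exactly, and
  letting the averaging length tend to \<open>0\<close> gives the identity. The adjoint relation in turn makes \<open>M\<close>
  and \<open>M\<^sup>*\<close> linear up to null sets, whatever representatives the choice operators select.
\<close>

section \<open>Square-integrable functions\<close>

text \<open>Elements of \<open>L2 S\<close> are functions and not classes, so \<open>ip\<close> is
  only a semi-inner product and each Hilbert space argument is carried out with identities almost
  everywhere. The main obstacle is the adjoint relation: a state has a spatial gradient but no
  square-integrable time derivative, so it is not an admissible test function for the other
  equation. Integration by parts in time is replaced by difference quotients, for which it is just a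
  change of variables once the states are extended by zero. Averaging a test function forward in
  time keeps its support below t = T but may push it past t = 0; the zero initial value of the state
  removes the trace term that then arises. The adjoint equation is not treated separately but as the
  forward equation with coefficients reversed in time. For existence, the bilinear form is not
  coercive on the diagonal when b is negative; a multiplier exp (l t), with l chosen against the
  bound of b, restores positivity.\<close>

definition ip :: "'b::euclidean_space set \<Rightarrow> ('b \<Rightarrow> 'c::euclidean_space) \<Rightarrow> ('b \<Rightarrow> 'c) \<Rightarrow> real" where
  "ip S f g = (LINT z|lebesgue_on S. f z \<bullet> g z)"

definition l2norm :: "'b::euclidean_space set \<Rightarrow> ('b \<Rightarrow> 'c::euclidean_space) \<Rightarrow> real" where
  "l2norm S f = sqrt (ip S f f)"

text \<open>Membership in \<open>L2 S\<close> is demanded explicitly because the integral of a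
  non-integrable function is 0 by default, so that a small \<open>l2norm\<close> alone would carry
  no information.\<close>

definition l2lim :: "'b::euclidean_space set \<Rightarrow> (nat \<Rightarrow> 'b \<Rightarrow> 'c::euclidean_space) \<Rightarrow> ('b \<Rightarrow> 'c) \<Rightarrow> bool" where
  "l2lim S f u \<longleftrightarrow> (\<forall>n. f n \<in> L2 S) \<and> u \<in> L2 S \<and> (\<lambda>n. l2norm S (\<lambda>z. f n z - u z)) \<longlonglongrightarrow> 0"

lemma L2_measurable: "f \<in> L2 S \<Longrightarrow> f \<in> borel_measurable (lebesgue_on S)"
  by (simp add: L2_def)

lemma L2_integrable: "f \<in> L2 S \<Longrightarrow> integrable (lebesgue_on S) (\<lambda>z. f z \<bullet> f z)"
  by (simp add: L2_def power2_norm_eq_inner)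

lemma L2I:
  "f \<in> borel_measurable (lebesgue_on S) \<Longrightarrow> integrable (lebesgue_on S) (\<lambda>z. f z \<bullet> f z) \<Longrightarrow> f \<in> L2 S"
  by (simp add: L2_def power2_norm_eq_inner)

lemma L2_integrable_inner:
  fixes f g :: "'b::euclidean_space \<Rightarrow> 'c::euclidean_space"
  assumes "f \<in> L2 S" "g \<in> L2 S"
  shows "integrable (lebesgue_on S) (\<lambda>z. f z \<bullet> g z)"
proof (rule Bochner_Integration.integrable_bound)
  show "integrable (lebesgue_on S) (\<lambda>z. f z \<bullet> f z + g z \<bullet> g z)"
    using assms by (intro Bochner_Integration.integrable_add L2_integrable)
  show "(\<lambda>z. f z \<bullet> g z) \<in> borel_measurable (lebesgue_on S)"
    using assms[THEN L2_measurable] by measurable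
  have "\<bar>x \<bullet> y\<bar> \<le> x \<bullet> x + y \<bullet> y" for x y :: 'c
  proof -
    have "\<bar>x \<bullet> y\<bar> \<le> norm x * norm y" by (rule Cauchy_Schwarz_ineq2)
    also have "\<dots> \<le> norm x ^ 2 + norm y ^ 2"
    proof -
      have "0 \<le> norm x * norm y" by simp
      with sum_squares_bound[of "norm x" "norm y"] show ?thesis unfolding mult.assoc by linarith
    qed
    finally show ?thesis by (simp add: power2_norm_eq_inner)
  qed
  then show "AE z in lebesgue_on S. norm (f z \<bullet> g z) \<le> norm (f z \<bullet> f z + g z \<bullet> g z)"
    by (smt (verit) AE_I2 inner_ge_zero real_norm_def)
qed

lemma L2_add:
  fixes f g :: "'b::euclidean_space \<Rightarrow> 'c::euclidean_space"
  assumes "f \<in> L2 S" "g \<in> L2 S"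
  shows "(\<lambda>z. f z + g z) \<in> L2 S"
proof (rule L2I)
  show "(\<lambda>z. f z + g z) \<in> borel_measurable (lebesgue_on S)"
    using assms[THEN L2_measurable] by measurable
  have "integrable (lebesgue_on S) (\<lambda>z. f z \<bullet> f z + g z \<bullet> f z + (f z \<bullet> g z + g z \<bullet> g z))"
    using assms by (intro Bochner_Integration.integrable_add L2_integrable_inner)
  then show "integrable (lebesgue_on S) (\<lambda>z. (f z + g z) \<bullet> (f z + g z))"
    by (simp add: inner_add_left inner_add_right)
qed

lemma L2_mult_bounded:
  fixes f :: "'b::euclidean_space \<Rightarrow> 'c::euclidean_space" and k :: "'b \<Rightarrow> real"
  assumes f: "f \<in> L2 S" and k: "k \<in> borel_measurable (lebesgue_on S)"
    and B: "AE z in lebesgue_on S. \<bar>k z\<bar> \<le> B"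
  shows "(\<lambda>z. k z *\<^sub>R f z) \<in> L2 S"
proof (rule L2I)
  show m: "(\<lambda>z. k z *\<^sub>R f z) \<in> borel_measurable (lebesgue_on S)"
    using k f[THEN L2_measurable] by measurable
  show "integrable (lebesgue_on S) (\<lambda>z. k z *\<^sub>R f z \<bullet> k z *\<^sub>R f z)"
  proof (rule Bochner_Integration.integrable_bound)
    show "integrable (lebesgue_on S) (\<lambda>z. B\<^sup>2 * (f z \<bullet> f z))"
      using f by (intro integrable_mult_right L2_integrable)
    show "(\<lambda>z. k z *\<^sub>R f z \<bullet> k z *\<^sub>R f z) \<in> borel_measurable (lebesgue_on S)"
      using m by measurable
    show "AE z in lebesgue_on S. norm (k z *\<^sub>R f z \<bullet> k z *\<^sub>R f z) \<le> norm (B\<^sup>2 * (f z \<bullet> f z))"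
      using B
    proof eventually_elim
      case (elim z)
      then have "(k z)\<^sup>2 \<le> B\<^sup>2"
        by (metis abs_ge_zero abs_le_square_iff abs_of_nonneg order_trans)
      then have "(k z)\<^sup>2 * (f z \<bullet> f z) \<le> B\<^sup>2 * (f z \<bullet> f z)"
        by (intro mult_right_mono) auto
      moreover have "0 \<le> (k z)\<^sup>2 * (f z \<bullet> f z)" by simp
      ultimately have "norm ((k z)\<^sup>2 * (f z \<bullet> f z)) \<le> norm (B\<^sup>2 * (f z \<bullet> f z))"
        unfolding real_norm_def by (simp only: abs_of_nonneg order_trans)
      then show ?case by (simp add: power2_eq_square mult.assoc)
    qed
  qed
qed

lemma L2_mult_bounded_real:
  fixes f k :: "'b::euclidean_space \<Rightarrow> real"
  assumes "f \<in> L2 S" "k \<in> borel_measurable (lebesgue_on S)"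
    and "AE z in lebesgue_on S. \<bar>k z\<bar> \<le> B"
  shows "(\<lambda>z. k z * f z) \<in> L2 S"
  using L2_mult_bounded[OF assms] by simp

lemma L2_scaleR:
  fixes f :: "'b::euclidean_space \<Rightarrow> 'c::euclidean_space"
  shows "f \<in> L2 S \<Longrightarrow> (\<lambda>z. c *\<^sub>R f z) \<in> L2 S"
  by (rule L2_mult_bounded[where B = "\<bar>c\<bar>"]) auto

lemma L2_cmult:
  fixes f :: "'b::euclidean_space \<Rightarrow> real"
  shows "f \<in> L2 S \<Longrightarrow> (\<lambda>z. c * f z) \<in> L2 S"
  using L2_scaleR[of f S c] by simp

lemma L2_minus:
  fixes f :: "'b::euclidean_space \<Rightarrow> 'c::euclidean_space"
  shows "f \<in> L2 S \<Longrightarrow> (\<lambda>z. - f z) \<in> L2 S"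
  using L2_scaleR[of f S "-1"] by simp

lemma L2_diff:
  fixes f g :: "'b::euclidean_space \<Rightarrow> 'c::euclidean_space"
  shows "f \<in> L2 S \<Longrightarrow> g \<in> L2 S \<Longrightarrow> (\<lambda>z. f z - g z) \<in> L2 S"
  using L2_add[of f S "\<lambda>z. - g z"] L2_minus[of g S] by simp

lemma L2_zero: "(\<lambda>z. 0) \<in> L2 S"
  by (rule L2I) auto

lemma L2_lincomb:
  fixes f g :: "'b::euclidean_space \<Rightarrow> 'c::euclidean_space"
  shows "f \<in> L2 S \<Longrightarrow> g \<in> L2 S \<Longrightarrow> (\<lambda>z. f z + c *\<^sub>R g z) \<in> L2 S"
  by (intro L2_add L2_scaleR)

lemmas L2_intros = L2_add L2_diff L2_minus L2_scaleR L2_cmult L2_zero L2_lincomb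

lemma L2_cong_AE:
  fixes f g :: "'b::euclidean_space \<Rightarrow> 'c::euclidean_space"
  assumes "f \<in> L2 S" "g \<in> borel_measurable (lebesgue_on S)" "AE z in lebesgue_on S. f z = g z"
  shows "g \<in> L2 S"
proof (rule L2I)
  show "integrable (lebesgue_on S) (\<lambda>z. g z \<bullet> g z)"
    using assms L2_integrable[of f S] L2_measurable[OF assms(1)]
    by (subst integrable_cong_AE[where g = "\<lambda>z. f z \<bullet> f z"]) auto
qed (use assms in auto)

text \<open>Its purpose is to treat a function and its spatial gradient as one function with values
  in a product space: the energy norm of y is then the \<open>l2norm\<close> of the pair.\<close>

lemma L2_Pair:
  fixes f :: "'b::euclidean_space \<Rightarrow> 'c::euclidean_space" and g :: "'b \<Rightarrow> 'd::euclidean_space"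
  shows "(\<lambda>z. (f z, g z)) \<in> L2 S \<longleftrightarrow> f \<in> L2 S \<and> g \<in> L2 S"
proof safe
  assume h: "(\<lambda>z. (f z, g z)) \<in> L2 S"
  have m: "f \<in> borel_measurable (lebesgue_on S)" "g \<in> borel_measurable (lebesgue_on S)"
    using measurable_compose[OF L2_measurable[OF h], of fst borel]
      measurable_compose[OF L2_measurable[OF h], of snd borel]
    by (auto simp: borel_measurable_continuous_onI continuous_on_fst continuous_on_snd)
  have i: "integrable (lebesgue_on S) (\<lambda>z. f z \<bullet> f z + g z \<bullet> g z)"
    using L2_integrable[OF h] by simp
  show "f \<in> L2 S"
    by (rule L2I[OF m(1)], rule Bochner_Integration.integrable_bound[OF i]) (use m in auto)
  show "g \<in> L2 S"
    by (rule L2I[OF m(2)], rule Bochner_Integration.integrable_bound[OF i]) (use m in auto)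
next
  assume f: "f \<in> L2 S" and g: "g \<in> L2 S"
  show "(\<lambda>z. (f z, g z)) \<in> L2 S"
    using L2_integrable[OF f] L2_integrable[OF g] L2_measurable[OF f] L2_measurable[OF g]
    by (intro L2I) auto
qed

section \<open>Algebra of the semi-inner product and its norm\<close>

lemma ip_real: "ip S f g = (LINT z|lebesgue_on S. f z * g z)" for f g :: "'b::euclidean_space \<Rightarrow> real"
  by (simp add: ip_def)

lemma ip_commute: "ip S f g = ip S g f"
  by (simp add: ip_def inner_commute)

lemma ip_cong_AE:
  fixes f f' g g' :: "'b::euclidean_space \<Rightarrow> 'c::euclidean_space"
  assumes "AE z in lebesgue_on S. f z = f' z" "AE z in lebesgue_on S. g z = g' z"
    "f \<in> L2 S" "g \<in> L2 S" "f' \<in> L2 S" "g' \<in> L2 S"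
  shows "ip S f g = ip S f' g'"
  unfolding ip_def
proof (rule integral_cong_AE)
  show "AE z in lebesgue_on S. f z \<bullet> g z = f' z \<bullet> g' z"
    using assms(1,2) by eventually_elim simp
qed (use assms(3-)[THEN L2_measurable] in measurable)

lemma ip_add_left:
  fixes f g h :: "'b::euclidean_space \<Rightarrow> 'c::euclidean_space"
  shows "f \<in> L2 S \<Longrightarrow> g \<in> L2 S \<Longrightarrow> h \<in> L2 S \<Longrightarrow> ip S (\<lambda>z. f z + g z) h = ip S f h + ip S g h"
  by (simp add: ip_def inner_add_left L2_integrable_inner)

lemma ip_diff_left:
  fixes f g h :: "'b::euclidean_space \<Rightarrow> 'c::euclidean_space"
  shows "f \<in> L2 S \<Longrightarrow> g \<in> L2 S \<Longrightarrow> h \<in> L2 S \<Longrightarrow> ip S (\<lambda>z. f z - g z) h = ip S f h - ip S g h"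
  by (simp add: ip_def inner_diff_left L2_integrable_inner)

lemma ip_scaleR_left: "ip S (\<lambda>z. c *\<^sub>R f z) h = c * ip S f h"
  by (simp add: ip_def)

lemma ip_minus_left: "ip S (\<lambda>z. - f z) h = - ip S f h"
  by (simp add: ip_def)

lemma ip_cmult_left: "ip S (\<lambda>z. c * f z) h = c * ip S f h" for f h :: "'b::euclidean_space \<Rightarrow> real"
  by (simp add: ip_def mult.assoc)

lemma ip_zero_left: "ip S (\<lambda>z. 0) h = 0"
  by (simp add: ip_def)

lemmas ip_left = ip_add_left ip_diff_left ip_scaleR_left ip_minus_left ip_cmult_left ip_zero_left

lemma ip_add_right:
  fixes f g h :: "'b::euclidean_space \<Rightarrow> 'c::euclidean_space"
  shows "f \<in> L2 S \<Longrightarrow> g \<in> L2 S \<Longrightarrow> h \<in> L2 S \<Longrightarrow> ip S h (\<lambda>z. f z + g z) = ip S h f + ip S h g"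
  by (simp add: ip_def inner_add_right L2_integrable_inner)

lemma ip_diff_right:
  fixes f g h :: "'b::euclidean_space \<Rightarrow> 'c::euclidean_space"
  shows "f \<in> L2 S \<Longrightarrow> g \<in> L2 S \<Longrightarrow> h \<in> L2 S \<Longrightarrow> ip S h (\<lambda>z. f z - g z) = ip S h f - ip S h g"
  by (simp add: ip_def inner_diff_right L2_integrable_inner)

lemma ip_scaleR_right: "ip S h (\<lambda>z. c *\<^sub>R f z) = c * ip S h f"
  by (simp add: ip_def)

lemma ip_minus_right: "ip S h (\<lambda>z. - f z) = - ip S h f"
  by (simp add: ip_def)

lemma ip_cmult_right: "ip S h (\<lambda>z. c * f z) = c * ip S h f" for f h :: "'b::euclidean_space \<Rightarrow> real"
  by (simp add: ip_def mult.left_commute)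

lemma ip_zero_right: "ip S h (\<lambda>z. 0) = 0"
  by (simp add: ip_def)

lemmas ip_right = ip_add_right ip_diff_right ip_scaleR_right ip_minus_right ip_cmult_right ip_zero_right

lemma ip_nonneg: "0 \<le> ip S f f"
  by (auto simp: ip_def intro!: integral_nonneg_AE)

lemma l2norm_nonneg [simp]: "0 \<le> l2norm S f"
  by (simp add: l2norm_def ip_nonneg)

lemma l2norm_square: "(l2norm S f)\<^sup>2 = ip S f f"
  by (simp add: l2norm_def ip_nonneg)

lemma ip_lincomb_square:
  fixes f g :: "'b::euclidean_space \<Rightarrow> 'c::euclidean_space"
  assumes "f \<in> L2 S" "g \<in> L2 S"
  shows "ip S (\<lambda>z. f z + c *\<^sub>R g z) (\<lambda>z. f z + c *\<^sub>R g z) = ip S f f + 2 * c * ip S f g + c\<^sup>2 * ip S g g"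
proof -
  have "ip S (\<lambda>z. f z + c *\<^sub>R g z) (\<lambda>z. f z + c *\<^sub>R g z)
      = ip S f (\<lambda>z. f z + c *\<^sub>R g z) + c * ip S g (\<lambda>z. f z + c *\<^sub>R g z)"
    using assms by (simp add: ip_left L2_intros)
  also have "ip S f (\<lambda>z. f z + c *\<^sub>R g z) = ip S f f + c * ip S f g"
    using assms by (subst ip_commute) (simp add: ip_left L2_intros ip_commute[of S g])
  also have "ip S g (\<lambda>z. f z + c *\<^sub>R g z) = ip S f g + c * ip S g g"
    using assms by (subst ip_commute) (simp add: ip_left L2_intros)
  finally show ?thesis by (simp add: algebra_simps power2_eq_square)
qed

text \<open>Besides the Cauchy-Schwarz inequality, this serves every minimality argument below: with
  a = 0 it forces b = 0, that is, the first variation at a minimum vanishes.\<close>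

lemma nonneg_quadratic_discriminant:
  fixes a b c :: real
  assumes "\<And>t. 0 \<le> a + 2 * t * b + t\<^sup>2 * c" "0 \<le> c"
  shows "b\<^sup>2 \<le> a * c"
proof (cases "c = 0")
  case True
  have "b = 0"
  proof (rule ccontr)
    assume "b \<noteq> 0"
    \<comment> \<open>For c = 0 the expression is affine in t, and this t gives it the value
      -1.\<close>
    then have "2 * (- (a + 1) / (2 * b)) * b = - (a + 1)" by (simp add: field_simps)
    then show False using assms(1)[of "- (a + 1) / (2 * b)"] True by simp
  qed
  then show ?thesis using True by simp
next
  case False
  then have "c > 0" using assms by simp
  have "0 \<le> a + 2 * (- b / c) * b + (- b / c)\<^sup>2 * c" by (rule assms)
  also have "\<dots> = a - b\<^sup>2 / c"
    using False by (simp add: power2_eq_square field_simps)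
  finally show ?thesis using \<open>c > 0\<close> by (simp add: field_simps)
qed

lemma ip_Cauchy_Schwarz:
  fixes f g :: "'b::euclidean_space \<Rightarrow> 'c::euclidean_space"
  assumes "f \<in> L2 S" "g \<in> L2 S"
  shows "\<bar>ip S f g\<bar> \<le> l2norm S f * l2norm S g"
proof -
  have "(ip S f g)\<^sup>2 \<le> ip S f f * ip S g g"
  proof (rule nonneg_quadratic_discriminant)
    show "0 \<le> ip S f f + 2 * t * ip S f g + t\<^sup>2 * ip S g g" for t
      using ip_nonneg[of S "\<lambda>z. f z + t *\<^sub>R g z"] ip_lincomb_square[OF assms, of t] by simp
  qed (rule ip_nonneg)
  then have "(ip S f g)\<^sup>2 \<le> (l2norm S f * l2norm S g)\<^sup>2"
    by (simp add: l2norm_square power_mult_distrib)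
  then show ?thesis
    by (metis abs_le_square_iff abs_of_nonneg l2norm_nonneg mult_nonneg_nonneg)
qed

lemma l2norm_scaleR: "l2norm S (\<lambda>z. c *\<^sub>R f z) = \<bar>c\<bar> * l2norm S f"
  by (simp add: l2norm_def ip_def real_sqrt_mult mult.assoc[symmetric])

lemma l2norm_minus_commute: "l2norm S (\<lambda>z. f z - g z) = l2norm S (\<lambda>z. g z - f z)"
  using l2norm_scaleR[of S "-1" "\<lambda>z. f z - g z"] by simp

lemma l2norm_triangle:
  fixes f g :: "'b::euclidean_space \<Rightarrow> 'c::euclidean_space"
  assumes "f \<in> L2 S" "g \<in> L2 S"
  shows "l2norm S (\<lambda>z. f z + g z) \<le> l2norm S f + l2norm S g"
proof (rule power2_le_imp_le)
  have "(l2norm S (\<lambda>z. f z + g z))\<^sup>2 = ip S f f + 2 * ip S f g + ip S g g"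
    using ip_lincomb_square[OF assms, of 1] by (simp add: l2norm_square)
  also have "\<dots> \<le> (l2norm S f + l2norm S g)\<^sup>2"
    using ip_Cauchy_Schwarz[OF assms] by (simp add: l2norm_square power2_sum)
  finally show "(l2norm S (\<lambda>z. f z + g z))\<^sup>2 \<le> (l2norm S f + l2norm S g)\<^sup>2" .
qed simp

lemma l2norm_diff_triangle:
  fixes f g h :: "'b::euclidean_space \<Rightarrow> 'c::euclidean_space"
  assumes "f \<in> L2 S" "g \<in> L2 S" "h \<in> L2 S"
  shows "l2norm S (\<lambda>z. f z - h z) \<le> l2norm S (\<lambda>z. f z - g z) + l2norm S (\<lambda>z. g z - h z)"
  using l2norm_triangle[of "\<lambda>z. f z - g z" S "\<lambda>z. g z - h z"] assms by (simp add: L2_intros)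

lemma l2norm_eq_0_AE:
  fixes f :: "'b::euclidean_space \<Rightarrow> 'c::euclidean_space"
  assumes "f \<in> L2 S" "ip S f f \<le> 0"
  shows "AE z in lebesgue_on S. f z = 0"
proof -
  have "ip S f f = 0" using assms(2) ip_nonneg[of S f] by simp
  then have "AE z in lebesgue_on S. f z \<bullet> f z = 0"
    unfolding ip_def using integral_nonneg_eq_0_iff_AE[OF L2_integrable[OF assms(1)]] by simp
  then show ?thesis by simp
qed

section \<open>Mean-square limits, completeness and representation of functionals\<close>

lemma l2lim_ip:
  fixes f :: "nat \<Rightarrow> 'b::euclidean_space \<Rightarrow> 'c::euclidean_space"
  assumes f: "l2lim S f u" and g: "g \<in> L2 S"
  shows "(\<lambda>n. ip S (f n) g) \<longlonglongrightarrow> ip S u g"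
proof (rule LIM_zero_cancel, rule Lim_null_comparison)
  have L: "f n \<in> L2 S" "u \<in> L2 S" for n using f by (auto simp: l2lim_def)
  show "\<forall>\<^sub>F n in sequentially. norm (ip S (f n) g - ip S u g) \<le> l2norm S (\<lambda>z. f n z - u z) * l2norm S g"
    using ip_Cauchy_Schwarz[of "\<lambda>z. f n z - u z" S g for n] g L
    by (auto simp: ip_left L2_intros)
  show "(\<lambda>n. l2norm S (\<lambda>z. f n z - u z) * l2norm S g) \<longlonglongrightarrow> 0"
    using f by (intro tendsto_mult_left_zero) (simp add: l2lim_def)
qed

lemma l2lim_norm:
  fixes f :: "nat \<Rightarrow> 'b::euclidean_space \<Rightarrow> 'c::euclidean_space"
  assumes f: "l2lim S f u"
  shows "(\<lambda>n. l2norm S (f n)) \<longlonglongrightarrow> l2norm S u"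
proof (rule LIM_zero_cancel, rule Lim_null_comparison)
  have L: "f n \<in> L2 S" "u \<in> L2 S" for n using f by (auto simp: l2lim_def)
  have "\<bar>l2norm S (f n) - l2norm S u\<bar> \<le> l2norm S (\<lambda>z. f n z - u z)" for n
    using l2norm_triangle[of "\<lambda>z. f n z - u z" S u] l2norm_triangle[of "\<lambda>z. u z - f n z" S "f n"] L
      l2norm_minus_commute[of S u "f n"]
    by (auto simp: L2_intros)
  then show "\<forall>\<^sub>F n in sequentially. norm (l2norm S (f n) - l2norm S u) \<le> l2norm S (\<lambda>z. f n z - u z)"
    by simp
  show "(\<lambda>n. l2norm S (\<lambda>z. f n z - u z)) \<longlonglongrightarrow> 0" using f by (simp add: l2lim_def)
qed

text \<open>Riesz-Fischer: a rapidly converging subsequence converges almost everywhere, and Fatou's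
  lemma turns the pointwise limit into a limit in mean square.\<close>

lemma L2_complete:
  fixes f :: "nat \<Rightarrow> 'b::euclidean_space \<Rightarrow> 'c::euclidean_space"
  assumes L: "\<And>n. f n \<in> L2 S"
    and C: "\<And>e. e > 0 \<Longrightarrow> \<exists>N. \<forall>m\<ge>N. \<forall>n\<ge>N. l2norm S (\<lambda>z. f m z - f n z) \<le> e"
  shows "\<exists>u. l2lim S f u"
proof -
  let ?M = "lebesgue_on S"
  have [measurable]: "f n \<in> borel_measurable ?M" for n using L2_measurable[OF L] .
  have nn: "(\<integral>\<^sup>+z. ennreal ((norm (g z))\<^sup>2) \<partial>?M) = ennreal ((l2norm S g)\<^sup>2)" if "g \<in> L2 S" for g :: "'b \<Rightarrow> 'c"
    unfolding l2norm_square ip_def power2_norm_eq_inner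
    by (rule nn_integral_eq_integral) (use L2_integrable[OF that] in auto)
  \<comment> \<open>With the rate (1/4)^k the squared increments, weighted by 4^k, have integrals at
    most (1/4)^k and hence a finite sum. Pointwise this bounds the k-th increment by a multiple of
    (1/2)^k. Working with squares throughout makes the argument valid on sets of infinite
    measure.\<close>
  have "\<forall>k. \<exists>N. \<forall>m\<ge>N. \<forall>n\<ge>N. l2norm S (\<lambda>z. f m z - f n z) \<le> (1/4)^k"
    by (intro allI C) simp
  then obtain N where N: "\<And>k m n. m \<ge> N k \<Longrightarrow> n \<ge> N k \<Longrightarrow> l2norm S (\<lambda>z. f m z - f n z) \<le> (1/4)^k"
    by metis
  \<comment> \<open>The sum makes \<open>r j\<close> at least \<open>N k\<close> for all k up to j;
    the summand k makes \<open>r\<close> tend to infinity.\<close>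
  define r where "r k = (\<Sum>j\<le>k. N j) + k" for k
  have rN: "r j \<ge> N k" if "k \<le> j" for j k
    unfolding r_def using that by (intro trans_le_add1 member_le_sum) auto
  define d where "d k z = f (r (Suc k)) z - f (r k) z" for k z
  have [measurable]: "d k \<in> borel_measurable ?M" for k
    unfolding d_def by measurable
  have dL: "d k \<in> L2 S" for k
    using L2_diff[OF L L, of "r (Suc k)" "r k"] by (simp add: d_def[abs_def])
  have dn: "l2norm S (d k) \<le> (1/4)^k" for k
    using N[OF rN[of k "Suc k"] rN[of k k]] by (simp add: d_def[abs_def])
  have "(\<integral>\<^sup>+z. (\<Sum>k. ennreal (4^k * (norm (d k z))\<^sup>2)) \<partial>?M) = (\<Sum>k. \<integral>\<^sup>+z. ennreal (4^k * (norm (d k z))\<^sup>2) \<partial>?M)"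
    by (rule nn_integral_suminf) measurable
  also have "\<dots> = (\<Sum>k. ennreal (4^k * (l2norm S (d k))\<^sup>2))"
    by (simp add: ennreal_mult nn_integral_cmult nn dL)
  also have "\<dots> \<le> (\<Sum>k. ennreal ((1/4)^k))"
  proof (intro suminf_le ennreal_leI)
    fix k :: nat
    have "(l2norm S (d k))\<^sup>2 \<le> ((1/4)^k)\<^sup>2" using dn by (intro power_mono) auto
    then have "4^k * (l2norm S (d k))\<^sup>2 \<le> 4^k * ((1/4)^k)\<^sup>2" by (intro mult_left_mono) auto
    also have "\<dots> = (1/4::real)^k"
      by (simp add: power2_eq_square power_one_over)
    finally show "4^k * (l2norm S (d k))\<^sup>2 \<le> (1/4)^k" .
  qed auto
  also have "\<dots> < \<infinity>"
    by (subst suminf_ennreal2) (auto intro: summable_geometric)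
  finally have fin: "AE z in ?M. (\<Sum>k. ennreal (4^k * (norm (d k z))\<^sup>2)) \<noteq> \<infinity>"
    by (intro nn_integral_PInf_AE) auto
  have term_le: "g k \<le> (\<Sum>k. g k)" for g :: "nat \<Rightarrow> ennreal" and k
    using sum_le_suminf[OF summableI, of "{k}" g] by simp
  \<comment> \<open>Where the subsequence diverges, \<open>lim\<close> is unspecified;
    \<open>u\<close> is measurable all the same, and the divergence set is null.\<close>
  define u where "u z = lim (\<lambda>k. f (r k) z)" for z
  have [measurable]: "u \<in> borel_measurable ?M"
    unfolding u_def[abs_def] by (intro borel_measurable_lim_metric) measurable
  have conv: "AE z in ?M. (\<lambda>k. f (r k) z) \<longlonglongrightarrow> u z"
    using fin
  proof eventually_elim
    case (elim z)
    define B where "B = enn2real (\<Sum>k. ennreal (4^k * (norm (d k z))\<^sup>2))"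
    have B: "0 \<le> B" "(\<Sum>k. ennreal (4^k * (norm (d k z))\<^sup>2)) = ennreal B"
      using elim ennreal_enn2real[of "\<Sum>k. ennreal (4^k * (norm (d k z))\<^sup>2)"]
      unfolding B_def by (simp_all only: enn2real_nonneg infinity_ennreal_def less_top)
    have "norm (d k z) \<le> sqrt B * (1/2)^k" for k
    proof -
      have "ennreal (4^k * (norm (d k z))\<^sup>2) \<le> ennreal B"
        unfolding B(2)[symmetric] by (rule term_le)
      then have "4^k * (norm (d k z))\<^sup>2 \<le> B" using B(1) by simp
      moreover have "(2^k)\<^sup>2 = (4^k :: real)"
        by (simp add: power2_eq_square flip: power_mult_distrib)
      ultimately have "(2^k * norm (d k z))\<^sup>2 \<le> B"
        unfolding power_mult_distrib by simp
      then have "2^k * norm (d k z) \<le> sqrt B" by (rule real_le_rsqrt)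
      then show ?thesis by (simp add: field_simps power_divide)
    qed
    then have "summable (\<lambda>k. d k z)"
      by (intro summable_comparison_test[of "\<lambda>k. d k z" "\<lambda>k. sqrt B * (1/2)^k"] exI[of _ 0])
        (simp_all add: summable_mult summable_geometric)
    then have "convergent (\<lambda>n. f (r 0) z + (\<Sum>k<n. d k z))"
      unfolding summable_iff_convergent by (intro convergent_add convergent_const)
    moreover have "(\<Sum>k<n. d k z) = f (r n) z - f (r 0) z" for n
      unfolding d_def by (rule sum_lessThan_telescope)
    ultimately show ?case unfolding u_def by (simp add: convergent_LIMSEQ_iff)
  qed
  \<comment> \<open>Fatou's lemma carries the Cauchy estimate from \<open>f (r k)\<close> to the
    limit. Since it also gives finiteness, the difference is square integrable, and so is
    \<open>u\<close>.\<close>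
  have bound: "(\<lambda>z. f m z - u z) \<in> L2 S \<and> l2norm S (\<lambda>z. f m z - u z) \<le> e"
    if e: "e > 0" and K: "\<forall>m\<ge>K. \<forall>n\<ge>K. l2norm S (\<lambda>z. f m z - f n z) \<le> e" and m: "m \<ge> K" for m K e
  proof -
    have "(\<integral>\<^sup>+z. ennreal ((norm (f m z - u z))\<^sup>2) \<partial>?M)
        = (\<integral>\<^sup>+z. liminf (\<lambda>k. ennreal ((norm (f m z - f (r k) z))\<^sup>2)) \<partial>?M)"
      using conv
    proof (intro nn_integral_cong_AE, eventually_elim)
      case (elim z)
      then have "(\<lambda>k. ennreal ((norm (f m z - f (r k) z))\<^sup>2)) \<longlonglongrightarrow> ennreal ((norm (f m z - u z))\<^sup>2)"
        by (intro tendsto_ennrealI tendsto_intros)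
      from lim_imp_Liminf[OF sequentially_bot this] show ?case by (rule sym)
    qed
    also have "\<dots> \<le> liminf (\<lambda>k. \<integral>\<^sup>+z. ennreal ((norm (f m z - f (r k) z))\<^sup>2) \<partial>?M)"
      by (rule nn_integral_liminf) measurable
    also have "\<dots> \<le> limsup (\<lambda>k. \<integral>\<^sup>+z. ennreal ((norm (f m z - f (r k) z))\<^sup>2) \<partial>?M)"
      by (rule Liminf_le_Limsup) simp
    also have "\<dots> \<le> ennreal (e\<^sup>2)"
    proof (rule Limsup_bounded)
      have "(l2norm S (\<lambda>z. f m z - f (r k) z))\<^sup>2 \<le> e\<^sup>2" if "k \<ge> K" for k
        using K m that by (intro power_mono) (auto simp: r_def)
      then show "\<forall>\<^sub>F k in sequentially. (\<integral>\<^sup>+z. ennreal ((norm (f m z - f (r k) z))\<^sup>2) \<partial>?M) \<le> ennreal (e\<^sup>2)"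
        using L by (auto simp: eventually_sequentially nn L2_diff intro!: ennreal_leI exI[of _ K])
    qed
    finally have le: "(\<integral>\<^sup>+z. ennreal ((norm (f m z - u z))\<^sup>2) \<partial>?M) \<le> ennreal (e\<^sup>2)" .
    have D: "(\<lambda>z. f m z - u z) \<in> L2 S"
      unfolding L2_def using le
      by (auto intro!: integrableI_bounded dest: order_le_less_trans[OF _ ennreal_less_top])
    then show ?thesis using le e by (simp add: nn power_mono_iff)
  qed
  obtain K1 where "\<forall>m\<ge>K1. \<forall>n\<ge>K1. l2norm S (\<lambda>z. f m z - f n z) \<le> 1" using C[of 1] by auto
  then have "(\<lambda>z. f K1 z - u z) \<in> L2 S" using bound[of 1 K1 K1] by auto
  then have uL: "u \<in> L2 S" using L2_diff[OF L[of K1]] by fastforce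
  have "(\<lambda>n. l2norm S (\<lambda>z. f n z - u z)) \<longlonglongrightarrow> 0"
  proof (rule LIMSEQ_I)
    fix e :: real assume "e > 0"
    then obtain K where "\<forall>m\<ge>K. \<forall>n\<ge>K. l2norm S (\<lambda>z. f m z - f n z) \<le> e/2" using C[of "e/2"] by auto
    then have "\<forall>n\<ge>K. norm (l2norm S (\<lambda>z. f n z - u z) - 0) < e"
      using bound[of "e/2" K] \<open>e > 0\<close> by fastforce
    then show "\<exists>K. \<forall>n\<ge>K. norm (l2norm S (\<lambda>z. f n z - u z) - 0) < e" by blast
  qed
  then show ?thesis using uL L by (auto simp: l2lim_def)
qed

text \<open>A version of the Riesz representation theorem for a linear family given by an index set, which
  avoids passing to the quotient by null functions: the representing element is the limit of a
  minimising sequence of \<open>\<parallel>A i\<parallel>\<^sup>2 - 2 l i\<close>.\<close>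

lemma Riesz_family:
  fixes A :: "'i \<Rightarrow> 'b::euclidean_space \<Rightarrow> 'c::euclidean_space" and l :: "'i \<Rightarrow> real"
  assumes ne: "I \<noteq> {}" and L: "\<And>i. i \<in> I \<Longrightarrow> A i \<in> L2 S"
    and lin: "\<And>i j c. i \<in> I \<Longrightarrow> j \<in> I \<Longrightarrow>
      \<exists>k\<in>I. (AE z in lebesgue_on S. A k z = A i z + c *\<^sub>R A j z) \<and> l k = l i + c * l j"
    and bd: "\<And>i. i \<in> I \<Longrightarrow> \<bar>l i\<bar> \<le> C * l2norm S (A i)"
  shows "\<exists>u s. (\<forall>n. s n \<in> I) \<and> l2lim S (\<lambda>n. A (s n)) u \<and> (\<forall>i\<in>I. ip S u (A i) = l i)"
proof -
  define J where "J i = ip S (A i) (A i) - 2 * l i" for i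
  \<comment> \<open>Completing the square: the bound on \<open>l\<close> is absorbed by the
    quadratic term, so the functional is bounded below.\<close>
  have Jb: "- C\<^sup>2 \<le> J i" if "i \<in> I" for i
  proof -
    have "0 \<le> (l2norm S (A i) - C)\<^sup>2" by simp
    then have "2 * (C * l2norm S (A i)) \<le> ip S (A i) (A i) + C\<^sup>2"
      by (simp add: power2_diff l2norm_square algebra_simps)
    then show ?thesis using bd[OF that] unfolding J_def abs_le_iff by linarith
  qed
  define m where "m = Inf (J ` I)"
  have bdd: "bdd_below (J ` I)" using Jb by (auto intro!: bdd_belowI2)
  have mle: "m \<le> J i" if "i \<in> I" for i
    unfolding m_def using that bdd by (intro cINF_lower)
  have expand: "m \<le> J i + 2 * c * (ip S (A i) (A j) - l j) + c\<^sup>2 * ip S (A j) (A j)"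
    if ij: "i \<in> I" "j \<in> I" for i j c
  proof -
    obtain k where k: "k \<in> I" "AE z in lebesgue_on S. A k z = A i z + c *\<^sub>R A j z" "l k = l i + c * l j"
      using lin[OF ij] by blast
    have "ip S (A k) (A k) = ip S (\<lambda>z. A i z + c *\<^sub>R A j z) (\<lambda>z. A i z + c *\<^sub>R A j z)"
      using k ij by (intro ip_cong_AE L2_intros L)
    then show ?thesis
      using mle[OF k(1)] k(3) ip_lincomb_square[OF L L, OF ij, of c] by (simp add: J_def algebra_simps)
  qed
  \<comment> \<open>Parallelogram argument: the midpoint of \<open>A i\<close> and
    \<open>A j\<close> is reached from both ends along \<open>A k\<close>, which is their
    difference, with factors -1/2 and 1/2. On adding the two inequalities the terms with
    \<open>l k\<close> cancel.\<close>
  have diff: "ip S (\<lambda>z. A i z - A j z) (\<lambda>z. A i z - A j z) \<le> 2 * (J i - m) + 2 * (J j - m)"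
    if ij: "i \<in> I" "j \<in> I" for i j
  proof -
    obtain k where k: "k \<in> I" "AE z in lebesgue_on S. A k z = A i z + (-1) *\<^sub>R A j z" "l k = l i + (-1) * l j"
      using lin[OF ij] by blast
    have kA: "AE z in lebesgue_on S. A k z = A i z - A j z" using k(2) by simp
    let ?D = "ip S (\<lambda>z. A i z - A j z) (\<lambda>z. A i z - A j z)"
    have D: "ip S (A k) (A k) = ?D" using kA ij k by (intro ip_cong_AE L2_intros L)
    have "ip S (A i) (A k) - ip S (A j) (A k) = ip S (\<lambda>z. A i z - A j z) (A k)"
      using ij k L by (simp add: ip_diff_left)
    also have "\<dots> = ?D" using kA ij k by (intro ip_cong_AE L2_intros L) auto
    finally show ?thesis
      using expand[OF ij(1) k(1), of "-1/2"] expand[OF ij(2) k(1), of "1/2"] D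
      by (simp add: power2_eq_square algebra_simps)
  qed
  have "\<exists>i\<in>I. J i < m + inverse (real (Suc n))" for n
    using cInf_lessD[of "J ` I" "m + inverse (real (Suc n))"] ne by (auto simp: m_def)
  then obtain s where s: "\<And>n. s n \<in> I" "\<And>n. J (s n) < m + inverse (real (Suc n))" by metis
  have Js: "(\<lambda>n. J (s n)) \<longlonglongrightarrow> m"
  proof (rule tendsto_sandwich[of "\<lambda>_. m" _ _ "\<lambda>n. m + inverse (real (Suc n))"])
    show "(\<lambda>n. m + inverse (real (Suc n))) \<longlonglongrightarrow> m"
      using tendsto_add[OF tendsto_const LIMSEQ_inverse_real_of_nat, of m] by simp
    show "\<forall>\<^sub>F n in sequentially. J (s n) \<le> m + inverse (real (Suc n))"
      using s(2) by (intro always_eventually allI less_imp_le)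
  qed (use s mle in \<open>auto intro!: always_eventually\<close>)
  have "\<exists>u. l2lim S (\<lambda>n. A (s n)) u"
  proof (rule L2_complete)
    show "A (s n) \<in> L2 S" for n using L s by auto
    fix e :: real assume e: "e > 0"
    obtain N where N: "\<And>n. n \<ge> N \<Longrightarrow> \<bar>J (s n) - m\<bar> < e\<^sup>2 / 4"
      using LIMSEQ_D[OF Js, of "e\<^sup>2/4"] e by auto
    have "l2norm S (\<lambda>z. A (s p) z - A (s q) z) \<le> e" if "p \<ge> N" "q \<ge> N" for p q
    proof (rule power2_le_imp_le)
      show "(l2norm S (\<lambda>z. A (s p) z - A (s q) z))\<^sup>2 \<le> e\<^sup>2"
        proof -
          have "J (s p) - m \<le> e\<^sup>2/4" "J (s q) - m \<le> e\<^sup>2/4"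
            using N[OF that(1)] N[OF that(2)] by (simp_all only: abs_less_iff less_imp_le)
          then have "2 * (J (s p) - m) + 2 * (J (s q) - m) \<le> e\<^sup>2" by simp
          then show ?thesis
            unfolding l2norm_square by (rule order_trans[OF diff[OF s(1)[of p] s(1)[of q]]])
        qed
    qed (use e in simp)
    then show "\<exists>N. \<forall>p\<ge>N. \<forall>q\<ge>N. l2norm S (\<lambda>z. A (s p) z - A (s q) z) \<le> e" by blast
  qed
  then obtain u where u: "l2lim S (\<lambda>n. A (s n)) u" ..
  have "ip S u (A i) = l i" if i: "i \<in> I" for i
  proof -
    \<comment> \<open>Along the minimising sequence the constant term tends to the infimum
      \<open>m\<close> and cancels; the quadratic in c that remains has no constant term.\<close>
    have "0 \<le> 0 + 2 * c * (ip S u (A i) - l i) + c\<^sup>2 * ip S (A i) (A i)" for c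
    proof -
      have "(\<lambda>n. J (s n) + 2 * c * (ip S (A (s n)) (A i) - l i) + c\<^sup>2 * ip S (A i) (A i))
          \<longlonglongrightarrow> m + 2 * c * (ip S u (A i) - l i) + c\<^sup>2 * ip S (A i) (A i)"
        by (intro tendsto_intros Js l2lim_ip[OF u] L i)
      then have "m \<le> m + 2 * c * (ip S u (A i) - l i) + c\<^sup>2 * ip S (A i) (A i)"
        using expand[OF s(1) i] by (intro LIMSEQ_le_const) auto
      then show ?thesis by simp
    qed
    from nonneg_quadratic_discriminant[OF this ip_nonneg] show ?thesis by simp
  qed
  then show ?thesis using u s by blast
qed

section \<open>Test functions and the energy space\<close>

lemma C1c_has_derivative:
  assumes "C1c S \<phi> D"
  shows "(\<phi> has_derivative (\<lambda>h. D z \<bullet> h)) (at z)"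
  using assms by (auto simp: C1c_def gderiv_def inner_commute)

lemma C1c_continuous:
  assumes "C1c S \<phi> D"
  shows "continuous_on UNIV \<phi>" "continuous_on UNIV D"
proof -
  show "continuous_on UNIV \<phi>"
    by (rule has_derivative_continuous_on[OF has_derivative_at_withinI[OF C1c_has_derivative[OF assms]]])
  show "continuous_on UNIV D" using assms by (simp add: C1c_def)
qed

lemma C1c_outside_support:
  assumes C: "C1c S \<phi> D" and z: "z \<notin> closure {z. \<phi> z \<noteq> 0}"
  shows "\<phi> z = 0" "D z = 0"
proof -
  have out: "\<phi> x = 0" if "x \<notin> closure {z. \<phi> z \<noteq> 0}" for x
    using that subsetD[OF closure_subset[of "{z. \<phi> z \<noteq> 0}"], of x] by auto
  from this[OF z] show "\<phi> z = 0" .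
  have "(\<phi> has_derivative (\<lambda>h. 0)) (at z)"
  proof (rule has_derivative_transform_within_open)
    show "((\<lambda>_. 0) has_derivative (\<lambda>h. 0)) (at z)" by simp
    show "open (- closure {z. \<phi> z \<noteq> 0})" by (rule open_Compl) simp
    show "0 = \<phi> x" if "x \<in> - closure {z. \<phi> z \<noteq> 0}" for x
      by (rule out[symmetric]) (use that in blast)
  qed (use z in auto)
  from has_derivative_unique[OF this C1c_has_derivative[OF C]]
  have "D z \<bullet> D z = 0" by (rule fun_cong[THEN sym])
  then show "D z = 0" by simp
qed

lemma C1c_outside:
  assumes "C1c S \<phi> D" "z \<notin> S"
  shows "\<phi> z = 0" "D z = 0"
  using C1c_outside_support[OF assms(1), of z] assms unfolding C1c_def by blast+

text \<open>Any compact set off which the function vanishes may take the place of the support, so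
  that closures of non-vanishing sets need not be computed.\<close>

lemma C1cI:
  assumes der: "\<And>z. (\<phi> has_derivative (\<lambda>h. D z \<bullet> h)) (at z)" and cont: "continuous_on UNIV D"
    and K: "compact K" "K \<subseteq> S" "\<And>z. z \<notin> K \<Longrightarrow> \<phi> z = 0"
  shows "C1c S \<phi> D"
proof -
  have "closure {z. \<phi> z \<noteq> 0} \<subseteq> K"
    using K by (intro closure_minimal) (auto simp: compact_imp_closed)
  moreover from this K(1) have "compact (closure {z. \<phi> z \<noteq> 0})"
    by (metis closed_closure compact_Int_closed inf.absorb_iff2)
  ultimately show ?thesis
    unfolding C1c_def gderiv_def using der cont K(2) by (auto simp: inner_commute)
qed

lemma C1c_support:
  assumes "C1c S \<phi> D"
  obtains K where "compact K" "K \<subseteq> S" "\<And>z. z \<notin> K \<Longrightarrow> \<phi> z = 0" "\<And>z. z \<notin> K \<Longrightarrow> D z = 0"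
  using assms C1c_outside_support[OF assms] that[of "closure {z. \<phi> z \<noteq> 0}"] unfolding C1c_def by blast

lemma C1c_mono: "C1c S \<phi> D \<Longrightarrow> S \<subseteq> S' \<Longrightarrow> C1c S' \<phi> D"
  unfolding C1c_def by blast

lemma C1c_lincomb:
  assumes \<phi>: "C1c S \<phi> D" and \<psi>: "C1c S \<psi> E"
  shows "C1c S (\<lambda>z. \<phi> z + c * \<psi> z) (\<lambda>z. D z + c *\<^sub>R E z)"
proof -
  obtain K where K: "compact K" "K \<subseteq> S" "\<And>z. z \<notin> K \<Longrightarrow> \<phi> z = 0" by (rule C1c_support[OF \<phi>]) blast
  obtain K' where K': "compact K'" "K' \<subseteq> S" "\<And>z. z \<notin> K' \<Longrightarrow> \<psi> z = 0" by (rule C1c_support[OF \<psi>]) blast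
  show ?thesis
  proof (rule C1cI[of _ _ "K \<union> K'"])
    show "((\<lambda>z. \<phi> z + c * \<psi> z) has_derivative (\<lambda>h. (D z + c *\<^sub>R E z) \<bullet> h)) (at z)" for z
      by (rule derivative_eq_intros C1c_has_derivative[OF \<phi>] C1c_has_derivative[OF \<psi>] refl)+
        (auto simp: inner_add_left)
  qed (use K K' in \<open>auto intro!: continuous_intros C1c_continuous[OF \<phi>] C1c_continuous[OF \<psi>]\<close>)
qed

lemma C1c_zero: "C1c S (\<lambda>z. 0) (\<lambda>z. 0)"
  by (rule C1cI[of _ _ "{}"]) auto

text \<open>The support is also confined to that of the factor in time. A cutoff near t = 0 thereby
  moves a test function from \<open>\<Omega> \<times> {..<T}\<close> into the open cylinder; with an
  exponential factor the same lemma supplies the multiplier of the energy estimate.\<close>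

lemma C1c_mult_time:
  fixes \<phi> :: "'a::euclidean_space \<times> real \<Rightarrow> real"
  assumes \<phi>: "C1c S \<phi> D" and k: "\<And>t. (k has_real_derivative k' t) (at t)" "continuous_on UNIV k'"
  shows "C1c (S \<inter> closure {z. k (snd z) \<noteq> 0}) (\<lambda>z. k (snd z) * \<phi> z) (\<lambda>z. k (snd z) *\<^sub>R D z + (k' (snd z) * \<phi> z) *\<^sub>R (0, 1))"
proof -
  obtain K where K: "compact K" "K \<subseteq> S" "\<And>z. z \<notin> K \<Longrightarrow> \<phi> z = 0" by (rule C1c_support[OF \<phi>]) blast
  have kc: "continuous_on UNIV k" using k(1) by (meson DERIV_continuous_on has_field_derivative_at_within)
  show ?thesis
  proof (rule C1cI[of _ _ "K \<inter> closure {z. k (snd z) \<noteq> 0}"])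
    fix z :: "'a \<times> real"
    have "((\<lambda>z::'a \<times> real. k (snd z)) has_derivative (\<lambda>h. k' (snd z) * snd h)) (at z)"
      using has_derivative_compose[OF has_derivative_snd[OF has_derivative_ident, of "at z"] k(1)[unfolded has_field_derivative_def, of "snd z"]]
      by simp
    then show "((\<lambda>z. k (snd z) * \<phi> z) has_derivative (\<lambda>h. (k (snd z) *\<^sub>R D z + (k' (snd z) * \<phi> z) *\<^sub>R (0, 1)) \<bullet> h)) (at z)"
      by (rule has_derivative_eq_rhs[OF has_derivative_mult[OF _ C1c_has_derivative[OF \<phi>]]])
        (auto simp: inner_add_left inner_prod_def algebra_simps)
  next
    show "k (snd z) * \<phi> z = 0" if "z \<notin> K \<inter> closure {z. k (snd z) \<noteq> 0}" for z
      using that K(3)[of z] closure_subset[of "{z::'a \<times> real. k (snd z) \<noteq> 0}"] by auto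
  qed (use K in \<open>auto intro!: continuous_intros C1c_continuous[OF \<phi>] continuous_on_compose2[OF kc] continuous_on_compose2[OF k(2)]\<close>)
qed

lemma L2_continuous_compact:
  fixes f :: "'b::euclidean_space \<Rightarrow> 'c::euclidean_space"
  assumes S: "S \<in> sets lebesgue" and f: "continuous_on UNIV f" and K: "compact K" "\<And>z. z \<notin> K \<Longrightarrow> f z = 0"
  shows "f \<in> L2 S"
proof (rule L2I)
  show m: "f \<in> borel_measurable (lebesgue_on S)"
    using continuous_imp_measurable_on_sets_lebesgue[OF continuous_on_subset[OF f] S] by simp
  have "bounded (f ` K)"
    by (rule compact_imp_bounded[OF compact_continuous_image[OF continuous_on_subset[OF f] K(1)]]) simp
  then obtain B where B: "\<And>z. z \<in> K \<Longrightarrow> norm (f z) \<le> B"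
    unfolding bounded_iff by blast
  have "K \<in> lmeasurable" using K(1) by (rule lmeasurable_compact)
  then have "K \<in> sets lebesgue" by (rule fmeasurableD)
  then have KS: "K \<inter> S \<in> sets lebesgue" using S by auto
  have "emeasure (lebesgue_on S) (K \<inter> S) = emeasure lebesgue (K \<inter> S)"
    using S by (simp add: emeasure_restrict_space)
  also have "\<dots> \<le> emeasure lebesgue K"
    using \<open>K \<in> sets lebesgue\<close> by (intro emeasure_mono) auto
  also have "\<dots> < \<infinity>" using fmeasurableD2[OF \<open>K \<in> lmeasurable\<close>]
    by (simp add: less_top)
  finally have i: "integrable (lebesgue_on S) (\<lambda>z. B\<^sup>2 * indicator (K \<inter> S) z :: real)"
    using S KS by (intro integrable_mult_right integrable_real_indicator) (auto simp: sets_restrict_space)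
  show "integrable (lebesgue_on S) (\<lambda>z. f z \<bullet> f z)"
  proof (rule Bochner_Integration.integrable_bound[OF i])
    show "AE z in lebesgue_on S. norm (f z \<bullet> f z) \<le> norm (B\<^sup>2 * indicator (K \<inter> S) z :: real)"
    proof (rule AE_I2)
      fix z assume "z \<in> space (lebesgue_on S)"
      then show "norm (f z \<bullet> f z) \<le> norm (B\<^sup>2 * indicator (K \<inter> S) z :: real)"
        using B[of z] K(2)[of z] power_mono[of "norm (f z)" B 2]
        by (cases "z \<in> K") (auto simp: power2_norm_eq_inner)
    qed
  qed (use m in measurable)
qed

lemma C1c_L2:
  fixes \<phi> :: "'a::euclidean_space \<times> real \<Rightarrow> real"
  assumes S: "S \<in> sets lebesgue" and C: "C1c S' \<phi> D"
  shows "\<phi> \<in> L2 S" "D \<in> L2 S" "(\<lambda>z. fst (D z)) \<in> L2 S" "(\<lambda>z. snd (D z)) \<in> L2 S"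
    "(\<lambda>z. (\<phi> z, fst (D z))) \<in> L2 S"
proof -
  obtain K where K: "compact K" "K \<subseteq> S'" "\<And>z. z \<notin> K \<Longrightarrow> \<phi> z = 0" "\<And>z. z \<notin> K \<Longrightarrow> D z = 0"
    by (rule C1c_support[OF C]) blast
  note I = L2_continuous_compact[OF S _ K(1)] continuous_intros C1c_continuous[OF C]
  show "\<phi> \<in> L2 S" by (intro I) (use K in auto)
  show "D \<in> L2 S" by (intro I) (use K in auto)
  show "(\<lambda>z. fst (D z)) \<in> L2 S" by (intro I) (use K in auto)
  show "(\<lambda>z. snd (D z)) \<in> L2 S" by (intro I) (use K in auto)
  show "(\<lambda>z. (\<phi> z, fst (D z))) \<in> L2 S" by (intro I) (use K in \<open>auto simp: zero_prod_def\<close>)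
qed

lemma tendsto_0_le_nonneg:
  fixes f b :: "nat \<Rightarrow> real"
  assumes "b \<longlonglongrightarrow> 0" "\<And>n. 0 \<le> f n" "\<And>n. f n \<le> b n"
  shows "f \<longlonglongrightarrow> 0"
  by (rule tendsto_sandwich[OF always_eventually always_eventually tendsto_const assms(1)])
    (use assms in auto)

section \<open>The space-time cylinder and the closure of its test functions\<close>

lemma cyl_open: "open \<Omega> \<Longrightarrow> open (cyl \<Omega> T)"
  unfolding cyl_def by (intro open_Times) auto

lemma cyl_measurable: "open \<Omega> \<Longrightarrow> cyl \<Omega> T \<in> sets lebesgue"
  using cyl_open[of \<Omega> T] by auto

lemma ip_Pair:
  assumes "f \<in> L2 S" "f' \<in> L2 S" "g \<in> L2 S" "g' \<in> L2 S"
  shows "ip S (\<lambda>z. (f z, g z)) (\<lambda>z. (f' z, g' z)) = ip S f f' + ip S g g'"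
  using assms by (simp add: ip_def L2_integrable_inner)

text \<open>The two limits in the definition are the components of a single limit of pairs, so that
  the general facts about \<open>l2lim\<close> apply to the energy space.\<close>

lemma L2H01_iff:
  assumes \<Omega>: "open \<Omega>"
  shows "L2H01 \<Omega> T y g \<longleftrightarrow> (\<exists>\<phi> D. (\<forall>n. C1c (cyl \<Omega> T) (\<phi> n) (D n)) \<and>
    l2lim (cyl \<Omega> T) (\<lambda>n z. (\<phi> n z, fst (D n z))) (\<lambda>z. (y z, g z)))" (is "?L \<longleftrightarrow> ?R")
proof -
  let ?Q = "cyl \<Omega> T"
  have eq: "(l2norm ?Q (\<lambda>z. (\<phi> z, fst (D z)) - (y z, g z)))\<^sup>2
      = (LINT z|lebesgue_on ?Q. (\<phi> z - y z)\<^sup>2) + (LINT z|lebesgue_on ?Q. (norm (fst (D z) - g z))\<^sup>2)"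
    if "C1c ?Q \<phi> D" "y \<in> L2 ?Q" "g \<in> L2 ?Q" for \<phi> D
    using that C1c_L2[OF cyl_measurable[OF \<Omega>] that(1), of T]
    by (simp add: l2norm_square ip_Pair L2_diff) (simp add: ip_def power2_norm_eq_inner, simp add: power2_eq_square)
  show ?thesis
  proof
    assume ?L
    then obtain \<phi> D where *: "\<And>n. C1c ?Q (\<phi> n) (D n)" "y \<in> L2 ?Q" "g \<in> L2 ?Q"
      and l: "(\<lambda>n. LINT z|lebesgue_on ?Q. (\<phi> n z - y z)\<^sup>2) \<longlonglongrightarrow> 0"
        "(\<lambda>n. LINT z|lebesgue_on ?Q. (norm (fst (D n z) - g z))\<^sup>2) \<longlonglongrightarrow> 0"
      by (auto simp: L2H01_def)
    have "(\<lambda>n. (l2norm ?Q (\<lambda>z. (\<phi> n z, fst (D n z)) - (y z, g z)))\<^sup>2) \<longlonglongrightarrow> 0"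
      unfolding eq[OF *] using tendsto_add[OF l] by simp
    then have "(\<lambda>n. l2norm ?Q (\<lambda>z. (\<phi> n z, fst (D n z)) - (y z, g z))) \<longlonglongrightarrow> 0"
      using tendsto_real_sqrt by fastforce
    then show ?R
      using * C1c_L2(5)[OF cyl_measurable[OF \<Omega>] *(1)] unfolding l2lim_def L2_Pair by blast
  next
    assume ?R
    then obtain \<phi> D where *: "\<And>n. C1c ?Q (\<phi> n) (D n)" "y \<in> L2 ?Q" "g \<in> L2 ?Q"
      and l: "(\<lambda>n. l2norm ?Q (\<lambda>z. (\<phi> n z, fst (D n z)) - (y z, g z))) \<longlonglongrightarrow> 0"
      unfolding l2lim_def L2_Pair by blast
    have l2: "(\<lambda>n. (LINT z|lebesgue_on ?Q. (\<phi> n z - y z)\<^sup>2) + (LINT z|lebesgue_on ?Q. (norm (fst (D n z) - g z))\<^sup>2)) \<longlonglongrightarrow> 0"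
      unfolding eq[OF *, symmetric] using tendsto_power[OF l, of 2] by simp
    have "(\<lambda>n. LINT z|lebesgue_on ?Q. (\<phi> n z - y z)\<^sup>2) \<longlonglongrightarrow> 0"
      by (rule tendsto_0_le_nonneg[OF l2]) auto
    moreover have "(\<lambda>n. LINT z|lebesgue_on ?Q. (norm (fst (D n z) - g z))\<^sup>2) \<longlonglongrightarrow> 0"
      by (rule tendsto_0_le_nonneg[OF l2]) auto
    ultimately show ?L unfolding L2H01_def using * by blast
  qed
qed

lemma L2H01_L2: "L2H01 \<Omega> T y g \<Longrightarrow> y \<in> L2 (cyl \<Omega> T)" "L2H01 \<Omega> T y g \<Longrightarrow> g \<in> L2 (cyl \<Omega> T)"
  "L2H01 \<Omega> T y g \<Longrightarrow> (\<lambda>z. (y z, g z)) \<in> L2 (cyl \<Omega> T)"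
  by (auto simp: L2H01_def L2_Pair)

lemma L2H01_approx:
  assumes "open \<Omega>" "L2H01 \<Omega> T y g"
  obtains \<phi> D where "\<And>n. C1c (cyl \<Omega> T) (\<phi> n) (D n)"
    "l2lim (cyl \<Omega> T) (\<lambda>n z. (\<phi> n z, fst (D n z))) (\<lambda>z. (y z, g z))"
  using assms L2H01_iff by blast

lemma l2lim_const: "f \<in> L2 S \<Longrightarrow> l2lim S (\<lambda>_. f) f"
  by (simp add: l2lim_def l2norm_def ip_def)

lemma C1c_L2H01:
  assumes "open \<Omega>" "C1c (cyl \<Omega> T) \<phi> D"
  shows "L2H01 \<Omega> T \<phi> (\<lambda>z. fst (D z))"
  unfolding L2H01_iff[OF assms(1)]
  using l2lim_const[OF C1c_L2(5)[OF cyl_measurable[OF assms(1)] assms(2), of T]] assms(2)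
  by (intro exI[of _ "\<lambda>_. \<phi>"] exI[of _ "\<lambda>_. D"] conjI allI)

lemma l2lim_lincomb:
  fixes f g :: "nat \<Rightarrow> 'b::euclidean_space \<Rightarrow> 'c::euclidean_space"
  assumes f: "l2lim S f u" and g: "l2lim S g v"
  shows "l2lim S (\<lambda>n z. f n z + c *\<^sub>R g n z) (\<lambda>z. u z + c *\<^sub>R v z)"
proof -
  have L: "f n \<in> L2 S" "g n \<in> L2 S" "u \<in> L2 S" "v \<in> L2 S" for n using f g by (auto simp: l2lim_def)
  have "l2norm S (\<lambda>z. f n z + c *\<^sub>R g n z - (u z + c *\<^sub>R v z))
      \<le> l2norm S (\<lambda>z. f n z - u z) + \<bar>c\<bar> * l2norm S (\<lambda>z. g n z - v z)" for n
    using l2norm_triangle[of "\<lambda>z. f n z - u z" S "\<lambda>z. c *\<^sub>R (g n z - v z)"] L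
    unfolding l2norm_scaleR by (simp add: L2_diff L2_scaleR) (simp add: scaleR_diff_right algebra_simps)
  moreover have "(\<lambda>n. l2norm S (\<lambda>z. f n z - u z) + \<bar>c\<bar> * l2norm S (\<lambda>z. g n z - v z)) \<longlonglongrightarrow> 0 + \<bar>c\<bar> * 0"
    using f g unfolding l2lim_def by (intro tendsto_add tendsto_mult tendsto_const) blast+
  ultimately have "(\<lambda>n. l2norm S (\<lambda>z. f n z + c *\<^sub>R g n z - (u z + c *\<^sub>R v z))) \<longlonglongrightarrow> 0"
    unfolding mult_zero_right add_0_left by (rule tendsto_0_le_nonneg[rotated 2]) simp
  then show ?thesis using L by (simp add: l2lim_def L2_lincomb)
qed

lemma L2H01_lincomb:
  assumes \<Omega>: "open \<Omega>" and y: "L2H01 \<Omega> T y g" and y': "L2H01 \<Omega> T y' g'"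
  shows "L2H01 \<Omega> T (\<lambda>z. y z + c * y' z) (\<lambda>z. g z + c *\<^sub>R g' z)"
proof -
  obtain \<phi> D where \<phi>: "\<And>n. C1c (cyl \<Omega> T) (\<phi> n) (D n)"
    "l2lim (cyl \<Omega> T) (\<lambda>n z. (\<phi> n z, fst (D n z))) (\<lambda>z. (y z, g z))" by (rule L2H01_approx[OF \<Omega> y]) blast
  obtain \<psi> E where \<psi>: "\<And>n. C1c (cyl \<Omega> T) (\<psi> n) (E n)"
    "l2lim (cyl \<Omega> T) (\<lambda>n z. (\<psi> n z, fst (E n z))) (\<lambda>z. (y' z, g' z))" by (rule L2H01_approx[OF \<Omega> y']) blast
  show ?thesis
    unfolding L2H01_iff[OF \<Omega>] using C1c_lincomb[OF \<phi>(1) \<psi>(1), of _ c] l2lim_lincomb[OF \<phi>(2) \<psi>(2), of c]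
    by (intro exI[of _ "\<lambda>n z. \<phi> n z + c * \<psi> n z"] exI[of _ "\<lambda>n z. D n z + c *\<^sub>R E n z"]) simp
qed

text \<open>Diagonal argument: the n-th function is replaced by a test function whose distance from
  it in the energy norm is below 1/(n+1).\<close>

lemma L2H01_closed:
  assumes \<Omega>: "open \<Omega>" and y: "\<And>n. L2H01 \<Omega> T (y n) (g n)"
    and l: "l2lim (cyl \<Omega> T) (\<lambda>n z. (y n z, g n z)) (\<lambda>z. (u z, h z))"
  shows "L2H01 \<Omega> T u h"
proof -
  let ?Q = "cyl \<Omega> T"
  have "\<forall>n. \<exists>\<phi> D. C1c ?Q \<phi> D \<and> l2norm ?Q (\<lambda>z. (\<phi> z, fst (D z)) - (y n z, g n z)) < inverse (real (Suc n))"
  proof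
    fix n
    obtain \<phi> D where \<phi>: "\<And>k. C1c ?Q (\<phi> k) (D k)"
      "l2lim ?Q (\<lambda>k z. (\<phi> k z, fst (D k z))) (\<lambda>z. (y n z, g n z))" by (rule L2H01_approx[OF \<Omega> y[of n]]) blast
    then have "(\<lambda>k. l2norm ?Q (\<lambda>z. (\<phi> k z, fst (D k z)) - (y n z, g n z))) \<longlonglongrightarrow> 0"
      by (simp add: l2lim_def)
    then have "\<forall>\<^sub>F k in sequentially. l2norm ?Q (\<lambda>z. (\<phi> k z, fst (D k z)) - (y n z, g n z)) < inverse (real (Suc n))"
      by (rule order_tendstoD) simp
    then obtain k where "l2norm ?Q (\<lambda>z. (\<phi> k z, fst (D k z)) - (y n z, g n z)) < inverse (real (Suc n))"
      unfolding eventually_sequentially by blast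
    then show "\<exists>\<phi> D. C1c ?Q \<phi> D \<and> l2norm ?Q (\<lambda>z. (\<phi> z, fst (D z)) - (y n z, g n z)) < inverse (real (Suc n))"
      using \<phi>(1) by blast
  qed
  then obtain \<phi> D where \<phi>: "\<And>n. C1c ?Q (\<phi> n) (D n)"
    "\<And>n. l2norm ?Q (\<lambda>z. (\<phi> n z, fst (D n z)) - (y n z, g n z)) < inverse (real (Suc n))"
    unfolding choice_iff by blast
  have L: "(\<lambda>z. (\<phi> n z, fst (D n z))) \<in> L2 ?Q" "(\<lambda>z. (y n z, g n z)) \<in> L2 ?Q" "(\<lambda>z. (u z, h z)) \<in> L2 ?Q" for n
    using C1c_L2(5)[OF cyl_measurable[OF \<Omega>] \<phi>(1)] l by (auto simp: l2lim_def)
  have "(\<lambda>n. l2norm ?Q (\<lambda>z. (\<phi> n z, fst (D n z)) - (u z, h z))) \<longlonglongrightarrow> 0"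
  proof (rule tendsto_0_le_nonneg)
    let ?b = "\<lambda>n. inverse (real (Suc n)) + l2norm ?Q (\<lambda>z. (y n z, g n z) - (u z, h z))"
    show "l2norm ?Q (\<lambda>z. (\<phi> n z, fst (D n z)) - (u z, h z)) \<le> ?b n" for n
      using l2norm_diff_triangle[OF L, of n n] \<phi>(2)[of n] by linarith
    show "?b \<longlonglongrightarrow> 0"
      using tendsto_add[OF LIMSEQ_inverse_real_of_nat, of "\<lambda>n. l2norm ?Q (\<lambda>z. (y n z, g n z) - (u z, h z))" 0] l
      by (simp add: l2lim_def)
  qed simp
  then show ?thesis unfolding L2H01_iff[OF \<Omega>] l2lim_def using \<phi>(1) L by blast
qed

lemma C1c_mult:
  assumes \<phi>: "C1c S \<phi> D" and \<psi>: "C1c S \<psi> E"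
  shows "C1c S (\<lambda>z. \<phi> z * \<psi> z) (\<lambda>z. \<phi> z *\<^sub>R E z + \<psi> z *\<^sub>R D z)"
proof -
  obtain K where K: "compact K" "K \<subseteq> S" "\<And>z. z \<notin> K \<Longrightarrow> \<phi> z = 0" by (rule C1c_support[OF \<phi>]) blast
  show ?thesis
  proof (rule C1cI[of _ _ K])
    show "((\<lambda>z. \<phi> z * \<psi> z) has_derivative (\<lambda>h. (\<phi> z *\<^sub>R E z + \<psi> z *\<^sub>R D z) \<bullet> h)) (at z)" for z
      by (rule has_derivative_eq_rhs[OF has_derivative_mult[OF C1c_has_derivative[OF \<phi>] C1c_has_derivative[OF \<psi>]]])
        (simp add: inner_add_left mult.commute)
  qed (use K in \<open>auto intro!: continuous_intros C1c_continuous[OF \<phi>] C1c_continuous[OF \<psi>]\<close>)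
qed

lemma L2_indicator:
  assumes S: "S \<in> sets lebesgue" and K: "K \<in> lmeasurable"
  shows "(indicator K :: 'b::euclidean_space \<Rightarrow> real) \<in> L2 S"
proof (rule L2I)
  have Ks: "K \<in> sets lebesgue" using K by (rule fmeasurableD)
  show "(indicator K :: 'b \<Rightarrow> real) \<in> borel_measurable (lebesgue_on S)"
    by (rule measurable_restrict_space1[OF borel_measurable_indicator[OF Ks]])
  have "S \<inter> K \<in> lmeasurable" using fmeasurable_Int_fmeasurable[OF K S] by (simp add: inf_commute)
  then have "integrable lebesgue (indicator (S \<inter> K) :: 'b \<Rightarrow> real)"
    by (intro integrable_real_indicator) (auto simp: fmeasurable_def)
  then show "integrable (lebesgue_on S) (\<lambda>z::'b. indicator K z \<bullet> (indicator K z :: real))"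
    using S by (subst integrable_restrict_space) (simp_all add: indicator_inter_arith inner_real_def flip: indicator_inter_arith)
qed

text \<open>Such an f is the product of two square-integrable functions, itself and the indicator of
  K.\<close>

lemma integrable_continuous_compact:
  fixes f :: "'b::euclidean_space \<Rightarrow> real"
  assumes S: "S \<in> sets lebesgue" and f: "continuous_on UNIV f" and K: "compact K" "\<And>z. z \<notin> K \<Longrightarrow> f z = 0"
  shows "integrable (lebesgue_on S) f"
proof -
  have "integrable (lebesgue_on S) (\<lambda>z. f z \<bullet> (indicator K z :: real))"
    by (intro L2_integrable_inner L2_continuous_compact[OF S f K] L2_indicator[OF S] lmeasurable_compact K(1))
  also have "(\<lambda>z. f z \<bullet> (indicator K z :: real)) = f"
    using K(2) by (fastforce simp: indicator_def fun_eq_iff)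
  finally show ?thesis .
qed

text \<open>The squared positive part is a simple C^1 function that vanishes on a half-line; the
  cutoffs in time are built from it.\<close>

lemma has_derivative_max_0_square: "((\<lambda>x::real. (max 0 x)\<^sup>2) has_real_derivative 2 * max 0 x) (at x)"
proof (cases x "0::real" rule: linorder_cases)
  case less
  have "((\<lambda>x::real. 0) has_real_derivative 0) (at x)" by simp
  then have "((\<lambda>x::real. (max 0 x)\<^sup>2) has_real_derivative 0) (at x)"
    by (rule has_field_derivative_transform_within_open[where S = "{..<0}"]) (use less in auto)
  then show ?thesis using less by simp
next
  case greater
  have "((\<lambda>x::real. x\<^sup>2) has_real_derivative 2 * x) (at x)"
    by (auto intro!: derivative_eq_intros)
  then have "((\<lambda>x::real. (max 0 x)\<^sup>2) has_real_derivative 2 * x) (at x)"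
    by (rule has_field_derivative_transform_within_open[where S = "{0<..}"]) (use greater in auto)
  then show ?thesis using greater by simp
next
  case equal
  have "((\<lambda>h::real. max 0 h) \<longlongrightarrow> max 0 0) (at 0)" by (intro tendsto_intros)
  then have "((\<lambda>h::real. max 0 h) \<longlongrightarrow> 0) (at 0)" by simp
  then have "((\<lambda>h::real. ((max 0 (0 + h))\<^sup>2 - (max 0 0)\<^sup>2) / h) \<longlongrightarrow> 0) (at 0)"
    by (rule Lim_transform_eventually)
      (auto simp: eventually_at power2_eq_square max_def intro!: exI[of _ 1])
  then show ?thesis using equal by (simp add: DERIV_def)
qed

text \<open>Fubini and the fundamental theorem of calculus along each time line. The support lies
  strictly below t = T, so only the trace at t = 0 survives.\<close>

lemma C1c_integral_time_derivative:
  fixes \<psi> :: "'a::euclidean_space \<times> real \<Rightarrow> real"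
  assumes \<Omega>: "open \<Omega>" and T: "T > 0" and C: "C1c (\<Omega> \<times> {..<T}) \<psi> E"
  shows "(LINT z|lebesgue_on (cyl \<Omega> T). snd (E z)) = - (LINT x|lebesgue_on \<Omega>. \<psi> (x, 0))"
proof -
  let ?Q = "cyl \<Omega> T"
  obtain K where K: "compact K" "K \<subseteq> \<Omega> \<times> {..<T}" "\<And>z. z \<notin> K \<Longrightarrow> \<psi> z = 0" "\<And>z. z \<notin> K \<Longrightarrow> E z = 0"
    by (rule C1c_support[OF C]) blast
  have Q: "?Q \<in> sets lebesgue" "?Q \<in> sets borel" using cyl_open[OF \<Omega>, of T] by auto
  have c: "continuous_on UNIV (\<lambda>z. snd (E z))" by (intro continuous_intros C1c_continuous[OF C])
  have [measurable]: "(\<lambda>z. snd (E z)) \<in> borel_measurable borel" using c by (rule borel_measurable_continuous_onI)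
  have \<psi>c: "continuous_on UNIV (\<lambda>x. \<psi> (x, 0))"
    by (rule continuous_on_compose2[OF C1c_continuous(1)[OF C]]) (auto intro!: continuous_intros)
  have [measurable]: "(\<lambda>x. \<psi> (x, 0)) \<in> borel_measurable borel" using \<psi>c by (rule borel_measurable_continuous_onI)
  have [measurable]: "\<Omega> \<in> sets borel" using \<Omega> by auto
  let ?f = "\<lambda>z. indicator ?Q z *\<^sub>R snd (E z)"
  \<comment> \<open>Fubini is applied to the product of Borel measures, so the integral passes from
    the completed measure to \<open>lborel\<close> here and back at the end.\<close>
  have fm: "?f \<in> borel_measurable lborel" using Q by measurable
  have "integrable (lebesgue_on ?Q) (\<lambda>z. snd (E z))"
    by (rule integrable_continuous_compact[OF Q(1) c K(1)]) (use K in auto)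
  then have "integrable lebesgue ?f" using Q by (subst (asm) integrable_restrict_space) auto
  then have "integrable lborel ?f" using integrable_completion[OF fm] by simp
  then have int: "integrable (lborel \<Otimes>\<^sub>M lborel) ?f" by (simp add: lborel_prod)
  have inner: "(LINT t|lborel. ?f (x, t)) = - (indicator \<Omega> x *\<^sub>R \<psi> (x, 0))" for x
  proof -
    \<comment> \<open>The fundamental theorem is stated for closed intervals; the two end points
      form a null set.\<close>
    have "(LINT t|lborel. ?f (x, t)) = (LINT t|lborel. indicator \<Omega> x * (snd (E (x, t)) * indicator {0..T} t))"
    proof (rule integral_cong_AE)
      show "AE t in lborel. ?f (x, t) = indicator \<Omega> x * (snd (E (x, t)) * indicator {0..T} t)"
        using AE_lborel_singleton[of 0] AE_lborel_singleton[of T]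
        by eventually_elim (auto simp: cyl_def indicator_def)
      have [measurable]: "(\<lambda>t. snd (E (x, t))) \<in> borel_measurable borel"
        by (intro borel_measurable_continuous_onI continuous_on_compose2[OF c] continuous_intros) auto
      show "(\<lambda>t. indicator \<Omega> x * (snd (E (x, t)) * indicator {0..T} t)) \<in> borel_measurable lborel" by measurable
      have "(\<lambda>t. ?f (x, t)) = (\<lambda>t. indicator \<Omega> x * (snd (E (x, t)) * indicator {0<..<T} t))"
        by (auto simp: cyl_def indicator_def)
      then show "(\<lambda>t. ?f (x, t)) \<in> borel_measurable lborel" by simp
    qed
    also have "\<dots> = indicator \<Omega> x * (\<psi> (x, T) - \<psi> (x, 0))"
    proof -
      have "(LINT t|lborel. snd (E (x, t)) * indicator {0..T} t) = \<psi> (x, T) - \<psi> (x, 0)"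
      proof (rule integral_FTC_Icc_real)
        show "((\<lambda>t. \<psi> (x, t)) has_real_derivative snd (E (x, t))) (at t)" for t
        proof -
          have p: "((\<lambda>t. (x, t)) has_derivative (\<lambda>h. (0, h))) (at t)"
            by (rule has_derivative_Pair) auto
          show ?thesis
            unfolding has_field_derivative_def
            by (rule has_derivative_eq_rhs[OF has_derivative_compose[OF p C1c_has_derivative[OF C]]]) (auto simp: inner_prod_def)
        qed
        show "isCont (\<lambda>t. snd (E (x, t))) t" for t
          using continuous_on_compose2[OF c, of UNIV "\<lambda>t. (x, t)"]
          by (simp add: continuous_on_eq_continuous_at continuous_on_Pair)
      qed (use T in simp)
      then show ?thesis by simp
    qed
    also have "\<psi> (x, T) = 0" using C1c_outside(1)[OF C, of "(x, T)"] by simp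
    finally show ?thesis by simp
  qed
  have "(LINT z|lebesgue_on ?Q. snd (E z)) = (LINT z|lebesgue. ?f z)"
    using Q by (subst integral_restrict_space) auto
  also have "\<dots> = (LINT z|lborel. ?f z)" by (rule integral_completion[OF fm])
  also have "\<dots> = (LINT z|(lborel \<Otimes>\<^sub>M lborel). ?f z)" by (simp add: lborel_prod)
  also have "\<dots> = (LINT x|lborel. LINT t|lborel. ?f (x, t))"
    using lborel_pair.integral_fst'[OF int] by simp
  also have "\<dots> = - (LINT x|lborel. indicator \<Omega> x *\<^sub>R \<psi> (x, 0))" unfolding inner by simp
  also have "(LINT x|lborel. indicator \<Omega> x *\<^sub>R \<psi> (x, 0)) = (LINT x|lebesgue. indicator \<Omega> x *\<^sub>R \<psi> (x, 0))"
    by (rule integral_completion[symmetric]) measurable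
  also have "\<dots> = (LINT x|lebesgue_on \<Omega>. \<psi> (x, 0))"
    using \<Omega> by (subst integral_restrict_space) auto
  finally show ?thesis .
qed

lemma L2_trace:
  fixes \<phi> :: "'a::euclidean_space \<times> real \<Rightarrow> real"
  assumes \<Omega>: "open \<Omega>" and C: "C1c S \<phi> D"
  shows "(\<lambda>x. \<phi> (x, 0)) \<in> L2 \<Omega>"
proof -
  obtain K where K: "compact K" "K \<subseteq> S" "\<And>z. z \<notin> K \<Longrightarrow> \<phi> z = 0" "\<And>z. z \<notin> K \<Longrightarrow> D z = 0"
    by (rule C1c_support[OF C]) blast
  show ?thesis
  proof (rule L2_continuous_compact[where K = "fst ` K"])
    show "continuous_on UNIV (\<lambda>x. \<phi> (x, 0))"
      by (rule continuous_on_compose2[OF C1c_continuous(1)[OF C]]) (auto intro!: continuous_intros)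
    show "compact (fst ` K)" by (rule compact_continuous_image[OF continuous_on_fst[OF continuous_on_id] K(1)])
    show "\<phi> (x, 0) = 0" if "x \<notin> fst ` K" for x
      using that by (intro K(3)) force
  qed (use \<Omega> in auto)
qed

text \<open>Test functions need not vanish at the initial time; multiplying them by \<open>1 - 1/(1 + n (t - 1/n)\<^sub>+\<^sup>2)\<close>
  shows that they nevertheless belong to the energy space.\<close>

lemma C1c_initial_L2H01:
  fixes \<psi> :: "'a::euclidean_space \<times> real \<Rightarrow> real"
  assumes \<Omega>: "open \<Omega>" and C: "C1c (\<Omega> \<times> {..<T}) \<psi> E"
  shows "L2H01 \<Omega> T \<psi> (\<lambda>z. fst (E z))"
proof -
  let ?Q = "cyl \<Omega> T"
  \<comment> \<open>The factor \<open>k n\<close> vanishes for t up to 1/(n+1) and tends to 1 for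
    each t > 0. Its derivative may grow with n, which is harmless because the energy norm contains
    only the spatial gradient.\<close>
  define p where "p n t = (max 0 (t - inverse (real (Suc n))))\<^sup>2" for n t
  define d where "d n t = 1 + real (Suc n) * p n t" for n t
  define k where "k n t = 1 - inverse (d n t)" for n t
  define k' where "k' n t = real (Suc n) * (2 * max 0 (t - inverse (real (Suc n)))) * (inverse (d n t) * inverse (d n t))" for n t
  have d1: "d n t \<ge> 1" for n t unfolding d_def p_def by simp
  have pc: "continuous_on UNIV (p n)" for n unfolding p_def by (intro continuous_intros)
  have dc: "continuous_on UNIV (d n)" for n unfolding d_def using pc by (intro continuous_intros) auto
  have d0: "d n t \<noteq> 0" for n t using d1[of n t] by auto
  have k'c: "continuous_on UNIV (k' n)" for n
    unfolding k'_def using dc d0 by (intro continuous_intros) auto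
  have kd: "(k n has_real_derivative k' n t) (at t)" for n t
  proof -
    have "(p n has_real_derivative 2 * max 0 (t - inverse (real (Suc n))) * 1) (at t)"
      unfolding p_def by (rule DERIV_chain2[OF has_derivative_max_0_square]) (auto intro!: derivative_eq_intros)
    from DERIV_add[OF DERIV_const[of 1] DERIV_cmult[OF this, of "real (Suc n)"]]
    have "(d n has_real_derivative real (Suc n) * (2 * max 0 (t - inverse (real (Suc n))))) (at t)"
      unfolding d_def[abs_def] by simp
    from DERIV_diff[OF DERIV_const DERIV_inverse'[OF this d0], of 1]
    show ?thesis unfolding k_def[abs_def] k'_def by (simp add: mult_ac)
  qed
  have k01: "0 \<le> k n t" "k n t \<le> 1" for n t
    using d1[of n t] by (auto simp: k_def inverse_le_1_iff)
  have C': "C1c ?Q (\<lambda>z. k n (snd z) * \<psi> z) (\<lambda>z. k n (snd z) *\<^sub>R E z + (k' n (snd z) * \<psi> z) *\<^sub>R (0, 1))" for n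
  proof (rule C1c_mono[OF C1c_mult_time[OF C kd k'c]])
    have "closure {z::'a \<times> real. k n (snd z) \<noteq> 0} \<subseteq> {z. inverse (real (Suc n)) \<le> snd z}"
    proof (rule closure_minimal)
      show "{z::'a \<times> real. k n (snd z) \<noteq> 0} \<subseteq> {z. inverse (real (Suc n)) \<le> snd z}"
        by (auto simp: k_def d_def p_def max_def split: if_splits)
      show "closed {z::'a \<times> real. inverse (real (Suc n)) \<le> snd z}"
        by (intro closed_Collect_le continuous_intros)
    qed
    then have sub: "inverse (real (Suc n)) \<le> snd z" if "z \<in> closure {z::'a \<times> real. k n (snd z) \<noteq> 0}" for z
      using that by blast
    show "\<Omega> \<times> {..<T} \<inter> closure {z. k n (snd z) \<noteq> 0} \<subseteq> ?Q"
    proof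
      fix z assume z: "z \<in> \<Omega> \<times> {..<T} \<inter> closure {z. k n (snd z) \<noteq> 0}"
      have "0 < inverse (real (Suc n))" by simp
      also have "\<dots> \<le> snd z" using z by (intro sub) simp
      finally show "z \<in> ?Q" using z by (auto simp: cyl_def)
    qed
  qed
  let ?J = "\<lambda>z. (\<psi> z, fst (E z))"
  have JL: "?J \<in> L2 ?Q" by (rule C1c_L2(5)[OF cyl_measurable[OF \<Omega>] C])
  have kL: "(\<lambda>z. k n (snd z) *\<^sub>R ?J z) \<in> L2 ?Q" for n
    using C1c_L2(5)[OF cyl_measurable[OF \<Omega>] C'[of n], of T] by simp
  have klim: "(\<lambda>n. k n t) \<longlonglongrightarrow> 1" if "t > 0" for t
  proof -
    have "filterlim (\<lambda>n. d n t) at_top sequentially"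
    proof (rule filterlim_at_top_mono)
      show "filterlim (\<lambda>n. real (Suc n) * (t/2)\<^sup>2) at_top sequentially"
        using that by (intro filterlim_at_top_mult_tendsto_pos[OF tendsto_const] filterlim_compose[OF filterlim_real_sequentially] filterlim_Suc) auto
      have "\<forall>\<^sub>F n in sequentially. inverse (real (Suc n)) < t / 2"
        by (rule order_tendstoD[OF LIMSEQ_inverse_real_of_nat]) (use that in simp)
      then show "\<forall>\<^sub>F n in sequentially. real (Suc n) * (t/2)\<^sup>2 \<le> d n t"
      proof eventually_elim
        case (elim n)
        have "(t/2)\<^sup>2 \<le> p n t" unfolding p_def by (rule power_mono) (use elim that in auto)
        then have "real (Suc n) * (t/2)\<^sup>2 \<le> real (Suc n) * p n t" by (rule mult_left_mono) simp
        then show ?case unfolding d_def by linarith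
      qed
    qed
    from tendsto_diff[OF tendsto_const[of 1] tendsto_inverse_0_at_top[OF this]]
    show ?thesis unfolding k_def by simp
  qed
  \<comment> \<open>Dominated convergence: the integrand is \<open>(k n - 1)\<^sup>2\<close> times
    the squared length of the pair, and the first factor is at most 1.\<close>
  have "(\<lambda>n. ip ?Q (\<lambda>z. k n (snd z) *\<^sub>R ?J z - ?J z) (\<lambda>z. k n (snd z) *\<^sub>R ?J z - ?J z)) \<longlonglongrightarrow> (LINT z|lebesgue_on ?Q. 0)"
    unfolding ip_def
  proof (rule integral_dominated_convergence[where w = "\<lambda>z. ?J z \<bullet> ?J z"])
    show "(\<lambda>z. (k n (snd z) *\<^sub>R ?J z - ?J z) \<bullet> (k n (snd z) *\<^sub>R ?J z - ?J z)) \<in> borel_measurable (lebesgue_on ?Q)" for n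
      using L2_measurable[OF kL[of n]] L2_measurable[OF JL] by measurable
    show "integrable (lebesgue_on ?Q) (\<lambda>z. ?J z \<bullet> ?J z)" by (rule L2_integrable[OF JL])
    have eq: "(k n (snd z) *\<^sub>R ?J z - ?J z) \<bullet> (k n (snd z) *\<^sub>R ?J z - ?J z) = (k n (snd z) - 1)\<^sup>2 * (?J z \<bullet> ?J z)" for n and z :: "'a \<times> real"
      by (simp only: scaleR_left_diff_distrib[of _ 1, simplified, symmetric] inner_scaleR_left inner_scaleR_right power2_eq_square mult.assoc scaleR_one)
    show "AE z in lebesgue_on ?Q. norm ((k n (snd z) *\<^sub>R ?J z - ?J z) \<bullet> (k n (snd z) *\<^sub>R ?J z - ?J z)) \<le> ?J z \<bullet> ?J z" for n
    proof (rule AE_I2)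
      fix z :: "'a \<times> real"
      have "(k n (snd z) - 1)\<^sup>2 \<le> 1" using k01[of n "snd z"] by (simp add: abs_square_le_1)
      from mult_right_mono[OF this, of "?J z \<bullet> ?J z"]
      show "norm ((k n (snd z) *\<^sub>R ?J z - ?J z) \<bullet> (k n (snd z) *\<^sub>R ?J z - ?J z)) \<le> ?J z \<bullet> ?J z"
        unfolding eq by simp
    qed
    show "AE z in lebesgue_on ?Q. (\<lambda>n. (k n (snd z) *\<^sub>R ?J z - ?J z) \<bullet> (k n (snd z) *\<^sub>R ?J z - ?J z)) \<longlonglongrightarrow> 0"
    proof (rule AE_I2)
      fix z :: "'a \<times> real" assume "z \<in> space (lebesgue_on ?Q)"
      then have "snd z > 0" by (auto simp: cyl_def)
      from tendsto_mult_right[OF tendsto_power[OF tendsto_diff[OF klim[OF this] tendsto_const[of 1]], of 2], of "?J z \<bullet> ?J z"]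
      show "(\<lambda>n. (k n (snd z) *\<^sub>R ?J z - ?J z) \<bullet> (k n (snd z) *\<^sub>R ?J z - ?J z)) \<longlonglongrightarrow> 0"
        unfolding eq by simp
    qed
  qed simp
  from tendsto_real_sqrt[OF this]
  have "(\<lambda>n. l2norm ?Q (\<lambda>z. k n (snd z) *\<^sub>R ?J z - ?J z)) \<longlonglongrightarrow> 0"
    unfolding l2norm_def by simp
  then have "l2lim ?Q (\<lambda>n z. k n (snd z) *\<^sub>R ?J z) ?J"
    unfolding l2lim_def using JL kL by blast
  then show ?thesis
    unfolding L2H01_iff[OF \<Omega>] using C'
    by (intro exI[of _ "\<lambda>n z. k n (snd z) * \<psi> z"] exI[of _ "\<lambda>n z. k n (snd z) *\<^sub>R E z + (k' n (snd z) * \<psi> z) *\<^sub>R (0, 1)"] conjI allI)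
      simp_all
qed

section \<open>Existence of weak solutions\<close>

text \<open>This is the orthogonal projection of F onto the closed subspace of pairs of a function
  and its gradient: the functional is represented on test functions, the representing pair is their
  limit, and density extends the identity.\<close>

lemma L2H01_projection:
  fixes F :: "'a::euclidean_space \<times> real \<Rightarrow> real \<times> 'a"
  assumes \<Omega>: "open \<Omega>" and F: "F \<in> L2 (cyl \<Omega> T)"
  shows "\<exists>w g. L2H01 \<Omega> T w g \<and> (\<forall>h k. L2H01 \<Omega> T h k \<longrightarrow>
    ip (cyl \<Omega> T) (\<lambda>z. (w z, g z)) (\<lambda>z. (h z, k z)) = ip (cyl \<Omega> T) F (\<lambda>z. (h z, k z)))"
proof -
  let ?Q = "cyl \<Omega> T"
  define I where "I = {(\<phi>, D). C1c ?Q \<phi> D}"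
  define A :: "('a \<times> real \<Rightarrow> real) \<times> ('a \<times> real \<Rightarrow> 'a \<times> real) \<Rightarrow> 'a \<times> real \<Rightarrow> real \<times> 'a"
    where "A = (\<lambda>(\<phi>, D) z. (\<phi> z, fst (D z)))"
  have L: "A i \<in> L2 ?Q" if "i \<in> I" for i
    using that C1c_L2(5)[OF cyl_measurable[OF \<Omega>]] by (auto simp: I_def A_def)
  have "\<exists>u s. (\<forall>n. s n \<in> I) \<and> l2lim ?Q (\<lambda>n. A (s n)) u \<and> (\<forall>i\<in>I. ip ?Q u (A i) = ip ?Q F (A i))"
  proof (rule Riesz_family[where C = "l2norm ?Q F", OF _ L])
    show "I \<noteq> {}" using C1c_zero[of ?Q] by (auto simp: I_def)
    fix i assume i: "i \<in> I"
    show "\<bar>ip ?Q F (A i)\<bar> \<le> l2norm ?Q F * l2norm ?Q (A i)" by (rule ip_Cauchy_Schwarz[OF F L[OF i]])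
    fix j c assume j: "j \<in> I"
    obtain \<phi> D \<psi> E where ij: "i = (\<phi>, D)" "j = (\<psi>, E)" by (cases i, cases j)
    show "\<exists>k\<in>I. (AE z in lebesgue_on ?Q. A k z = A i z + c *\<^sub>R A j z) \<and> ip ?Q F (A k) = ip ?Q F (A i) + c * ip ?Q F (A j)"
    proof (rule bexI)
      let ?k = "(\<lambda>z. \<phi> z + c * \<psi> z, \<lambda>z. D z + c *\<^sub>R E z)"
      show "?k \<in> I" using i j C1c_lincomb[of ?Q \<phi> D \<psi> E c] unfolding ij I_def by simp
      have k: "A ?k = (\<lambda>z. A i z + c *\<^sub>R A j z)" unfolding A_def ij by auto
      show "(AE z in lebesgue_on ?Q. A ?k z = A i z + c *\<^sub>R A j z) \<and> ip ?Q F (A ?k) = ip ?Q F (A i) + c * ip ?Q F (A j)"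
        unfolding k using ip_add_right[OF L[OF i] L2_scaleR[OF L[OF j]] F] by (simp add: ip_scaleR_right)
    qed
  qed
  then obtain u s where s: "\<And>n. s n \<in> I" and l: "l2lim ?Q (\<lambda>n. A (s n)) u"
    and u: "\<And>i. i \<in> I \<Longrightarrow> ip ?Q u (A i) = ip ?Q F (A i)" by blast
  let ?w = "\<lambda>z. fst (u z)" and ?g = "\<lambda>z. snd (u z)"
  have A_eq: "A i = (\<lambda>z. (fst i z, fst (snd i z)))" for i unfolding A_def by (simp add: split_beta)
  have w: "L2H01 \<Omega> T ?w ?g"
    unfolding L2H01_iff[OF \<Omega>] using s l unfolding A_eq I_def
    by (intro exI[of _ "\<lambda>n. fst (s n)"] exI[of _ "\<lambda>n. snd (s n)"]) (simp add: split_beta)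
  have uL: "u \<in> L2 ?Q" using l by (simp add: l2lim_def)
  have "ip ?Q (\<lambda>z. (?w z, ?g z)) (\<lambda>z. (h z, k z)) = ip ?Q F (\<lambda>z. (h z, k z))" if hk: "L2H01 \<Omega> T h k" for h k
  proof -
    obtain \<phi> D where \<phi>: "\<And>n. C1c ?Q (\<phi> n) (D n)"
      and lim: "l2lim ?Q (\<lambda>n z. (\<phi> n z, fst (D n z))) (\<lambda>z. (h z, k z))"
      by (rule L2H01_approx[OF \<Omega> hk]) blast
    have "ip ?Q (\<lambda>z. (\<phi> n z, fst (D n z))) u = ip ?Q (\<lambda>z. (\<phi> n z, fst (D n z))) F" for n
      using u[of "(\<phi> n, D n)"] \<phi>[of n] by (simp add: I_def A_def ip_commute)
    with l2lim_ip[OF lim uL] have "(\<lambda>n. ip ?Q (\<lambda>z. (\<phi> n z, fst (D n z))) F) \<longlonglongrightarrow> ip ?Q (\<lambda>z. (h z, k z)) u"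
      by simp
    from LIMSEQ_unique[OF this l2lim_ip[OF lim F]] show ?thesis by (simp add: ip_commute)
  qed
  with w show ?thesis by blast
qed

text \<open>The assumptions are invariant under the reversal of time, which permits a second
  interpretation with reversed coefficients for the adjoint problem.\<close>

locale parabolic =
  fixes \<Omega> :: "'a::euclidean_space set" and T a0 :: real and a b :: "'a \<times> real \<Rightarrow> real"
  assumes \<Omega>: "open \<Omega>" "bounded \<Omega>" and T: "T > 0"
    and a: "a \<in> Linf (cyl \<Omega> T)" and b: "b \<in> Linf (cyl \<Omega> T)"
    and a0: "a0 > 0" "AE z in lebesgue_on (cyl \<Omega> T). a z \<ge> a0"
begin

abbreviation Q where "Q \<equiv> cyl \<Omega> T"

lemma Q_measurable: "Q \<in> sets lebesgue"
  by (rule cyl_measurable[OF \<Omega>(1)])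

lemma Q_lmeasurable: "Q \<in> lmeasurable"
  unfolding cyl_def using \<Omega> by (intro lmeasurable_open bounded_Times open_Times) auto

lemma ab_measurable: "a \<in> borel_measurable (lebesgue_on Q)" "b \<in> borel_measurable (lebesgue_on Q)"
  using a b by (auto simp: Linf_def)

lemma ab_bounded: "\<exists>B\<ge>0. (AE z in lebesgue_on Q. \<bar>a z\<bar> \<le> B) \<and> (AE z in lebesgue_on Q. \<bar>b z\<bar> \<le> B)"
proof -
  obtain A B where A: "AE z in lebesgue_on Q. \<bar>a z\<bar> \<le> A" and B: "AE z in lebesgue_on Q. \<bar>b z\<bar> \<le> B"
    using a b by (auto simp: Linf_def)
  have "AE z in lebesgue_on Q. \<bar>a z\<bar> \<le> max 0 (max A B)" using A by eventually_elim simp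
  moreover have "AE z in lebesgue_on Q. \<bar>b z\<bar> \<le> max 0 (max A B)" using B by eventually_elim simp
  ultimately show ?thesis by (intro exI[of _ "max 0 (max A B)"]) simp
qed

lemma L2_mult_a: "g \<in> L2 Q \<Longrightarrow> (\<lambda>z. a z *\<^sub>R g z) \<in> L2 Q" for g :: "'a \<times> real \<Rightarrow> 'b::euclidean_space"
  using ab_bounded ab_measurable(1) L2_mult_bounded by blast

lemma L2_mult_b: "g \<in> L2 Q \<Longrightarrow> (\<lambda>z. b z * g z) \<in> L2 Q"
  using ab_bounded ab_measurable(2) L2_mult_bounded_real by blast

text \<open>The formal adjoint of the parabolic operator, in the sense that \<open>(y, \<nabla>y) \<bullet> dual_op \<phi> D\<close> is the
  integrand of the weak formulation.\<close>

definition dual_op :: "('a \<times> real \<Rightarrow> real) \<Rightarrow> ('a \<times> real \<Rightarrow> 'a \<times> real) \<Rightarrow> 'a \<times> real \<Rightarrow> real \<times> 'a" where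
  "dual_op \<phi> D z = (- snd (D z) + b z * \<phi> z, a z *\<^sub>R fst (D z))"

lemma dual_op_L2: "C1c S \<phi> D \<Longrightarrow> dual_op \<phi> D \<in> L2 Q"
  unfolding dual_op_def[abs_def] L2_Pair
  by (intro conjI L2_add L2_minus L2_mult_a L2_mult_b C1c_L2[OF Q_measurable])

lemma weak_solution_iff:
  "weak_solution \<Omega> T a b f y0 y \<longleftrightarrow> (\<exists>g. L2H01 \<Omega> T y g \<and> (\<forall>\<phi> D. C1c (\<Omega> \<times> {..<T}) \<phi> D \<longrightarrow>
     ip Q (\<lambda>z. (y z, g z)) (dual_op \<phi> D) = ip Q f \<phi> + ip \<Omega> y0 (\<lambda>x. \<phi> (x, 0))))"
proof -
  have "ip Q (\<lambda>z. (y z, g z)) (dual_op \<phi> D) = (LINT z|lebesgue_on (cyl \<Omega> T).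
             - y z * snd (D z) + a z * (g z \<bullet> fst (D z)) + b z * y z * \<phi> z)" for g \<phi> D
    unfolding ip_def dual_op_def by (rule Bochner_Integration.integral_cong) (auto simp: algebra_simps)
  then show ?thesis unfolding weak_solution_def ip_real by simp
qed

text \<open>The multiplier is exp (l t) times the test function. Its time term splits into an exact
  derivative, which integrates to half the squared trace at t = 0, and l/2 times a square, which
  dominates b. The estimate has the inf-sup form, with a partner \<open>\<psi>\<close> of controlled
  norm for each \<open>\<phi>\<close>, because \<open>\<phi>\<close> paired with itself need not
  give a positive value.\<close>

lemma coercive:
  "\<exists>C>0. \<forall>\<phi> D. C1c (\<Omega> \<times> {..<T}) \<phi> D \<longrightarrow> (\<exists>\<psi> E. C1c (\<Omega> \<times> {..<T}) \<psi> E \<and>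
     l2norm Q (\<lambda>z. (\<psi> z, fst (E z))) \<le> C * l2norm Q (\<lambda>z. (\<phi> z, fst (D z))) \<and>
     (l2norm Q (\<lambda>z. (\<phi> z, fst (D z))))\<^sup>2 + (l2norm \<Omega> (\<lambda>x. \<phi> (x, 0)))\<^sup>2
       \<le> C * ip Q (dual_op \<phi> D) (\<lambda>z. (\<psi> z, fst (E z))))"
proof -
  obtain B where B: "B \<ge> 0" "AE z in lebesgue_on Q. \<bar>a z\<bar> \<le> B" "AE z in lebesgue_on Q. \<bar>b z\<bar> \<le> B"
    using ab_bounded by blast
  \<comment> \<open>This makes l/2 + b at least 1 almost everywhere.\<close>
  define l where "l = 2 * B + 2"
  \<comment> \<open>The entry 1/2 stems from the trace term, the entry \<open>a0\<close> from the
    ellipticity of the gradient term.\<close>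
  define m where "m = min (1/2) a0"
  have m: "0 < m" "m \<le> 1/2" "m \<le> a0" using a0 by (auto simp: m_def)
  define k where "k t = exp (l * t)" for t
  have kd: "(k has_real_derivative l * k t) (at t)" for t
    unfolding k_def[abs_def] by (auto intro!: derivative_eq_intros)
  have kc: "continuous_on UNIV (\<lambda>t. l * k t)" unfolding k_def by (intro continuous_intros)
  have kcc: "continuous_on UNIV (\<lambda>z::'a \<times> real. k (snd z))" unfolding k_def by (intro continuous_intros)
  have k1: "1 \<le> k (snd z)" "k (snd z) \<le> k T" if "z \<in> Q" for z
    using that B(1) by (auto simp: k_def l_def cyl_def)
  have kT: "k T > 0" by (simp add: k_def)
  \<comment> \<open>The first entry bounds the norm of the multiplied test function, the second
    turns the lower bound \<open>m\<close> into the constant of the estimate.\<close>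
  let ?C = "max (k T) (inverse m)"
  show ?thesis
  proof (intro exI[of _ ?C] conjI allI impI)
    show "0 < ?C" using kT by simp
    fix \<phi> D assume C: "C1c (\<Omega> \<times> {..<T}) \<phi> D"
    let ?J = "\<lambda>z. (\<phi> z, fst (D z))"
    let ?\<psi> = "\<lambda>z. k (snd z) * \<phi> z" and ?E = "\<lambda>z. k (snd z) *\<^sub>R D z + (l * k (snd z) * \<phi> z) *\<^sub>R (0, 1)"
    have C\<psi>: "C1c (\<Omega> \<times> {..<T}) ?\<psi> ?E" by (rule C1c_mono[OF C1c_mult_time[OF C kd kc]]) blast
    have J\<psi>: "(\<lambda>z. (?\<psi> z, fst (?E z))) = (\<lambda>z. k (snd z) *\<^sub>R ?J z)" by (simp add: fun_eq_iff)
    note L = C1c_L2[OF Q_measurable C] and L\<psi> = C1c_L2[OF Q_measurable C\<psi>]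
    show "\<exists>\<psi> E. C1c (\<Omega> \<times> {..<T}) \<psi> E \<and>
       l2norm Q (\<lambda>z. (\<psi> z, fst (E z))) \<le> ?C * l2norm Q ?J \<and>
       (l2norm Q ?J)\<^sup>2 + (l2norm \<Omega> (\<lambda>x. \<phi> (x, 0)))\<^sup>2 \<le> ?C * ip Q (dual_op \<phi> D) (\<lambda>z. (\<psi> z, fst (E z)))"
    proof (intro exI[of _ ?\<psi>] exI[of _ ?E] conjI)
      show "C1c (\<Omega> \<times> {..<T}) ?\<psi> ?E" by (rule C\<psi>)
      have "l2norm Q (\<lambda>z. (?\<psi> z, fst (?E z))) \<le> k T * l2norm Q ?J"
      proof (rule power2_le_imp_le)
        have "ip Q (\<lambda>z. (?\<psi> z, fst (?E z))) (\<lambda>z. (?\<psi> z, fst (?E z))) \<le> (k T)\<^sup>2 * ip Q ?J ?J"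
          unfolding ip_def integral_mult_right_zero[symmetric]
        proof (rule integral_mono)
          show "integrable (lebesgue_on Q) (\<lambda>z. (?\<psi> z, fst (?E z)) \<bullet> (?\<psi> z, fst (?E z)))" by (rule L2_integrable[OF L\<psi>(5)])
          show "integrable (lebesgue_on Q) (\<lambda>z. (k T)\<^sup>2 * (?J z \<bullet> ?J z))" by (intro integrable_mult_right L2_integrable[OF L(5)])
          fix z assume "z \<in> space (lebesgue_on Q)"
          then have "(k (snd z))\<^sup>2 \<le> (k T)\<^sup>2" using k1[of z] by (intro power_mono) auto
          from mult_right_mono[OF this, of "?J z \<bullet> ?J z"]
          show "(?\<psi> z, fst (?E z)) \<bullet> (?\<psi> z, fst (?E z)) \<le> (k T)\<^sup>2 * (?J z \<bullet> ?J z)"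
            unfolding fun_cong[OF J\<psi>] inner_scaleR_left inner_scaleR_right by (simp add: power2_eq_square mult.assoc)
        qed
        then show "(l2norm Q (\<lambda>z. (?\<psi> z, fst (?E z))))\<^sup>2 \<le> (k T * l2norm Q ?J)\<^sup>2"
          by (simp add: power_mult_distrib l2norm_square)
      qed (use kT in simp)
      also have "\<dots> \<le> ?C * l2norm Q ?J" by (intro mult_right_mono) auto
      finally show "l2norm Q (\<lambda>z. (?\<psi> z, fst (?E z))) \<le> ?C * l2norm Q ?J" .
      \<comment> \<open>The gradient of \<open>\<phi> z * ?\<psi> z\<close>. Its time component is
        twice k times \<open>\<phi>\<close> times its time derivative, plus l k times the square of
        \<open>\<phi>\<close>; the time term of the form is therefore -1/2 of it plus the damping
        l/2.\<close>
      let ?G = "\<lambda>z. \<phi> z *\<^sub>R ?E z + ?\<psi> z *\<^sub>R D z"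
      have CG: "C1c (\<Omega> \<times> {..<T}) (\<lambda>z. \<phi> z * ?\<psi> z) ?G" by (rule C1c_mult[OF C C\<psi>])
      have "(LINT z|lebesgue_on Q. snd (?G z)) = - (LINT x|lebesgue_on \<Omega>. \<phi> (x, 0) * ?\<psi> (x, 0))"
        by (rule C1c_integral_time_derivative[OF \<Omega>(1) T CG])
      also have "(LINT x|lebesgue_on \<Omega>. \<phi> (x, 0) * ?\<psi> (x, 0)) = (l2norm \<Omega> (\<lambda>x. \<phi> (x, 0)))\<^sup>2"
        by (simp add: l2norm_square ip_real k_def)
      finally have tr: "(LINT z|lebesgue_on Q. snd (?G z)) = - (l2norm \<Omega> (\<lambda>x. \<phi> (x, 0)))\<^sup>2" .
      have iG: "integrable (lebesgue_on Q) (\<lambda>z. snd (?G z))"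
      proof -
        obtain K where K: "compact K" "\<And>z. z \<notin> K \<Longrightarrow> ?G z = 0" by (rule C1c_support[OF CG]) blast
        show ?thesis
        proof (rule integrable_continuous_compact[OF Q_measurable continuous_on_snd[OF C1c_continuous(2)[OF CG]] K(1)])
          show "snd (?G z) = 0" if "z \<notin> K" for z unfolding K(2)[OF that] by simp
        qed
      qed
      have "m * (l2norm Q ?J)\<^sup>2 + 1/2 * (l2norm \<Omega> (\<lambda>x. \<phi> (x, 0)))\<^sup>2
          = (LINT z|lebesgue_on Q. m * (?J z \<bullet> ?J z) - 1/2 * snd (?G z))"
        using tr iG L2_integrable[OF L(5)] by (simp add: l2norm_square ip_def)
      also have "\<dots> \<le> ip Q (dual_op \<phi> D) (\<lambda>z. (?\<psi> z, fst (?E z)))"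
        unfolding ip_def
      proof (rule integral_mono_AE)
        show "integrable (lebesgue_on Q) (\<lambda>z. m * (?J z \<bullet> ?J z) - 1/2 * snd (?G z))"
          using iG L2_integrable[OF L(5)] by (intro Bochner_Integration.integrable_diff integrable_mult_right)
        show "integrable (lebesgue_on Q) (\<lambda>z. dual_op \<phi> D z \<bullet> (?\<psi> z, fst (?E z)))"
          by (intro L2_integrable_inner dual_op_L2[OF C] L\<psi>)
        show "AE z in lebesgue_on Q. m * (?J z \<bullet> ?J z) - 1/2 * snd (?G z) \<le> dual_op \<phi> D z \<bullet> (?\<psi> z, fst (?E z))"
          using B(3) a0(2) AE_space
        proof eventually_elim
          case (elim z)
          let ?k = "k (snd z)" and ?n = "fst (D z) \<bullet> fst (D z)"
          have k: "1 \<le> ?k" using k1 elim(3) by simp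
          have "1 \<le> l/2 + b z" using elim(1) unfolding l_def abs_le_iff by (simp add: field_simps)
          then have "m * 1 \<le> (l/2 + b z) * ?k" using k m by (intro mult_mono) auto
          then have "m * (\<phi> z * \<phi> z) \<le> (l/2 + b z) * ?k * (\<phi> z * \<phi> z)" by (intro mult_right_mono) auto
          moreover have "m * 1 \<le> a z * ?k" using k m elim(2) by (intro mult_mono) auto
          then have "m * ?n \<le> a z * ?k * ?n" by (intro mult_right_mono) auto
          ultimately show ?case
            by (simp add: dual_op_def algebra_simps)
        qed
      qed
      finally have "m * (l2norm Q ?J)\<^sup>2 + 1/2 * (l2norm \<Omega> (\<lambda>x. \<phi> (x, 0)))\<^sup>2
          \<le> ip Q (dual_op \<phi> D) (\<lambda>z. (?\<psi> z, fst (?E z)))" (is "_ \<le> ?I") .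
      moreover have "m * (l2norm \<Omega> (\<lambda>x. \<phi> (x, 0)))\<^sup>2 \<le> 1/2 * (l2norm \<Omega> (\<lambda>x. \<phi> (x, 0)))\<^sup>2"
        using m by (intro mult_right_mono) auto
      ultimately have "m * ((l2norm Q ?J)\<^sup>2 + (l2norm \<Omega> (\<lambda>x. \<phi> (x, 0)))\<^sup>2) \<le> ?I"
        unfolding distrib_left by linarith
      then have le: "(l2norm Q ?J)\<^sup>2 + (l2norm \<Omega> (\<lambda>x. \<phi> (x, 0)))\<^sup>2 \<le> inverse m * ?I"
        using m(1) by (simp add: field_simps)
      moreover have "0 \<le> ?I"
        using le m(1) by (smt (verit) sum_power2_ge_zero zero_le_mult_iff inverse_positive_iff_positive)
      then have "inverse m * ?I \<le> ?C * ?I" by (intro mult_right_mono) auto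
      ultimately show "(l2norm Q ?J)\<^sup>2 + (l2norm \<Omega> (\<lambda>x. \<phi> (x, 0)))\<^sup>2 \<le> ?C * ?I" by linarith
    qed
  qed
qed

text \<open>On the energy space, pairing with \<open>dual_op \<phi> D\<close> is pairing with its
  projection. The weak formulation thus prescribes the inner products of the unknown pair with all
  these projections, and \<open>Riesz_family\<close> solves this system as soon as the data are
  bounded by the norms of the projections, which is what \<open>coercive\<close> provides.\<close>

lemma weak_solution_exists:
  assumes f: "f \<in> L2 Q" and y0: "y0 \<in> L2 \<Omega>"
  shows "\<exists>y. weak_solution \<Omega> T a b f y0 y"
proof -
  obtain C where C: "C > 0" and co: "\<And>\<phi> D. C1c (\<Omega> \<times> {..<T}) \<phi> D \<Longrightarrow> (\<exists>\<psi> E. C1c (\<Omega> \<times> {..<T}) \<psi> E \<and>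
     l2norm Q (\<lambda>z. (\<psi> z, fst (E z))) \<le> C * l2norm Q (\<lambda>z. (\<phi> z, fst (D z))) \<and>
     (l2norm Q (\<lambda>z. (\<phi> z, fst (D z))))\<^sup>2 + (l2norm \<Omega> (\<lambda>x. \<phi> (x, 0)))\<^sup>2
       \<le> C * ip Q (dual_op \<phi> D) (\<lambda>z. (\<psi> z, fst (E z))))"
    using coercive by blast
  define proj where "proj \<phi> D w g \<longleftrightarrow> L2H01 \<Omega> T w g \<and> (\<forall>h k. L2H01 \<Omega> T h k \<longrightarrow>
     ip Q (\<lambda>z. (w z, g z)) (\<lambda>z. (h z, k z)) = ip Q (dual_op \<phi> D) (\<lambda>z. (h z, k z)))" for \<phi> D w g
  \<comment> \<open>The projection is carried along in the index instead of being chosen as a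
    function of \<open>\<phi>\<close>; linear combinations of indices then need no linearity of a
    choice.\<close>
  define I where "I = {(\<phi>, D, w, g). C1c (\<Omega> \<times> {..<T}) \<phi> D \<and> proj \<phi> D w g}"
  define A :: "('a \<times> real \<Rightarrow> real) \<times> ('a \<times> real \<Rightarrow> 'a \<times> real) \<times> ('a \<times> real \<Rightarrow> real) \<times> ('a \<times> real \<Rightarrow> 'a) \<Rightarrow> 'a \<times> real \<Rightarrow> real \<times> 'a"
    where "A = (\<lambda>(\<phi>, D, w, g) z. (w z, g z))"
  define l :: "('a \<times> real \<Rightarrow> real) \<times> ('a \<times> real \<Rightarrow> 'a \<times> real) \<times> ('a \<times> real \<Rightarrow> real) \<times> ('a \<times> real \<Rightarrow> 'a) \<Rightarrow> real"
    where "l = (\<lambda>(\<phi>, D, w, g). ip Q f \<phi> + ip \<Omega> y0 (\<lambda>x. \<phi> (x, 0)))"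
  have proj_ex: "\<exists>w g. proj \<phi> D w g" if "C1c (\<Omega> \<times> {..<T}) \<phi> D" for \<phi> D
    unfolding proj_def by (rule L2H01_projection[OF \<Omega>(1) dual_op_L2[OF that]])
  have L: "A i \<in> L2 Q" if "i \<in> I" for i
  proof -
    obtain \<phi> D w g where "i = (\<phi>, D, w, g)" by (cases i)
    then show ?thesis using that L2H01_L2(3)[of \<Omega> T w g] unfolding I_def A_def proj_def by simp
  qed
  have "\<exists>u s. (\<forall>n. s n \<in> I) \<and> l2lim Q (\<lambda>n. A (s n)) u \<and> (\<forall>i\<in>I. ip Q u (A i) = l i)"
  proof (rule Riesz_family[where C = "(l2norm Q f + l2norm \<Omega> y0) * C\<^sup>2", OF _ L])
    show "I \<noteq> {}" using C1c_zero proj_ex unfolding I_def by blast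
    fix i assume i: "i \<in> I"
    obtain \<phi> D w g where ie: "i = (\<phi>, D, w, g)" by (cases i)
    have \<phi>: "C1c (\<Omega> \<times> {..<T}) \<phi> D" and pr: "proj \<phi> D w g" using i unfolding I_def ie by auto
    have wL: "(\<lambda>z. (w z, g z)) \<in> L2 Q" using L[OF i] unfolding A_def ie by simp
    show "\<bar>l i\<bar> \<le> (l2norm Q f + l2norm \<Omega> y0) * C\<^sup>2 * l2norm Q (A i)"
    proof -
      let ?X = "l2norm Q (\<lambda>z. (\<phi> z, fst (D z)))" and ?Y = "l2norm \<Omega> (\<lambda>x. \<phi> (x, 0))" and ?N = "l2norm Q (\<lambda>z. (w z, g z))"
      obtain \<psi> E where \<psi>: "C1c (\<Omega> \<times> {..<T}) \<psi> E" and n\<psi>: "l2norm Q (\<lambda>z. (\<psi> z, fst (E z))) \<le> C * ?X"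
        and cc: "?X\<^sup>2 + ?Y\<^sup>2 \<le> C * ip Q (dual_op \<phi> D) (\<lambda>z. (\<psi> z, fst (E z)))"
        using co[OF \<phi>] by blast
      \<comment> \<open>The partner \<open>\<psi>\<close> need not vanish at t = 0. That it still
        lies in the energy space, by \<open>C1c_initial_L2H01\<close>, is what allows it in the
        projection identity.\<close>
      have "ip Q (dual_op \<phi> D) (\<lambda>z. (\<psi> z, fst (E z))) = ip Q (\<lambda>z. (w z, g z)) (\<lambda>z. (\<psi> z, fst (E z)))"
        using pr C1c_initial_L2H01[OF \<Omega>(1) \<psi>] unfolding proj_def by simp
      also have "\<dots> \<le> ?N * l2norm Q (\<lambda>z. (\<psi> z, fst (E z)))"
        using ip_Cauchy_Schwarz[OF wL C1c_L2(5)[OF Q_measurable \<psi>]] by linarith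
      also have "\<dots> \<le> ?N * (C * ?X)" by (rule mult_left_mono[OF n\<psi>]) simp
      finally have "?X\<^sup>2 + ?Y\<^sup>2 \<le> C * (?N * (C * ?X))"
        using cc C by (meson mult_left_mono less_imp_le order_trans)
      then have XY: "?X\<^sup>2 + ?Y\<^sup>2 \<le> (C\<^sup>2 * ?N) * ?X" by (simp add: power2_eq_square mult_ac)
      \<comment> \<open>Omitting the trace and dividing by \<open>?X\<close> bounds
        \<open>?X\<close> by \<open>C\<^sup>2 * ?N\<close>; reinserted, this bounds
        \<open>?Y\<close> by the same quantity.\<close>
      have X: "?X \<le> C\<^sup>2 * ?N"
      proof (cases "?X = 0")
        case False
        then have "0 < ?X" using l2norm_nonneg[of Q "\<lambda>z. (\<phi> z, fst (D z))"] by linarith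
        moreover have "?X * ?X \<le> (C\<^sup>2 * ?N) * ?X" using XY zero_le_power2[of ?Y] unfolding power2_eq_square[of ?X] by linarith
        ultimately show ?thesis by simp
      qed simp
      have "?Y\<^sup>2 \<le> (C\<^sup>2 * ?N) * ?X" using XY zero_le_power2[of ?X] by linarith
      also have "\<dots> \<le> (C\<^sup>2 * ?N) * (C\<^sup>2 * ?N)" by (rule mult_left_mono[OF X]) simp
      finally have Y: "?Y \<le> C\<^sup>2 * ?N" unfolding power2_eq_square[of "C\<^sup>2 * ?N", symmetric] by (rule power2_le_imp_le) simp
      have "ip Q \<phi> \<phi> \<le> ip Q (\<lambda>z. (\<phi> z, fst (D z))) (\<lambda>z. (\<phi> z, fst (D z)))"
        using ip_nonneg[of Q "\<lambda>z. fst (D z)"] by (simp add: ip_Pair C1c_L2[OF Q_measurable \<phi>])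
      then have \<phi>X: "l2norm Q \<phi> \<le> ?X" by (simp add: l2norm_def)
      have "\<bar>l i\<bar> \<le> \<bar>ip Q f \<phi>\<bar> + \<bar>ip \<Omega> y0 (\<lambda>x. \<phi> (x, 0))\<bar>" unfolding l_def ie by simp
      also have "\<dots> \<le> l2norm Q f * l2norm Q \<phi> + l2norm \<Omega> y0 * ?Y"
        by (intro add_mono ip_Cauchy_Schwarz f y0 C1c_L2[OF Q_measurable \<phi>] L2_trace[OF \<Omega>(1) \<phi>])
      also have "\<dots> \<le> l2norm Q f * (C\<^sup>2 * ?N) + l2norm \<Omega> y0 * (C\<^sup>2 * ?N)"
        using order_trans[OF \<phi>X X] Y by (intro add_mono mult_left_mono) auto
      also have "\<dots> = (l2norm Q f + l2norm \<Omega> y0) * C\<^sup>2 * l2norm Q (A i)"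
        unfolding A_def ie by (simp add: algebra_simps)
      finally show ?thesis .
    qed
    fix j c assume j: "j \<in> I"
    obtain \<psi> E v h where je: "j = (\<psi>, E, v, h)" by (cases j)
    have \<psi>: "C1c (\<Omega> \<times> {..<T}) \<psi> E" and pr': "proj \<psi> E v h" using j unfolding I_def je by auto
    have vL: "(\<lambda>z. (v z, h z)) \<in> L2 Q" using L[OF j] unfolding A_def je by simp
    let ?k = "(\<lambda>z. \<phi> z + c * \<psi> z, \<lambda>z. D z + c *\<^sub>R E z, \<lambda>z. w z + c * v z, \<lambda>z. g z + c *\<^sub>R h z)"
    show "\<exists>k\<in>I. (AE z in lebesgue_on Q. A k z = A i z + c *\<^sub>R A j z) \<and> l k = l i + c * l j"
    proof (intro bexI conjI)
      show "AE z in lebesgue_on Q. A ?k z = A i z + c *\<^sub>R A j z" unfolding A_def ie je by simp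
      show "l ?k = l i + c * l j"
        unfolding l_def ie je using C1c_L2(1)[OF Q_measurable \<phi>] C1c_L2(1)[OF Q_measurable \<psi>]
          L2_trace[OF \<Omega>(1) \<phi>] L2_trace[OF \<Omega>(1) \<psi>] f y0
        by (simp add: ip_right L2_cmult algebra_simps)
      have "proj (\<lambda>z. \<phi> z + c * \<psi> z) (\<lambda>z. D z + c *\<^sub>R E z) (\<lambda>z. w z + c * v z) (\<lambda>z. g z + c *\<^sub>R h z)"
        unfolding proj_def
      proof (intro conjI allI impI)
        show "L2H01 \<Omega> T (\<lambda>z. w z + c * v z) (\<lambda>z. g z + c *\<^sub>R h z)"
          using pr pr' unfolding proj_def by (intro L2H01_lincomb[OF \<Omega>(1)]) auto
        fix p q assume pq: "L2H01 \<Omega> T p q"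
        note pL = L2H01_L2(3)[OF pq]
        have "ip Q (\<lambda>z. (w z + c * v z, g z + c *\<^sub>R h z)) (\<lambda>z. (p z, q z))
            = ip Q (\<lambda>z. (w z, g z) + c *\<^sub>R (v z, h z)) (\<lambda>z. (p z, q z))" by simp
        also have "\<dots> = ip Q (\<lambda>z. (w z, g z)) (\<lambda>z. (p z, q z)) + c * ip Q (\<lambda>z. (v z, h z)) (\<lambda>z. (p z, q z))"
          unfolding ip_add_left[OF wL L2_scaleR[OF vL] pL] ip_scaleR_left ..
        also have "\<dots> = ip Q (dual_op \<phi> D) (\<lambda>z. (p z, q z)) + c * ip Q (dual_op \<psi> E) (\<lambda>z. (p z, q z))"
          using pr pr' pq unfolding proj_def by simp
        also have "\<dots> = ip Q (\<lambda>z. dual_op \<phi> D z + c *\<^sub>R dual_op \<psi> E z) (\<lambda>z. (p z, q z))"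
          unfolding ip_add_left[OF dual_op_L2[OF \<phi>] L2_scaleR[OF dual_op_L2[OF \<psi>]] pL] ip_scaleR_left ..
        also have "(\<lambda>z. dual_op \<phi> D z + c *\<^sub>R dual_op \<psi> E z) = dual_op (\<lambda>z. \<phi> z + c * \<psi> z) (\<lambda>z. D z + c *\<^sub>R E z)"
          by (auto simp: dual_op_def fun_eq_iff algebra_simps)
        finally show "ip Q (\<lambda>z. (w z + c * v z, g z + c *\<^sub>R h z)) (\<lambda>z. (p z, q z))
            = ip Q (dual_op (\<lambda>z. \<phi> z + c * \<psi> z) (\<lambda>z. D z + c *\<^sub>R E z)) (\<lambda>z. (p z, q z))" .
      qed
      then show "?k \<in> I" unfolding I_def using C1c_lincomb[OF \<phi> \<psi>, of c] by simp
    qed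
  qed
  then obtain u s where s: "\<And>n. s n \<in> I" and lim: "l2lim Q (\<lambda>n. A (s n)) u"
    and u: "\<And>i. i \<in> I \<Longrightarrow> ip Q u (A i) = l i" by blast
  let ?y = "\<lambda>z. fst (u z)" and ?g = "\<lambda>z. snd (u z)"
  have A_eq: "A i = (\<lambda>z. (fst (snd (snd i)) z, snd (snd (snd i)) z))" for i unfolding A_def by (simp add: split_beta)
  \<comment> \<open>The representing element is a limit of projections, all of which lie in the
    energy space, and that space is closed.\<close>
  have y: "L2H01 \<Omega> T ?y ?g"
  proof (rule L2H01_closed[OF \<Omega>(1)])
    show "l2lim Q (\<lambda>n z. (fst (snd (snd (s n))) z, snd (snd (snd (s n))) z)) (\<lambda>z. (?y z, ?g z))"
      using lim unfolding A_eq by simp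
    show "L2H01 \<Omega> T (fst (snd (snd (s n)))) (snd (snd (snd (s n))))" for n
      using s[of n] unfolding I_def proj_def by auto
  qed
  have "weak_solution \<Omega> T a b f y0 ?y"
    unfolding weak_solution_iff
  proof (intro exI[of _ ?g] conjI allI impI)
    show "L2H01 \<Omega> T ?y ?g" by (rule y)
    fix \<phi> D assume \<phi>: "C1c (\<Omega> \<times> {..<T}) \<phi> D"
    obtain w g where pr: "proj \<phi> D w g" using proj_ex[OF \<phi>] by blast
    then have prj: "ip Q (\<lambda>z. (w z, g z)) (\<lambda>z. (h z, k z)) = ip Q (dual_op \<phi> D) (\<lambda>z. (h z, k z))"
      if "L2H01 \<Omega> T h k" for h k using that unfolding proj_def by blast
    have "ip Q (\<lambda>z. (?y z, ?g z)) (dual_op \<phi> D) = ip Q (dual_op \<phi> D) (\<lambda>z. (?y z, ?g z))" by (rule ip_commute)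
    also have "\<dots> = ip Q (\<lambda>z. (w z, g z)) (\<lambda>z. (?y z, ?g z))"
      by (rule prj[OF y, symmetric])
    also have "\<dots> = ip Q u (A (\<phi>, D, w, g))" unfolding A_def by (simp add: ip_commute)
    also have "\<dots> = l (\<phi>, D, w, g)" by (rule u) (use \<phi> pr in \<open>simp add: I_def\<close>)
    finally show "ip Q (\<lambda>z. (?y z, ?g z)) (dual_op \<phi> D) = ip Q f \<phi> + ip \<Omega> y0 (\<lambda>x. \<phi> (x, 0))" by (simp add: l_def)
  qed
  then show ?thesis by blast
qed

end

section \<open>Steklov averages\<close>

text \<open>Translations in time do not map the cylinder to itself. After extension by zero they act
  on \<open>L2 UNIV\<close>, where the measure is invariant.\<close>

definition zext :: "'b set \<Rightarrow> ('b \<Rightarrow> 'c::zero) \<Rightarrow> 'b \<Rightarrow> 'c" where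
  "zext S f z = (if z \<in> S then f z else 0)"

lemma ip_zext_left:
  fixes f g :: "'b::euclidean_space \<Rightarrow> 'c::euclidean_space"
  assumes "S \<in> sets lebesgue"
  shows "ip S f g = ip UNIV (zext S f) g"
  unfolding ip_def Lebesgue_Measure.integral_restrict_UNIV[OF assms, symmetric] lebesgue_on_UNIV_eq
  by (rule Bochner_Integration.integral_cong) (auto simp: zext_def)

lemma ip_zext_right:
  fixes f g :: "'b::euclidean_space \<Rightarrow> 'c::euclidean_space"
  assumes "S \<in> sets lebesgue"
  shows "ip S f g = ip UNIV f (zext S g)"
  using ip_zext_left[OF assms, of g f] by (simp add: ip_commute)

lemma zext_measurable:
  fixes f :: "'b::euclidean_space \<Rightarrow> 'c::euclidean_space"
  assumes "S \<in> sets lebesgue" "f \<in> borel_measurable (lebesgue_on S)"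
  shows "zext S f \<in> borel_measurable lebesgue"
  using borel_measurable_if_I[OF assms(2,1)] unfolding zext_def[abs_def] .

lemma zext_L2:
  fixes f :: "'b::euclidean_space \<Rightarrow> 'c::euclidean_space"
  assumes S: "S \<in> sets lebesgue" and f: "f \<in> L2 S"
  shows "zext S f \<in> L2 UNIV"
proof (rule L2I)
  show "zext S f \<in> borel_measurable (lebesgue_on UNIV)"
    unfolding lebesgue_on_UNIV_eq by (rule zext_measurable[OF S L2_measurable[OF f]])
  have "integrable lebesgue (\<lambda>z. indicator S z *\<^sub>R (f z \<bullet> f z))"
    using L2_integrable[OF f] S by (subst (asm) integrable_restrict_space) auto
  moreover have "(\<lambda>z. indicator S z *\<^sub>R (f z \<bullet> f z)) = (\<lambda>z. zext S f z \<bullet> zext S f z)"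
    by (auto simp: zext_def fun_eq_iff)
  ultimately show "integrable (lebesgue_on UNIV) (\<lambda>z. zext S f z \<bullet> zext S f z)"
    unfolding lebesgue_on_UNIV_eq by simp
qed

lemma L2_restrict:
  fixes f :: "'b::euclidean_space \<Rightarrow> 'c::euclidean_space"
  assumes S: "S \<in> sets lebesgue" and SR: "S \<subseteq> R" and R: "R \<in> sets lebesgue" and f: "f \<in> L2 R"
  shows "f \<in> L2 S"
proof (rule L2I)
  show m: "f \<in> borel_measurable (lebesgue_on S)"
    using L2_measurable[OF f] SR by (rule measurable_restrict_mono)
  have "integrable lebesgue (\<lambda>z. indicator R z *\<^sub>R (f z \<bullet> f z))"
    using L2_integrable[OF f] R by (subst (asm) integrable_restrict_space) auto
  then have "integrable lebesgue (\<lambda>z. indicator S z *\<^sub>R (indicator R z *\<^sub>R (f z \<bullet> f z)))"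
    using S by (rule integrable_mult_indicator[rotated])
  moreover have "(\<lambda>z. indicator S z *\<^sub>R (indicator R z *\<^sub>R (f z \<bullet> f z))) = (\<lambda>z. indicator S z *\<^sub>R (f z \<bullet> f z))"
    using SR by (auto simp: fun_eq_iff indicator_def)
  ultimately show "integrable (lebesgue_on S) (\<lambda>z. f z \<bullet> f z)"
    using S by (subst integrable_restrict_space) auto
qed

lemma l2norm_restrict_le:
  fixes f :: "'b::euclidean_space \<Rightarrow> 'c::euclidean_space"
  assumes S: "S \<in> sets lebesgue" and f: "f \<in> L2 UNIV"
  shows "l2norm S f \<le> l2norm UNIV f"
proof -
  have m: "zext S f \<in> L2 UNIV" by (rule zext_L2[OF S L2_restrict[OF S _ _ f]]) auto
  have "ip S f f = ip UNIV (zext S f) (zext S f)"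
    unfolding ip_zext_left[OF S] unfolding ip_def by (rule Bochner_Integration.integral_cong) (auto simp: zext_def)
  also have "\<dots> \<le> ip UNIV f f"
    unfolding ip_def by (rule integral_mono[OF L2_integrable[OF m] L2_integrable[OF f]]) (auto simp: zext_def)
  finally show ?thesis by (simp add: l2norm_def)
qed

lemma zext_apply_outside: "(\<And>z. z \<notin> S \<Longrightarrow> f z = 0) \<Longrightarrow> zext S f = f"
  by (auto simp: zext_def fun_eq_iff)

section \<open>Translations and time reversal as measure-preserving maps\<close>

definition preserves_lebesgue :: "('b::euclidean_space \<Rightarrow> 'b) \<Rightarrow> bool" where
  "preserves_lebesgue \<tau> \<longleftrightarrow> \<tau> \<in> lebesgue \<rightarrow>\<^sub>M lebesgue \<and> distr lebesgue lebesgue \<tau> = lebesgue"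

text \<open>A diagonal map with entries of modulus 1 has unit Jacobian. All signs positive gives
  translations; one negative sign, in the time direction, gives time reversal.\<close>

lemma preserves_lebesgue_reflect:
  fixes c :: "'b::euclidean_space \<Rightarrow> real"
  assumes c: "\<And>j. j \<in> Basis \<Longrightarrow> \<bar>c j\<bar> = 1"
  shows "preserves_lebesgue (\<lambda>x. t + (\<Sum>j\<in>Basis. (c j * (x \<bullet> j)) *\<^sub>R j))"
proof -
  have c0: "c j \<noteq> 0" if "j \<in> Basis" for j using c[OF that] by auto
  have "lebesgue = density (distr lebesgue lebesgue (\<lambda>x. t + (\<Sum>j\<in>Basis. (c j * (x \<bullet> j)) *\<^sub>R j))) (\<lambda>_. (\<Prod>j\<in>Basis. \<bar>c j\<bar>))"
    by (rule lebesgue_affine_euclidean[OF c0])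
  also have "(\<Prod>j\<in>Basis. \<bar>c j\<bar>) = 1" by (rule prod.neutral) (use c in auto)
  finally have "distr lebesgue lebesgue (\<lambda>x. t + (\<Sum>j\<in>Basis. (c j * (x \<bullet> j)) *\<^sub>R j)) = lebesgue"
    by (simp add: density_1)
  then show ?thesis unfolding preserves_lebesgue_def using lebesgue_affine_measurable[of c t, OF c0] by blast
qed

lemma preserves_lebesgue_translation: "preserves_lebesgue (\<lambda>z. z + c)"
proof -
  have "(\<lambda>x. c + (\<Sum>j\<in>Basis. (1 * (x \<bullet> j)) *\<^sub>R j)) = (\<lambda>z. z + c)"
    by (simp add: euclidean_representation add.commute)
  with preserves_lebesgue_reflect[of "\<lambda>_. 1" c] show ?thesis by simp
qed

lemma preserves_lebesgue_time_reversal: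
  "preserves_lebesgue (\<lambda>z :: 'a::euclidean_space \<times> real. (fst z, c - snd z))"
proof -
  have "(\<lambda>x :: 'a \<times> real. (0, c) + (\<Sum>j\<in>Basis. ((if j = (0, 1) then -1 else 1) * (x \<bullet> j)) *\<^sub>R j)) = (\<lambda>z. (fst z, c - snd z))"
  proof
    fix x :: "'a \<times> real"
    have e: "(0, 1) \<in> (Basis :: ('a \<times> real) set)" by (auto simp: Basis_prod_def)
    have "(\<Sum>j\<in>Basis. ((if j = (0, 1) then -1 else 1) * (x \<bullet> j)) *\<^sub>R j)
        = (\<Sum>j\<in>Basis. (x \<bullet> j) *\<^sub>R j - (if j = (0, 1) then (2 * snd x) *\<^sub>R (0, 1) else 0))"
    proof (intro sum.cong refl)
      fix j :: "'a \<times> real"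
      show "((if j = (0, 1) then -1 else 1) * (x \<bullet> j)) *\<^sub>R j = (x \<bullet> j) *\<^sub>R j - (if j = (0, 1) then (2 * snd x) *\<^sub>R (0, 1) else 0)"
        by (cases "j = (0, 1)") (simp_all add: inner_prod_def flip: zero_prod_def)
    qed
    also have "\<dots> = x - (2 * snd x) *\<^sub>R (0, 1)"
      using e by (simp only: sum_subtractf euclidean_representation sum.delta[OF finite_Basis] if_True)
    finally show "(0, c) + (\<Sum>j\<in>Basis. ((if j = (0, 1) then -1 else 1) * (x \<bullet> j)) *\<^sub>R j) = (fst x, c - snd x)"
      by (cases x) simp
  qed
  with preserves_lebesgue_reflect[of "\<lambda>j :: 'a \<times> real. if j = (0, 1) then -1 else 1" "(0, c)"] show ?thesis by simp
qed

lemma integral_preserves_lebesgue: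
  fixes f :: "'b::euclidean_space \<Rightarrow> real"
  assumes \<tau>: "preserves_lebesgue \<tau>" and f: "f \<in> borel_measurable lebesgue"
  shows "(LINT z|lebesgue. f (\<tau> z)) = (LINT z|lebesgue. f z)"
    "integrable lebesgue (\<lambda>z. f (\<tau> z)) \<longleftrightarrow> integrable lebesgue f"
  using integral_distr[of \<tau> lebesgue lebesgue f] integrable_distr_eq[of \<tau> lebesgue lebesgue f] \<tau> f
  unfolding preserves_lebesgue_def by auto

lemma L2_compose_preserves_lebesgue:
  fixes f g :: "'b::euclidean_space \<Rightarrow> 'c::euclidean_space"
  assumes \<tau>: "preserves_lebesgue \<tau>" and f: "f \<in> L2 UNIV"
  shows "(\<lambda>z. f (\<tau> z)) \<in> L2 UNIV"
proof (rule L2I)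
  have m: "f \<in> borel_measurable lebesgue" using L2_measurable[OF f] by (simp add: lebesgue_on_UNIV_eq)
  have \<tau>m: "\<tau> \<in> lebesgue \<rightarrow>\<^sub>M lebesgue" using \<tau> by (simp add: preserves_lebesgue_def)
  show "(\<lambda>z. f (\<tau> z)) \<in> borel_measurable (lebesgue_on UNIV)"
    unfolding lebesgue_on_UNIV_eq by (rule measurable_compose[OF \<tau>m m])
  have "(\<lambda>z. f z \<bullet> f z) \<in> borel_measurable lebesgue" using m by measurable
  from integral_preserves_lebesgue(2)[OF \<tau> this] L2_integrable[OF f]
  show "integrable (lebesgue_on UNIV) (\<lambda>z. f (\<tau> z) \<bullet> f (\<tau> z))" by (simp add: lebesgue_on_UNIV_eq)
qed

lemma ip_compose_preserves_lebesgue: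
  fixes f g :: "'b::euclidean_space \<Rightarrow> 'c::euclidean_space"
  assumes \<tau>: "preserves_lebesgue \<tau>" and f: "f \<in> L2 UNIV" and g: "g \<in> L2 UNIV"
  shows "ip UNIV (\<lambda>z. f (\<tau> z)) (\<lambda>z. g (\<tau> z)) = ip UNIV f g"
proof -
  have "f \<in> borel_measurable lebesgue" "g \<in> borel_measurable lebesgue"
    using L2_measurable[OF f] L2_measurable[OF g] by (simp_all add: lebesgue_on_UNIV_eq)
  then have "(\<lambda>z. f z \<bullet> g z) \<in> borel_measurable lebesgue" by measurable
  from integral_preserves_lebesgue(1)[OF \<tau> this] show ?thesis by (simp add: ip_def lebesgue_on_UNIV_eq)
qed

text \<open>Steklov average over the forward interval from t to t + h. It is formed with the gauge
  integral, for which differentiation under the integral sign and the exchange of integrals of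
  continuous functions are available.\<close>

definition avg :: "real \<Rightarrow> ('a::euclidean_space \<times> real \<Rightarrow> 'c::euclidean_space) \<Rightarrow> 'a \<times> real \<Rightarrow> 'c" where
  "avg h G z = inverse h *\<^sub>R integral {0..h} (\<lambda>s. G (z + (0, s)))"

lemma continuous_shift:
  fixes G :: "'a::euclidean_space \<times> real \<Rightarrow> 'c::euclidean_space"
  assumes "continuous_on UNIV G"
  shows "continuous_on S (\<lambda>s. G (z + (0, s)))" "continuous_on S' (\<lambda>(z, s). G (z + (0, s)))"
proof -
  show "continuous_on S (\<lambda>s. G (z + (0, s)))"
    by (rule continuous_on_compose2[OF assms]) (auto intro!: continuous_intros)
  show "continuous_on S' (\<lambda>(z, s). G (z + (0, s)))"
    unfolding split_beta by (rule continuous_on_compose2[OF assms]) (auto intro!: continuous_intros)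
qed

lemma avg_continuous:
  fixes G :: "'a::euclidean_space \<times> real \<Rightarrow> 'c::euclidean_space"
  assumes "continuous_on UNIV G"
  shows "continuous_on UNIV (avg h G)"
  unfolding avg_def[abs_def] cbox_interval[symmetric]
  by (rule continuous_on_scaleR[OF continuous_on_const integral_continuous_on_param[OF continuous_shift(2)[OF assms]]])

text \<open>K' is K moved backward in time by all amounts between 0 and h. It depends on K and h
  alone and so serves every G supported in K.\<close>

lemma avg_support:
  assumes K: "compact K"
  obtains K' where "compact K'" "\<And>z. z \<in> K' \<Longrightarrow> \<exists>s\<in>{0..h}. z + (0, s) \<in> K"
    "\<And>G :: 'a::euclidean_space \<times> real \<Rightarrow> 'c::euclidean_space. (\<And>z. z \<notin> K \<Longrightarrow> G z = 0) \<Longrightarrow> \<forall>z. z \<notin> K' \<longrightarrow> avg h G z = 0"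
proof
  let ?K' = "(\<lambda>p. fst p - (0, snd p)) ` (K \<times> {0..h})"
  show "compact ?K'"
    by (intro compact_continuous_image compact_Times K compact_Icc continuous_intros)
  show "\<exists>s\<in>{0..h}. z + (0, s) \<in> K" if z: "z \<in> ?K'" for z
  proof -
    obtain p where p: "p \<in> K \<times> {0..h}" "z = fst p - (0, snd p)" using z by blast
    define w s where "w = fst p" and "s = snd p"
    have ws: "w \<in> K" "s \<in> {0..h}" "z = w - (0, s)" using p by (auto simp: w_def s_def)
    then have "z + (0, s) = w" by simp
    with ws(1) have "z + (0, s) \<in> K" by (simp only:)
    then show ?thesis using ws(2) by (rule bexI)
  qed
  fix G :: "'a \<times> real \<Rightarrow> 'c" assume G: "\<And>z. z \<notin> K \<Longrightarrow> G z = 0"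
  show "\<forall>z. z \<notin> ?K' \<longrightarrow> avg h G z = 0"
  proof (intro allI impI)
    fix z assume z: "z \<notin> ?K'"
    have "G (z + (0, s)) = 0" if "s \<in> {0..h}" for s
    proof (rule G, rule notI)
      assume "z + (0, s) \<in> K"
      then have "(z + (0, s), s) \<in> K \<times> {0..h}" using that by blast
      then have "fst (z + (0, s), s) - (0, snd (z + (0, s), s)) \<in> ?K'" by (rule imageI)
      with z show False by simp
    qed
    then have "integral {0..h} (\<lambda>s. G (z + (0, s))) = integral {0..h} (\<lambda>s. 0)" by (intro integral_cong) auto
    then show "avg h G z = 0" by (simp add: avg_def)
  qed
qed

text \<open>Since the support moves only backward in time, it stays below t = T; it may cross t = 0,
  which the class of test functions on \<open>\<Omega> \<times> {..<T}\<close> permits. The gradient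
  passes under the integral by the Leibniz rule.\<close>

lemma C1c_avg:
  fixes \<phi> :: "'a::euclidean_space \<times> real \<Rightarrow> real"
  assumes C: "C1c (\<Omega> \<times> {..<T}) \<phi> D"
  shows "C1c (\<Omega> \<times> {..<T}) (avg h \<phi>) (avg h D)"
proof -
  obtain K where K: "compact K" "K \<subseteq> \<Omega> \<times> {..<T}" "\<And>z. z \<notin> K \<Longrightarrow> \<phi> z = 0"
    by (rule C1c_support[OF C]) blast
  obtain K' where K': "compact K'" "\<And>z. z \<in> K' \<Longrightarrow> \<exists>s\<in>{0..h}. z + (0, s) \<in> K"
    "\<And>G :: 'a \<times> real \<Rightarrow> real. (\<And>z. z \<notin> K \<Longrightarrow> G z = 0) \<Longrightarrow> \<forall>z. z \<notin> K' \<longrightarrow> avg h G z = 0"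
    by (rule avg_support[OF K(1), where ?'c = real]) blast
  have K'\<Omega>: "K' \<subseteq> \<Omega> \<times> {..<T}"
  proof
    fix z assume "z \<in> K'"
    then obtain s where s: "s \<in> {0..h}" "z + (0, s) \<in> \<Omega> \<times> {..<T}" using K'(2) K(2) by blast
    then show "z \<in> \<Omega> \<times> {..<T}" by (cases z) auto
  qed
  note c = C1c_continuous[OF C]
  show ?thesis
  proof (rule C1cI[OF _ avg_continuous[OF c(2)] K'(1) K'\<Omega>])
    show "avg h \<phi> z = 0" if "z \<notin> K'" for z using K'(3)[of \<phi>] K(3) that by blast
    fix z
    have "((\<lambda>z. integral (cbox 0 h) (\<lambda>s. \<phi> (z + (0, s)))) has_derivative
        integral (cbox 0 h) (\<lambda>s. blinfun_inner_right (D (z + (0, s))))) (at z within UNIV)"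
    proof (rule leibniz_rule)
      show "((\<lambda>x. \<phi> (x + (0, t))) has_derivative blinfun_inner_right (D (x + (0, t)))) (at x)" for x t
        unfolding blinfun_inner_right.rep_eq
        by (rule has_derivative_eq_rhs[OF has_derivative_compose[OF has_derivative_add_const[OF has_derivative_ident] C1c_has_derivative[OF C]]]) simp
      show "(\<lambda>s. \<phi> (x + (0, s))) integrable_on cbox 0 h" for x
        by (rule integrable_continuous[OF continuous_shift(1)[OF c(1)]])
      show "continuous_on (UNIV \<times> cbox 0 h) (\<lambda>(x, t). blinfun_inner_right (D (x + (0, t))))"
        using bounded_linear.continuous_on[OF bounded_linear_blinfun_inner_right continuous_shift(2)[OF c(2)]]
        by (simp add: split_beta)
    qed auto
    also have "integral (cbox 0 h) (\<lambda>s. blinfun_inner_right (D (z + (0, s)))) = blinfun_inner_right (integral (cbox 0 h) (\<lambda>s. D (z + (0, s))))"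
      using integral_linear[OF integrable_continuous[OF continuous_shift(1)[OF c(2)]] bounded_linear_blinfun_inner_right, of 0 h z]
      by (simp add: o_def)
    finally have "((\<lambda>z. inverse h *\<^sub>R integral (cbox 0 h) (\<lambda>s. \<phi> (z + (0, s)))) has_derivative
        (\<lambda>k. inverse h *\<^sub>R blinfun_inner_right (integral (cbox 0 h) (\<lambda>s. D (z + (0, s)))) k)) (at z)"
      by (rule has_derivative_scaleR_right)
    then show "(avg h \<phi> has_derivative (\<bullet>) (avg h D z)) (at z)"
      unfolding avg_def[abs_def] cbox_interval[symmetric] blinfun_inner_right.rep_eq inner_scaleR_left real_scaleR_def .
  qed
qed

lemma avg_time_derivative:
  fixes \<phi> :: "'a::euclidean_space \<times> real \<Rightarrow> real"
  assumes C: "C1c S \<phi> D" and h: "h > 0"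
  shows "snd (avg h D z) = inverse h * (\<phi> (z + (0, h)) - \<phi> z)"
proof -
  have c: "continuous_on UNIV D" using C1c_continuous[OF C] by blast
  have "((\<lambda>s. snd (D (z + (0, s)))) has_integral \<phi> (z + (0, h)) - \<phi> (z + (0, 0))) {0..h}"
  proof (rule fundamental_theorem_of_calculus)
    fix s :: real
    have p: "((\<lambda>s. z + (0, s)) has_derivative (\<lambda>h. (0, h))) (at s within {0..h})"
      by (auto intro!: derivative_eq_intros)
    show "((\<lambda>s. \<phi> (z + (0, s))) has_vector_derivative snd (D (z + (0, s)))) (at s within {0..h})"
      unfolding has_vector_derivative_def
      by (rule has_derivative_eq_rhs[OF has_derivative_compose[OF p C1c_has_derivative[OF C]]]) (auto simp: inner_prod_def)
  qed (use h in simp)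
  moreover have "integral {0..h} (\<lambda>s. snd (D (z + (0, s)))) = snd (integral {0..h} (\<lambda>s. D (z + (0, s))))"
    using integral_linear[OF integrable_continuous_interval[OF continuous_shift(1)[OF c]] bounded_linear_snd, of 0 h z]
    by (simp add: o_def)
  ultimately show ?thesis unfolding avg_def by (simp add: integral_unique flip: zero_prod_def)
qed

lemma avg_linear:
  fixes G :: "'a::euclidean_space \<times> real \<Rightarrow> 'c::euclidean_space" and l :: "'c \<Rightarrow> 'd::euclidean_space"
  assumes G: "continuous_on UNIV G" and l: "bounded_linear l"
  shows "l (avg h G z) = avg h (\<lambda>z. l (G z)) z"
proof -
  have "integral {0..h} (l \<circ> (\<lambda>s. G (z + (0, s)))) = l (integral {0..h} (\<lambda>s. G (z + (0, s))))"
    by (rule integral_linear[OF integrable_continuous_interval[OF continuous_shift(1)[OF G]] l])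
  then show ?thesis
    using linear_scale[OF bounded_linear.linear[OF l]] by (simp add: avg_def o_def)
qed

lemma integral_cbox_eq_lebesgue:
  fixes f :: "'b::euclidean_space \<Rightarrow> real"
  assumes f: "continuous_on UNIV f" and K: "compact K" "K \<subseteq> cbox p q" "\<And>z. z \<notin> K \<Longrightarrow> f z = 0"
  shows "integral (cbox p q) f = (LINT z|lebesgue. f z)"
proof (rule integral_unique)
  have "integrable lebesgue f"
    using integrable_continuous_compact[OF _ f K(1,3), of UNIV] by (simp add: lebesgue_on_UNIV_eq)
  then have "(f has_integral (LINT z|lebesgue. f z)) UNIV" by (rule has_integral_integral_lebesgue)
  moreover have "f = (\<lambda>z. if z \<in> cbox p q then f z else 0)" using K by (auto simp: fun_eq_iff)
  ultimately have "((\<lambda>z. if z \<in> cbox p q then f z else 0) has_integral (LINT z|lebesgue. f z)) UNIV" by simp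
  then show "(f has_integral (LINT z|lebesgue. f z)) (cbox p q)" by (simp only: has_integral_restrict_UNIV)
qed

text \<open>Duality proof of Minkowski's inequality: the squared norm of the average is the mean
  over s of its inner products with the translates of G, all of which have the norm of G; one factor
  is then cancelled.\<close>

lemma l2norm_avg_le:
  fixes G :: "'a::euclidean_space \<times> real \<Rightarrow> 'c::euclidean_space"
  assumes G: "continuous_on UNIV G" and K: "compact K" "\<And>z. z \<notin> K \<Longrightarrow> G z = 0" and h: "h > 0"
  shows "avg h G \<in> L2 UNIV" "l2norm UNIV (avg h G) \<le> l2norm UNIV G"
proof -
  let ?A = "avg h G"
  obtain K' where K': "compact K'" "\<And>z. z \<in> K' \<Longrightarrow> \<exists>s\<in>{0..h}. z + (0, s) \<in> K"
    "\<And>G :: 'a \<times> real \<Rightarrow> 'c. (\<And>z. z \<notin> K \<Longrightarrow> G z = 0) \<Longrightarrow> \<forall>z. z \<notin> K' \<longrightarrow> avg h G z = 0"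
    by (rule avg_support[OF K(1), where ?'c = 'c]) blast
  have A0: "?A z = 0" if "z \<notin> K'" for z using K'(3)[of G] K(2) that by blast
  have Ac: "continuous_on UNIV ?A" by (rule avg_continuous[OF G])
  show AL: "?A \<in> L2 UNIV" by (rule L2_continuous_compact[OF _ Ac K'(1) A0]) auto
  have GL: "G \<in> L2 UNIV" by (rule L2_continuous_compact[OF _ G K]) auto
  obtain p q where pq: "K' \<subseteq> cbox p q" using bounded_subset_cbox_symmetric[OF compact_imp_bounded[OF K'(1)]] by blast
  let ?f = "\<lambda>z s. inverse h * (?A z \<bullet> G (z + (0, s)))"
  have fc: "continuous_on S (\<lambda>(z, s). ?f z s)" for S
    unfolding split_beta
    by (intro continuous_on_mult continuous_on_const continuous_on_inner continuous_on_compose2[OF Ac]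
        continuous_on_compose2[OF G] continuous_on_fst continuous_on_snd continuous_on_add continuous_on_Pair continuous_on_id) auto
  have fc': "continuous_on S (\<lambda>(s, z). ?f z s)" for S
    unfolding split_beta
    by (intro continuous_on_mult continuous_on_const continuous_on_inner continuous_on_compose2[OF Ac]
        continuous_on_compose2[OF G] continuous_on_fst continuous_on_snd continuous_on_add continuous_on_Pair continuous_on_id) auto
  have sq: "?A z \<bullet> ?A z = integral (cbox 0 h) (\<lambda>s. ?f z s)" for z
    using avg_linear[OF G bounded_linear_inner_right, of "?A z" h z]
    by (simp add: avg_def[where G = "\<lambda>w. ?A z \<bullet> G w"] cbox_interval)
  have inner_le: "integral (cbox p q) (\<lambda>z. ?f z s) \<le> inverse h * (l2norm UNIV ?A * l2norm UNIV G)" for s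
  proof -
    have "integral (cbox p q) (\<lambda>z. ?f z s) = (LINT z|lebesgue. ?f z s)"
    proof (rule integral_cbox_eq_lebesgue[OF _ K'(1) pq])
      show "continuous_on UNIV (\<lambda>z. ?f z s)"
        by (intro continuous_on_mult continuous_on_const continuous_on_inner Ac
          continuous_on_compose2[OF G] continuous_on_add continuous_on_Pair continuous_on_id) auto
      show "?f z s = 0" if "z \<notin> K'" for z using A0[OF that] by simp
    qed
    also have "\<dots> = inverse h * ip UNIV ?A (\<lambda>z. G (z + (0, s)))" by (simp add: ip_def lebesgue_on_UNIV_eq)
    also have "ip UNIV ?A (\<lambda>z. G (z + (0, s))) \<le> l2norm UNIV ?A * l2norm UNIV (\<lambda>z. G (z + (0, s)))"
      using ip_Cauchy_Schwarz[OF AL L2_compose_preserves_lebesgue[OF preserves_lebesgue_translation GL]]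
      by (rule order_trans[OF abs_ge_self])
    also have "l2norm UNIV (\<lambda>z. G (z + (0, s))) = l2norm UNIV G"
      unfolding l2norm_def ip_compose_preserves_lebesgue[OF preserves_lebesgue_translation GL GL] ..
    finally show ?thesis using h by simp
  qed
  have "(l2norm UNIV ?A)\<^sup>2 = (LINT z|lebesgue. ?A z \<bullet> ?A z)"
    by (simp add: l2norm_square ip_def lebesgue_on_UNIV_eq)
  also have "\<dots> = integral (cbox p q) (\<lambda>z. ?A z \<bullet> ?A z)"
    by (rule integral_cbox_eq_lebesgue[OF continuous_on_inner[OF Ac Ac] K'(1) pq, symmetric]) (simp add: A0)
  also have "\<dots> = integral (cbox p q) (\<lambda>z. integral (cbox 0 h) (\<lambda>s. ?f z s))" unfolding sq ..
  also have "\<dots> = integral (cbox 0 h) (\<lambda>s. integral (cbox p q) (\<lambda>z. ?f z s))"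
    by (rule integral_swap_continuous[OF fc])
  also have "\<dots> \<le> integral (cbox 0 h) (\<lambda>s. inverse h * (l2norm UNIV ?A * l2norm UNIV G))"
    by (rule integral_le[OF integrable_continuous[OF integral_continuous_on_param[OF fc']] integrable_const]) (rule inner_le)
  also have "\<dots> = l2norm UNIV ?A * l2norm UNIV G" using h by simp
  finally have le: "l2norm UNIV ?A * l2norm UNIV ?A \<le> l2norm UNIV ?A * l2norm UNIV G" by (simp add: power2_eq_square)
  show "l2norm UNIV ?A \<le> l2norm UNIV G"
  proof (cases "l2norm UNIV ?A = 0")
    case False
    then have "0 < l2norm UNIV ?A" using l2norm_nonneg[of UNIV ?A] by linarith
    with le show ?thesis by simp
  qed simp
qed

lemma uniformly_continuous_compact_support:
  fixes G :: "'b::euclidean_space \<Rightarrow> 'c::euclidean_space"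
  assumes G: "continuous_on UNIV G" and K: "compact K" "\<And>z. z \<notin> K \<Longrightarrow> G z = 0" and e: "e > 0"
  shows "\<exists>\<delta>>0. \<forall>z z'. dist z z' < \<delta> \<longrightarrow> norm (G z - G z') < e"
proof -
  obtain r where "\<forall>x\<in>K. norm x \<le> r" using compact_imp_bounded[OF K(1)] unfolding bounded_iff by blast
  then have r: "K \<subseteq> cball 0 r" by auto
  have "uniformly_continuous_on (cball 0 (r + 1)) G"
    by (rule compact_uniformly_continuous[OF continuous_on_subset[OF G]]) auto
  then obtain d where d: "d > 0" "\<And>z z'. z \<in> cball 0 (r + 1) \<Longrightarrow> z' \<in> cball 0 (r + 1) \<Longrightarrow> dist z' z < d \<Longrightarrow> dist (G z') (G z) < e"
    using e unfolding uniformly_continuous_on_def by blast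
  show ?thesis
  \<comment> \<open>The ball is one unit larger than the one containing K. If one of two points at
    distance below 1 lies outside it, neither belongs to K.\<close>
  proof (intro exI[of _ "min d 1"] conjI allI impI)
    fix z z' :: 'b assume zz: "dist z z' < min d 1"
    show "norm (G z - G z') < e"
    proof (cases "z \<in> cball 0 (r + 1) \<and> z' \<in> cball 0 (r + 1)")
      case True
      then show ?thesis using d(2)[of z' z] zz by (simp add: dist_norm)
    next
      case False
      have "norm z \<le> norm z' + dist z z'" "norm z' \<le> norm z + dist z z'"
        using norm_triangle_ineq2[of z z'] norm_triangle_ineq2[of z' z] by (simp_all add: dist_norm norm_minus_commute)
      then have "norm z > r" "norm z' > r" using False zz by auto
      then have "z \<notin> K" "z' \<notin> K" using r by auto
      then show ?thesis using K(2) e by simp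
    qed
  qed (use d in simp)
qed

lemma avg_uniform:
  fixes G :: "'a::euclidean_space \<times> real \<Rightarrow> 'c::euclidean_space"
  assumes G: "continuous_on UNIV G" and K: "compact K" "\<And>z. z \<notin> K \<Longrightarrow> G z = 0" and e: "e > 0"
  shows "\<forall>\<^sub>F h in at_right 0. \<forall>z. norm (avg h G z - G z) \<le> e"
proof -
  obtain d where d: "d > 0" "\<And>z z'. dist z z' < d \<Longrightarrow> norm (G z - G z') < e"
    using uniformly_continuous_compact_support[OF assms] by blast
  have "norm (avg h G z - G z) \<le> e" if h: "h > 0" "h < d" for h z
  proof -
    let ?I = "integral {0..h} (\<lambda>s. G (z + (0, s)))"
    have "(\<lambda>s. G (z + (0, s))) integrable_on cbox 0 h"
      by (rule integrable_continuous[OF continuous_shift(1)[OF G]])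
    then have "((\<lambda>s. G (z + (0, s)) - G z) has_integral (integral (cbox 0 h) (\<lambda>s. G (z + (0, s))) - measure lborel (cbox 0 h) *\<^sub>R G z)) (cbox 0 h)"
      by (intro has_integral_diff has_integral_const integrable_integral)
    then have "norm (integral (cbox 0 h) (\<lambda>s. G (z + (0, s))) - measure lborel (cbox 0 h) *\<^sub>R G z) \<le> e * measure lborel (cbox 0 h)"
    proof (rule has_integral_bound[rotated])
      fix s assume s: "s \<in> cbox 0 h"
      have "dist (z + (0, s)) z < d" using s h by (simp add: dist_norm norm_Pair)
      from d(2)[OF this] show "norm (G (z + (0, s)) - G z) \<le> e" by simp
    qed (use e in simp)
    then have "norm (?I - h *\<^sub>R G z) \<le> e * h" using h by (simp add: cbox_interval)
    then have "inverse h * norm (?I - h *\<^sub>R G z) \<le> inverse h * (e * h)" using h by (intro mult_left_mono) auto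
    also have "inverse h * (e * h) = e" using h by simp
    also have "inverse h * norm (?I - h *\<^sub>R G z) = norm (inverse h *\<^sub>R (?I - h *\<^sub>R G z))" using h by simp
    also have "inverse h *\<^sub>R (?I - h *\<^sub>R G z) = avg h G z - G z" using h by (simp add: avg_def scaleR_diff_right)
    finally show ?thesis .
  qed
  then show ?thesis unfolding eventually_at_right_field using d(1) by blast
qed

text \<open>The averages converge uniformly, and on a set of finite measure this implies convergence
  in mean square.\<close>

lemma ip_avg_tendsto:
  fixes G :: "'a::euclidean_space \<times> real \<Rightarrow> 'c::euclidean_space"
  assumes S: "S \<in> lmeasurable" and F: "F \<in> L2 S"
    and G: "continuous_on UNIV G" and K: "compact K" "\<And>z. z \<notin> K \<Longrightarrow> G z = 0"
  shows "((\<lambda>h. ip S F (avg h G)) \<longlongrightarrow> ip S F G) (at_right 0)"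
proof (rule tendstoI)
  fix e :: real assume e: "e > 0"
  have Ss: "S \<in> sets lebesgue" using S by (rule fmeasurableD)
  define m where "m = measure (lebesgue_on S) S"
  have m: "0 \<le> m" by (simp add: m_def)
  \<comment> \<open>The summand 1 keeps \<open>N\<close> positive and makes the final inequality
    strict.\<close>
  define N where "N = l2norm S F * sqrt m + 1"
  have N: "N > 0" using m unfolding N_def by (intro add_nonneg_pos mult_nonneg_nonneg) auto
  interpret finite_measure "lebesgue_on S" by (rule finite_measure_lebesgue_on[OF S])
  have GL: "G \<in> L2 S" by (rule L2_continuous_compact[OF Ss G K])
  have "\<forall>\<^sub>F h in at_right 0. \<forall>z. norm (avg h G z - G z) \<le> e / N"
    by (rule avg_uniform[OF G K]) (use e N in auto)
  moreover have "\<forall>\<^sub>F h::real in at_right 0. h > 0" by (simp add: eventually_at_right_less)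
  ultimately show "\<forall>\<^sub>F h in at_right 0. dist (ip S F (avg h G)) (ip S F G) < e"
  proof eventually_elim
    case (elim h)
    have AL: "avg h G \<in> L2 S" by (rule L2_restrict[OF Ss _ _ l2norm_avg_le(1)[OF G K elim(2)]]) auto
    have DL: "(\<lambda>z. avg h G z - G z) \<in> L2 S" by (rule L2_diff[OF AL GL])
    have "ip S (\<lambda>z. avg h G z - G z) (\<lambda>z. avg h G z - G z) \<le> (LINT z|lebesgue_on S. (e/N)\<^sup>2)"
      unfolding ip_def
    proof (rule integral_mono[OF L2_integrable[OF DL] integrable_const])
      fix z
      have "(norm (avg h G z - G z))\<^sup>2 \<le> (e/N)\<^sup>2" by (rule power_mono[OF elim(1)[rule_format]]) simp
      then show "(avg h G z - G z) \<bullet> (avg h G z - G z) \<le> (e/N)\<^sup>2" by (simp only: power2_norm_eq_inner)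
    qed
    also have "\<dots> = m * (e/N)\<^sup>2" by (simp add: m_def)
    finally have "l2norm S (\<lambda>z. avg h G z - G z) \<le> sqrt (m * (e/N)\<^sup>2)" unfolding l2norm_def by (rule real_sqrt_le_mono)
    also have "\<dots> = sqrt m * (e/N)" using e N by (simp add: real_sqrt_mult)
    finally have n: "l2norm S (\<lambda>z. avg h G z - G z) \<le> sqrt m * (e/N)" .
    have "dist (ip S F (avg h G)) (ip S F G) = \<bar>ip S F (\<lambda>z. avg h G z - G z)\<bar>"
      unfolding ip_diff_right[OF AL GL F] dist_real_def ..
    also have "\<dots> \<le> l2norm S F * l2norm S (\<lambda>z. avg h G z - G z)" by (rule ip_Cauchy_Schwarz[OF F DL])
    also have "\<dots> \<le> l2norm S F * (sqrt m * (e/N))" by (rule mult_left_mono[OF n]) simp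
    also have "\<dots> = (N - 1) * (e/N)" by (simp add: N_def)
    also have "\<dots> < N * (e/N)" using e N by (intro mult_strict_right_mono) auto
    also have "\<dots> = e" using N by simp
    finally show ?case .
  qed
qed

section \<open>The equation tested with its own solutions\<close>

context parabolic
begin

abbreviation shift :: "real \<Rightarrow> ('a \<times> real \<Rightarrow> real) \<Rightarrow> 'a \<times> real \<Rightarrow> real" where
  "shift h w \<equiv> (\<lambda>z. zext Q w (z + (0, h)))"

lemma shift_L2: "w \<in> L2 Q \<Longrightarrow> shift h w \<in> L2 Q"
  by (rule L2_restrict[OF Q_measurable _ _ L2_compose_preserves_lebesgue[OF preserves_lebesgue_translation zext_L2[OF Q_measurable]]]) auto

text \<open>Summation by parts in time: translating both factors by -h preserves the integral over
  the whole space, and extension by zero leaves no boundary terms.\<close>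

lemma shift_adjoint:
  assumes y: "y \<in> L2 Q" and w: "w \<in> L2 Q"
  shows "ip Q y (shift h w) = ip Q (shift (- h) y) w"
proof -
  have yL: "zext Q y \<in> L2 UNIV" and wL: "zext Q w \<in> L2 UNIV" by (rule zext_L2[OF Q_measurable y], rule zext_L2[OF Q_measurable w])
  have "ip Q y (shift h w) = ip UNIV (zext Q y) (shift h w)" by (rule ip_zext_left[OF Q_measurable])
  also have "\<dots> = ip UNIV (\<lambda>z. zext Q y (z + (0, - h))) (\<lambda>z. shift h w (z + (0, - h)))"
    by (rule ip_compose_preserves_lebesgue[OF preserves_lebesgue_translation yL
          L2_compose_preserves_lebesgue[OF preserves_lebesgue_translation wL], symmetric])
  also have "(\<lambda>z. shift h w (z + (0, - h))) = zext Q w"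
  proof
    fix z :: "'a \<times> real"
    have "z + (0, - h) + (0, h) = z" by (cases z) simp
    then show "shift h w (z + (0, - h)) = zext Q w z" by (simp only:)
  qed
  also have "ip UNIV (shift (- h) y) (zext Q w) = ip Q (shift (- h) y) w" by (rule ip_zext_right[OF Q_measurable, symmetric])
  finally show ?thesis .
qed

text \<open>Discrete counterpart of minus the integral of y times the time derivative of w; it is
  meaningful for a w that is merely square integrable.\<close>

definition incr :: "('a \<times> real \<Rightarrow> real) \<Rightarrow> ('a \<times> real \<Rightarrow> real) \<Rightarrow> real \<Rightarrow> real" where
  "incr y w h = inverse h * (ip Q y w - ip Q y (shift h w))"

text \<open>With the difference quotient moved onto y, \<open>incr\<close> is for fixed h a
  continuous functional of w in mean square.\<close>

lemma incr_alt:
  assumes y: "y \<in> L2 Q" and w: "w \<in> L2 Q"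
  shows "incr y w h = ip Q (\<lambda>z. inverse h * (y z - shift (- h) y z)) w"
  unfolding incr_def shift_adjoint[OF y w] ip_cmult_left ip_diff_left[OF y shift_L2[OF y] w] ..

text \<open>Padding with a zero gradient component lets limits of pairs be used for pairings that
  involve the function alone.\<close>

lemma ip_fst:
  assumes "v \<in> L2 Q" "w \<in> L2 Q" "k \<in> L2 Q"
  shows "ip Q v w = ip Q (\<lambda>z. (w z, k z)) (\<lambda>z. (v z, 0 :: 'a))"
  using ip_Pair[OF assms(2,1,3) L2_zero] by (simp add: ip_zero_right ip_commute)

text \<open>The right-hand side of the equation solved for the time derivative, as a functional on
  pairs: the second component represents the divergence term after integration by parts in
  space.\<close>

definition flux :: "('a \<times> real \<Rightarrow> real) \<Rightarrow> ('a \<times> real \<Rightarrow> real) \<Rightarrow> ('a \<times> real \<Rightarrow> 'a) \<Rightarrow> 'a \<times> real \<Rightarrow> real \<times> 'a" where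
  "flux f y g z = (f z - b z * y z, - (a z *\<^sub>R g z))"

definition weak_pair :: "('a \<times> real \<Rightarrow> real) \<Rightarrow> ('a \<times> real \<Rightarrow> real) \<Rightarrow> ('a \<times> real \<Rightarrow> 'a) \<Rightarrow> bool" where
  "weak_pair f y g \<longleftrightarrow> f \<in> L2 Q \<and> L2H01 \<Omega> T y g \<and>
    (\<forall>\<phi> D. C1c (\<Omega> \<times> {..<T}) \<phi> D \<longrightarrow> ip Q (\<lambda>z. (y z, g z)) (dual_op \<phi> D) = ip Q f \<phi>)"

lemma weak_solution_zero_iff:
  "f \<in> L2 Q \<Longrightarrow> weak_solution \<Omega> T a b f (\<lambda>x. 0) y \<longleftrightarrow> (\<exists>g. weak_pair f y g)"
  unfolding weak_solution_iff weak_pair_def by (simp add: ip_zero_left)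

lemma flux_L2: "f \<in> L2 Q \<Longrightarrow> y \<in> L2 Q \<Longrightarrow> g \<in> L2 Q \<Longrightarrow> flux f y g \<in> L2 Q"
  unfolding flux_def[abs_def] L2_Pair by (intro conjI L2_diff L2_minus L2_mult_a L2_mult_b)

lemma weak_pair_flux:
  assumes w: "weak_pair f y g" and C: "C1c (\<Omega> \<times> {..<T}) \<phi> D"
  shows "ip Q y (\<lambda>z. - snd (D z)) = ip Q (flux f y g) (\<lambda>z. (\<phi> z, fst (D z)))"
proof -
  have f: "f \<in> L2 Q" and y: "y \<in> L2 Q" and g: "g \<in> L2 Q" using w L2H01_L2 unfolding weak_pair_def by blast+
  note L = C1c_L2[OF Q_measurable C]
  have 1: "ip Q (\<lambda>z. (y z, g z)) (dual_op \<phi> D) = ip Q f \<phi>" using w C unfolding weak_pair_def by blast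
  have 2: "ip Q (\<lambda>z. (y z, g z)) (dual_op \<phi> D)
      = ip Q y (\<lambda>z. - snd (D z)) + ip Q y (\<lambda>z. b z * \<phi> z) + ip Q g (\<lambda>z. a z *\<^sub>R fst (D z))"
    unfolding dual_op_def[abs_def]
    by (subst ip_Pair[OF y L2_add[OF L2_minus[OF L(4)] L2_mult_b[OF L(1)]] g L2_mult_a[OF L(3)]])
      (subst ip_add_right[OF L2_minus[OF L(4)] L2_mult_b[OF L(1)] y], rule refl)
  have 3: "ip Q (flux f y g) (\<lambda>z. (\<phi> z, fst (D z)))
      = ip Q f \<phi> - ip Q (\<lambda>z. b z * y z) \<phi> - ip Q (\<lambda>z. a z *\<^sub>R g z) (\<lambda>z. fst (D z))"
    unfolding flux_def[abs_def]
    by (subst ip_Pair[OF L2_diff[OF f L2_mult_b[OF y]] L(1) L2_minus[OF L2_mult_a[OF g]] L(3)])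
      (simp add: ip_diff_left[OF f L2_mult_b[OF y] L(1)] ip_minus_left)
  have 4: "ip Q y (\<lambda>z. b z * \<phi> z) = ip Q (\<lambda>z. b z * y z) \<phi>" by (simp add: ip_def mult_ac)
  have 5: "ip Q g (\<lambda>z. a z *\<^sub>R fst (D z)) = ip Q (\<lambda>z. a z *\<^sub>R g z) (\<lambda>z. fst (D z))" by (simp add: ip_def)
  show ?thesis using 1 2 3 4 5 by linarith
qed

text \<open>The Steklov average of a test function has a difference quotient as its time derivative.\<close>

lemma incr_C1c:
  assumes w: "weak_pair f y g" and C: "C1c Q \<phi> D" and h: "h > 0"
  shows "incr y \<phi> h = ip Q (flux f y g) (avg h (\<lambda>z. (\<phi> z, fst (D z))))"
proof -
  have y: "y \<in> L2 Q" using w L2H01_L2 unfolding weak_pair_def by blast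
  have C': "C1c (\<Omega> \<times> {..<T}) \<phi> D" by (rule C1c_mono[OF C]) (auto simp: cyl_def)
  note c = C1c_continuous[OF C]
  have z\<phi>: "zext Q \<phi> = \<phi>" by (rule zext_apply_outside) (rule C1c_outside[OF C])
  have \<phi>L: "\<phi> \<in> L2 Q" by (rule C1c_L2[OF Q_measurable C])
  have sL: "shift h \<phi> \<in> L2 Q" by (rule shift_L2[OF \<phi>L])
  have "incr y \<phi> h = ip Q y (\<lambda>z. inverse h * (\<phi> z - shift h \<phi> z))"
    unfolding incr_def ip_cmult_right ip_diff_right[OF \<phi>L sL y] ..
  also have "(\<lambda>z. inverse h * (\<phi> z - shift h \<phi> z)) = (\<lambda>z. - snd (avg h D z))"
    unfolding avg_time_derivative[OF C h] z\<phi> by (simp add: algebra_simps)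
  also have "ip Q y (\<lambda>z. - snd (avg h D z)) = ip Q (flux f y g) (\<lambda>z. (avg h \<phi> z, fst (avg h D z)))"
    by (rule weak_pair_flux[OF w C1c_avg[OF C']])
  also have "(\<lambda>z. (avg h \<phi> z, fst (avg h D z))) = avg h (\<lambda>z. (\<phi> z, fst (D z)))"
  proof
    fix z
    have Jc: "continuous_on UNIV (\<lambda>z. (\<phi> z, fst (D z)))" by (intro continuous_intros c)
    show "(avg h \<phi> z, fst (avg h D z)) = avg h (\<lambda>z. (\<phi> z, fst (D z))) z"
      using avg_linear[OF Jc bounded_linear_fst, of h z] avg_linear[OF Jc bounded_linear_snd, of h z]
        avg_linear[OF c(2) bounded_linear_fst, of h z]
      by (intro prod_eqI) simp_all
  qed
  finally show ?thesis .
qed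

text \<open>Averaging does not increase the norm, so the bound does not depend on h. This uniformity
  later justifies approximating first and letting h tend to 0 afterwards.\<close>

lemma incr_C1c_bound:
  assumes w: "weak_pair f y g" and C: "C1c Q \<phi> D" and h: "h > 0"
  shows "\<bar>incr y \<phi> h\<bar> \<le> l2norm Q (flux f y g) * l2norm Q (\<lambda>z. (\<phi> z, fst (D z)))"
proof -
  let ?J = "\<lambda>z. (\<phi> z, fst (D z))"
  have F: "flux f y g \<in> L2 Q" using w L2H01_L2 unfolding weak_pair_def by (intro flux_L2) blast+
  obtain K where K: "compact K" "K \<subseteq> Q" "\<And>z. z \<notin> K \<Longrightarrow> \<phi> z = 0" "\<And>z. z \<notin> K \<Longrightarrow> D z = 0"
    by (rule C1c_support[OF C]) blast
  have Jc: "continuous_on UNIV ?J" by (intro continuous_intros C1c_continuous[OF C])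
  have J0: "?J z = 0" if "z \<notin> K" for z using K(3,4)[OF that] by (simp add: zero_prod_def)
  have zJ: "zext Q ?J = ?J" by (rule zext_apply_outside) (use J0 K(2) in blast)
  note A = l2norm_avg_le[OF Jc K(1) J0 h]
  have "ip Q ?J ?J = ip UNIV ?J ?J" using ip_zext_left[OF Q_measurable, of ?J ?J] unfolding zJ .
  then have n: "l2norm UNIV ?J = l2norm Q ?J" by (simp add: l2norm_def)
  have AL: "avg h ?J \<in> L2 Q" by (rule L2_restrict[OF Q_measurable _ _ A(1)]) auto
  have "\<bar>incr y \<phi> h\<bar> \<le> l2norm Q (flux f y g) * l2norm Q (avg h ?J)"
    unfolding incr_C1c[OF assms] by (rule ip_Cauchy_Schwarz[OF F AL])
  also have "\<dots> \<le> l2norm Q (flux f y g) * l2norm Q ?J"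
    by (rule mult_left_mono[OF order_trans[OF l2norm_restrict_le[OF Q_measurable A(1)] A(2)[unfolded n]]]) (assumption+, rule l2norm_nonneg)
  finally show ?thesis .
qed

text \<open>For fixed h both sides are continuous with respect to convergence of pairs, so the
  estimate extends from test functions by density.\<close>

lemma incr_bound:
  assumes w: "weak_pair f y g" and v: "L2H01 \<Omega> T v k" and h: "h > 0"
  shows "\<bar>incr y v h\<bar> \<le> l2norm Q (flux f y g) * l2norm Q (\<lambda>z. (v z, k z))"
proof -
  have y: "y \<in> L2 Q" using w L2H01_L2 unfolding weak_pair_def by blast
  obtain \<phi> D where \<phi>: "\<And>n. C1c Q (\<phi> n) (D n)" and lim: "l2lim Q (\<lambda>n z. (\<phi> n z, fst (D n z))) (\<lambda>z. (v z, k z))"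
    by (rule L2H01_approx[OF \<Omega>(1) v]) blast
  let ?d = "\<lambda>z. inverse h * (y z - shift (- h) y z)"
  have dL: "?d \<in> L2 Q" by (intro L2_cmult L2_diff y shift_L2)
  have "(\<lambda>n. ip Q (\<lambda>z. (\<phi> n z, fst (D n z))) (\<lambda>z. (?d z, 0))) \<longlonglongrightarrow> ip Q (\<lambda>z. (v z, k z)) (\<lambda>z. (?d z, 0))"
    by (rule l2lim_ip[OF lim]) (use dL L2_zero in \<open>simp add: L2_Pair\<close>)
  moreover have "ip Q (\<lambda>z. (\<phi> n z, fst (D n z))) (\<lambda>z. (?d z, 0)) = incr y (\<phi> n) h" for n
    unfolding incr_alt[OF y C1c_L2(1)[OF Q_measurable \<phi>]]
    by (rule ip_fst[OF dL C1c_L2(1,3)[OF Q_measurable \<phi>], symmetric])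
  moreover have "ip Q (\<lambda>z. (v z, k z)) (\<lambda>z. (?d z, 0)) = incr y v h"
    unfolding incr_alt[OF y L2H01_L2(1)[OF v]] by (rule ip_fst[OF dL L2H01_L2(1,2)[OF v], symmetric])
  ultimately have "(\<lambda>n. incr y (\<phi> n) h) \<longlonglongrightarrow> incr y v h" by (simp only:)
  then have "(\<lambda>n. \<bar>incr y (\<phi> n) h\<bar>) \<longlonglongrightarrow> \<bar>incr y v h\<bar>" by (rule tendsto_rabs)
  moreover have "(\<lambda>n. l2norm Q (flux f y g) * l2norm Q (\<lambda>z. (\<phi> n z, fst (D n z))))
      \<longlonglongrightarrow> l2norm Q (flux f y g) * l2norm Q (\<lambda>z. (v z, k z))"
    by (intro tendsto_mult_left l2lim_norm[OF lim])
  ultimately show ?thesis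
    by (rule LIMSEQ_le) (use incr_C1c_bound[OF w \<phi> h] in blast)
qed

text \<open>A weak solution with zero initial value may be tested with every function in the energy space, if
  the time derivative is replaced by a limit of difference quotients.\<close>

lemma incr_tendsto:
  assumes w: "weak_pair f y g" and v: "L2H01 \<Omega> T v k"
  shows "(incr y v \<longlongrightarrow> ip Q (flux f y g) (\<lambda>z. (v z, k z))) (at_right 0)"
proof (rule tendstoI)
  fix e :: real assume e: "e > 0"
  have y: "y \<in> L2 Q" using w L2H01_L2 unfolding weak_pair_def by blast
  have F: "flux f y g \<in> L2 Q" using w L2H01_L2 unfolding weak_pair_def by (intro flux_L2) blast+
  let ?F = "flux f y g" and ?W = "\<lambda>z. (v z, k z)"
  define N where "N = l2norm Q ?F + 1"
  have N: "N > 0" unfolding N_def by (intro add_nonneg_pos) auto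
  obtain \<phi>' D' where \<phi>': "\<And>n. C1c Q (\<phi>' n) (D' n)" and lim: "l2lim Q (\<lambda>n z. (\<phi>' n z, fst (D' n z))) ?W"
    by (rule L2H01_approx[OF \<Omega>(1) v]) blast
  have "(\<lambda>n. l2norm Q (\<lambda>z. (\<phi>' n z, fst (D' n z)) - ?W z)) \<longlonglongrightarrow> 0" using lim unfolding l2lim_def by blast
  from order_tendstoD(2)[OF this, of "e / (3 * N)"] obtain n where n: "l2norm Q (\<lambda>z. (\<phi>' n z, fst (D' n z)) - ?W z) < e / (3 * N)"
    unfolding eventually_sequentially using e N by auto
  define \<phi> D where "\<phi> = \<phi>' n" and "D = D' n"
  let ?J = "\<lambda>z. (\<phi> z, fst (D z))"
  have C: "C1c Q \<phi> D" unfolding \<phi>_def D_def by (rule \<phi>')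
  have WJ: "l2norm Q (\<lambda>z. ?W z - ?J z) < e / (3 * N)"
    unfolding l2norm_minus_commute[of Q ?W ?J] unfolding \<phi>_def D_def by (rule n)
  have \<phi>L: "\<phi> \<in> L2 Q" and JL: "?J \<in> L2 Q" by (rule C1c_L2[OF Q_measurable C])+
  have WL: "?W \<in> L2 Q" and vL: "v \<in> L2 Q" by (rule L2H01_L2[OF v])+
  \<comment> \<open>The approximation error itself lies in the energy space, hence
    \<open>incr_bound\<close> controls its increment uniformly in h. The remaining two thirds of e
    go to the flux pairing of the error and to the average of the fixed test function.\<close>
  have d: "L2H01 \<Omega> T (\<lambda>z. v z + (-1) * \<phi> z) (\<lambda>z. k z + (-1) *\<^sub>R fst (D z))"
    by (rule L2H01_lincomb[OF \<Omega>(1) v C1c_L2H01[OF \<Omega>(1) C]])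
  have small: "l2norm Q ?F * l2norm Q (\<lambda>z. ?W z - ?J z) < e / 3"
  proof -
    have "l2norm Q ?F * l2norm Q (\<lambda>z. ?W z - ?J z) \<le> l2norm Q ?F * (e / (3 * N))"
      by (rule mult_left_mono[OF less_imp_le[OF WJ]]) simp
    also have "\<dots> < N * (e / (3 * N))" using e N by (intro mult_strict_right_mono) (auto simp: N_def)
    also have "\<dots> = e / 3" using N by simp
    finally show ?thesis .
  qed
  have A: "\<bar>incr y v h - incr y \<phi> h\<bar> < e / 3" if h: "h > 0" for h
  proof -
    have dL: "(\<lambda>z. inverse h * (y z - shift (- h) y z)) \<in> L2 Q" by (intro L2_cmult L2_diff y shift_L2)
    have "incr y v h - incr y \<phi> h = incr y (\<lambda>z. v z + (-1) * \<phi> z) h"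
      unfolding incr_alt[OF y vL] incr_alt[OF y \<phi>L] incr_alt[OF y L2H01_L2(1)[OF d]]
        ip_add_right[OF vL L2_cmult[OF \<phi>L] dL] ip_cmult_right by simp
    also have "\<bar>\<dots>\<bar> \<le> l2norm Q ?F * l2norm Q (\<lambda>z. (v z + (-1) * \<phi> z, k z + (-1) *\<^sub>R fst (D z)))"
      by (rule incr_bound[OF w d h])
    also have "(\<lambda>z. (v z + (-1) * \<phi> z, k z + (-1) *\<^sub>R fst (D z))) = (\<lambda>z. ?W z - ?J z)" by simp
    finally show ?thesis using small by linarith
  qed
  have B: "\<bar>ip Q ?F ?J - ip Q ?F ?W\<bar> < e / 3"
  proof -
    have "\<bar>ip Q ?F ?J - ip Q ?F ?W\<bar> = \<bar>ip Q ?F (\<lambda>z. ?W z - ?J z)\<bar>"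
      unfolding ip_diff_right[OF WL JL F] by linarith
    also have "\<dots> \<le> l2norm Q ?F * l2norm Q (\<lambda>z. ?W z - ?J z)" by (rule ip_Cauchy_Schwarz[OF F L2_diff[OF WL JL]])
    finally show ?thesis using small by linarith
  qed
  obtain K where K: "compact K" "K \<subseteq> Q" "\<And>z. z \<notin> K \<Longrightarrow> \<phi> z = 0" "\<And>z. z \<notin> K \<Longrightarrow> D z = 0"
    by (rule C1c_support[OF C]) blast
  have Jc: "continuous_on UNIV ?J" by (intro continuous_intros C1c_continuous[OF C])
  have J0: "?J z = 0" if "z \<notin> K" for z using K(3,4)[OF that] by (simp add: zero_prod_def)
  have "\<forall>\<^sub>F h in at_right 0. dist (ip Q ?F (avg h ?J)) (ip Q ?F ?J) < e / 3"
    by (rule tendstoD[OF ip_avg_tendsto[OF Q_lmeasurable F Jc K(1) J0]]) (use e in simp_all)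
  moreover have "\<forall>\<^sub>F h::real in at_right 0. h > 0" by (simp add: eventually_at_right_less)
  ultimately show "\<forall>\<^sub>F h in at_right 0. dist (incr y v h) (ip Q ?F ?W) < e"
  proof eventually_elim
    case (elim h)
    show ?case using elim(1) A[OF elim(2)] B incr_C1c[OF w C elim(2)] unfolding dist_real_def by linarith
  qed
qed

end

section \<open>Time reversal and duality\<close>

context parabolic
begin

lemma ip_flux:
  assumes w: "weak_pair f y g" and v: "L2H01 \<Omega> T v k"
  shows "ip Q (flux f y g) (\<lambda>z. (v z, k z)) = ip Q f v - ip Q (\<lambda>z. b z * y z) v - ip Q (\<lambda>z. a z *\<^sub>R g z) k"
proof -
  have f: "f \<in> L2 Q" and y: "y \<in> L2 Q" and g: "g \<in> L2 Q" using w L2H01_L2 unfolding weak_pair_def by blast+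
  note vk = L2H01_L2(1,2)[OF v]
  show ?thesis unfolding flux_def[abs_def]
    by (subst ip_Pair[OF L2_diff[OF f L2_mult_b[OF y]] vk(1) L2_minus[OF L2_mult_a[OF g]] vk(2)])
      (simp add: ip_diff_left[OF f L2_mult_b[OF y] vk(1)] ip_minus_left)
qed

abbreviation \<sigma> :: "'a \<times> real \<Rightarrow> 'a \<times> real" where "\<sigma> \<equiv> (\<lambda>z. (fst z, T - snd z))"

lemma \<sigma>_Q: "\<sigma> z \<in> Q \<longleftrightarrow> z \<in> Q"
  by (cases z) (auto simp: cyl_def)

lemma zext_\<sigma>: "zext Q (\<lambda>z. f (\<sigma> z)) = (\<lambda>z. zext Q f (\<sigma> z))"
  by (simp add: zext_def \<sigma>_Q fun_eq_iff)

lemma L2_\<sigma>: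
  fixes f :: "'a \<times> real \<Rightarrow> 'c::euclidean_space"
  assumes "f \<in> L2 Q"
  shows "(\<lambda>z. f (\<sigma> z)) \<in> L2 Q"
proof -
  have "zext Q (\<lambda>z. f (\<sigma> z)) \<in> L2 UNIV"
    unfolding zext_\<sigma> by (rule L2_compose_preserves_lebesgue[OF preserves_lebesgue_time_reversal zext_L2[OF Q_measurable assms]])
  from L2_restrict[OF Q_measurable _ _ this] have Z: "zext Q (\<lambda>z. f (\<sigma> z)) \<in> L2 Q" by simp
  have eq: "zext Q (\<lambda>z. f (\<sigma> z)) z = f (\<sigma> z)" if "z \<in> Q" for z using that by (simp add: zext_def)
  have "(\<lambda>z. f (\<sigma> z)) \<in> borel_measurable (lebesgue_on Q)"
    using L2_measurable[OF Z] by (rule measurable_cong[THEN iffD1, rotated]) (simp add: eq)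
  then show ?thesis by (rule L2_cong_AE[OF Z]) (auto intro!: AE_I2 simp: eq)
qed

lemma ip_\<sigma>:
  fixes f g :: "'a \<times> real \<Rightarrow> 'c::euclidean_space"
  assumes "f \<in> L2 Q" "g \<in> L2 Q"
  shows "ip Q (\<lambda>z. f (\<sigma> z)) (\<lambda>z. g (\<sigma> z)) = ip Q f g"
proof -
  have zz: "ip Q u v = ip UNIV (zext Q u) (zext Q v)" for u v :: "'a \<times> real \<Rightarrow> 'c"
    unfolding ip_zext_left[OF Q_measurable, of u v]
    unfolding ip_def by (rule Bochner_Integration.integral_cong) (auto simp: zext_def)
  show ?thesis
    unfolding zz zext_\<sigma>
    by (rule ip_compose_preserves_lebesgue[OF preserves_lebesgue_time_reversal zext_L2[OF Q_measurable assms(1)] zext_L2[OF Q_measurable assms(2)]])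
qed

lemma l2norm_\<sigma>:
  fixes f :: "'a \<times> real \<Rightarrow> 'c::euclidean_space"
  shows "f \<in> L2 Q \<Longrightarrow> l2norm Q (\<lambda>z. f (\<sigma> z)) = l2norm Q f"
  by (simp add: l2norm_def ip_\<sigma>)

lemma AE_\<sigma>:
  assumes "AE z in lebesgue_on Q. P z"
  shows "AE z in lebesgue_on Q. P (\<sigma> z)"
proof -
  have m: "\<sigma> \<in> lebesgue \<rightarrow>\<^sub>M lebesgue" and d: "distr lebesgue lebesgue \<sigma> = lebesgue"
    using preserves_lebesgue_time_reversal[of T] unfolding preserves_lebesgue_def by blast+
  have "AE z in lebesgue. z \<in> Q \<longrightarrow> P z" using assms Q_measurable by (simp add: AE_restrict_space_iff)
  then obtain N where N: "N \<in> null_sets lebesgue" "{z. \<not> (z \<in> Q \<longrightarrow> P z)} \<subseteq> N" by (auto simp: eventually_ae_filter)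
  have "emeasure lebesgue (\<sigma> -` N) = emeasure (distr lebesgue lebesgue \<sigma>) N"
    using N by (subst emeasure_distr[OF m]) auto
  also have "\<dots> = 0" unfolding d using N by auto
  finally have "\<sigma> -` N \<in> null_sets lebesgue" using measurable_sets[OF m, of N] N by (auto simp: null_sets_def)
  moreover have "{z. \<not> (z \<in> Q \<longrightarrow> P (\<sigma> z))} \<subseteq> \<sigma> -` N" using N(2) \<sigma>_Q by blast
  ultimately have "AE z in lebesgue. z \<in> Q \<longrightarrow> P (\<sigma> z)" by (intro AE_I'[of "\<sigma> -` N"]) auto
  then show ?thesis using Q_measurable by (simp add: AE_restrict_space_iff)
qed

lemma Linf_\<sigma>:
  fixes f :: "'a \<times> real \<Rightarrow> real"
  assumes "f \<in> Linf Q"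
  shows "(\<lambda>z. f (\<sigma> z)) \<in> Linf Q"
proof -
  obtain C where f: "f \<in> borel_measurable (lebesgue_on Q)" and C: "AE z in lebesgue_on Q. norm (f z) \<le> C"
    using assms unfolding Linf_def by blast
  have m: "\<sigma> \<in> lebesgue \<rightarrow>\<^sub>M lebesgue"
    using preserves_lebesgue_time_reversal[of T] unfolding preserves_lebesgue_def by blast
  have "(\<lambda>z. zext Q f (\<sigma> z)) \<in> borel_measurable lebesgue"
    by (rule measurable_compose[OF m zext_measurable[OF Q_measurable f]])
  then have "(\<lambda>z. zext Q f (\<sigma> z)) \<in> borel_measurable (lebesgue_on Q)" by (rule measurable_restrict_space1)
  then have "(\<lambda>z. f (\<sigma> z)) \<in> borel_measurable (lebesgue_on Q)"
    by (rule measurable_cong[THEN iffD1, rotated]) (auto simp: zext_def cyl_def)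
  then show ?thesis unfolding Linf_def using AE_\<sigma>[OF C] by blast
qed

text \<open>Through this interpretation the existence theorem and \<open>incr_tendsto\<close> become
  available for the adjoint equation.\<close>

lemma reversed: "parabolic \<Omega> T a0 (\<lambda>z. a (\<sigma> z)) (\<lambda>z. b (\<sigma> z))"
  by unfold_locales (use \<Omega> T a0(1) Linf_\<sigma>[OF a] Linf_\<sigma>[OF b] AE_\<sigma>[OF a0(2)] in blast)+

lemma C1c_\<sigma>:
  fixes \<phi> :: "'a \<times> real \<Rightarrow> real"
  assumes C: "C1c S \<phi> D" and S: "\<And>z. \<sigma> z \<in> S \<Longrightarrow> z \<in> S'"
  shows "C1c S' (\<lambda>z. \<phi> (\<sigma> z)) (\<lambda>z. (fst (D (\<sigma> z)), - snd (D (\<sigma> z))))"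
proof -
  obtain K where K: "compact K" "K \<subseteq> S" "\<And>z. z \<notin> K \<Longrightarrow> \<phi> z = 0" by (rule C1c_support[OF C]) blast
  have c\<sigma>: "continuous_on A \<sigma>" for A by (intro continuous_intros)
  have inv: "\<sigma> (\<sigma> z) = z" for z by simp
  show ?thesis
  proof (rule C1cI[of _ _ "\<sigma> ` K"])
    fix z
    have "(\<sigma> has_derivative (\<lambda>h. (fst h, - snd h))) (at z)"
      by (auto intro!: derivative_eq_intros)
    from has_derivative_compose[OF this C1c_has_derivative[OF C]]
    show "((\<lambda>z. \<phi> (\<sigma> z)) has_derivative (\<lambda>h. (fst (D (\<sigma> z)), - snd (D (\<sigma> z))) \<bullet> h)) (at z)"
      by (rule has_derivative_eq_rhs) (simp add: inner_prod_def fun_eq_iff)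
    show "\<phi> (\<sigma> z) = 0" if "z \<notin> \<sigma> ` K"
    proof (rule K(3), rule notI)
      assume "\<sigma> z \<in> K"
      then have "\<sigma> (\<sigma> z) \<in> \<sigma> ` K" by (rule imageI)
      with that show False unfolding inv by blast
    qed
  next
    show "continuous_on UNIV (\<lambda>z. (fst (D (\<sigma> z)), - snd (D (\<sigma> z))))"
      by (intro continuous_intros continuous_on_compose2[OF C1c_continuous(2)[OF C] c\<sigma>]) auto
    show "compact (\<sigma> ` K)" by (rule compact_continuous_image[OF c\<sigma> K(1)])
    show "\<sigma> ` K \<subseteq> S'"
    proof
      fix z assume "z \<in> \<sigma> ` K"
      then obtain w where "w \<in> K" "z = \<sigma> w" by blast
      then have "\<sigma> z \<in> S" using K(2) inv[of w] by auto
      then show "z \<in> S'" by (rule S)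
    qed
  qed
qed

lemma L2H01_\<sigma>:
  assumes v: "L2H01 \<Omega> T v k"
  shows "L2H01 \<Omega> T (\<lambda>z. v (\<sigma> z)) (\<lambda>z. k (\<sigma> z))"
proof -
  obtain \<phi> D where \<phi>: "\<And>n. C1c Q (\<phi> n) (D n)" and lim: "l2lim Q (\<lambda>n z. (\<phi> n z, fst (D n z))) (\<lambda>z. (v z, k z))"
    by (rule L2H01_approx[OF \<Omega>(1) v]) blast
  let ?J = "\<lambda>n z. (\<phi> n z, fst (D n z))" and ?W = "\<lambda>z. (v z, k z)"
  have L: "?J n \<in> L2 Q" "?W \<in> L2 Q" for n using lim unfolding l2lim_def by blast+
  have C: "C1c Q (\<lambda>z. \<phi> n (\<sigma> z)) (\<lambda>z. (fst (D n (\<sigma> z)), - snd (D n (\<sigma> z))))" for n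
    by (rule C1c_\<sigma>[OF \<phi>]) (simp only: \<sigma>_Q)
  have "(\<lambda>n. l2norm Q (\<lambda>z. ?J n z - ?W z)) \<longlonglongrightarrow> 0" using lim unfolding l2lim_def by blast
  then have "(\<lambda>n. l2norm Q (\<lambda>z. ?J n (\<sigma> z) - ?W (\<sigma> z))) \<longlonglongrightarrow> 0"
    unfolding l2norm_\<sigma>[OF L2_diff[OF L]] .
  then have "l2lim Q (\<lambda>n z. ?J n (\<sigma> z)) (\<lambda>z. ?W (\<sigma> z))"
    unfolding l2lim_def using L2_\<sigma>[OF L(1)] L2_\<sigma>[OF L(2)] by blast
  then show ?thesis unfolding L2H01_iff[OF \<Omega>(1)] using C
    by (intro exI[of _ "\<lambda>n z. \<phi> n (\<sigma> z)"] exI[of _ "\<lambda>n z. (fst (D n (\<sigma> z)), - snd (D n (\<sigma> z)))"]) simp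
qed

text \<open>The adjoint state is described by the reversed forward problem, to which the theory
  above applies directly; \<open>weak_solution_adj_iff\<close> connects it with the backward
  identity.\<close>

definition weak_pair_adj :: "('a \<times> real \<Rightarrow> real) \<Rightarrow> ('a \<times> real \<Rightarrow> real) \<Rightarrow> ('a \<times> real \<Rightarrow> 'a) \<Rightarrow> bool" where
  "weak_pair_adj q z k \<longleftrightarrow> parabolic.weak_pair \<Omega> T (\<lambda>w. a (\<sigma> w)) (\<lambda>w. b (\<sigma> w)) (\<lambda>w. q (\<sigma> w)) (\<lambda>w. z (\<sigma> w)) (\<lambda>w. k (\<sigma> w))"

text \<open>Time reversal is an involution that exchanges the test functions vanishing near t = T
  with those vanishing near t = 0.\<close>

lemma weak_solution_adj_iff:
  assumes q: "q \<in> L2 Q"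
  shows "weak_solution_adj \<Omega> T a b q z \<longleftrightarrow> (\<exists>k. weak_pair_adj q z k)"
proof -
  interpret rev: parabolic \<Omega> T a0 "\<lambda>z. a (\<sigma> z)" "\<lambda>z. b (\<sigma> z)" by (rule reversed)
  let ?op = "\<lambda>\<phi> D w. (snd (D w) + b w * \<phi> w, a w *\<^sub>R fst (D w))"
  have adj: "weak_solution_adj \<Omega> T a b q z \<longleftrightarrow> (\<exists>k. L2H01 \<Omega> T z k \<and> (\<forall>\<phi> D. C1c (\<Omega> \<times> {0<..}) \<phi> D \<longrightarrow>
      ip Q (\<lambda>w. (z w, k w)) (?op \<phi> D) = ip Q q \<phi>))"
  proof -
    have "ip Q (\<lambda>w. (z w, k w)) (?op \<phi> D) = (LINT w|lebesgue_on (cyl \<Omega> T).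
             z w * snd (D w) + a w * (k w \<bullet> fst (D w)) + b w * z w * \<phi> w)" for k \<phi> and D :: "'a \<times> real \<Rightarrow> 'a \<times> real"
      unfolding ip_def by (rule Bochner_Integration.integral_cong) (auto simp: algebra_simps)
    then show ?thesis unfolding weak_solution_adj_def ip_real by simp
  qed
  have opL: "?op \<phi> D \<in> L2 Q" if "C1c S \<phi> D" for S \<phi> D
    unfolding L2_Pair by (intro conjI L2_add L2_mult_a L2_mult_b C1c_L2[OF Q_measurable that])
  have fwd: "C1c (\<Omega> \<times> {..<T}) (\<lambda>z. \<phi> (\<sigma> z)) (\<lambda>z. (fst (D (\<sigma> z)), - snd (D (\<sigma> z))))" if "C1c (\<Omega> \<times> {0<..}) \<phi> D" for \<phi> D
    by (rule C1c_\<sigma>[OF that]) auto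
  have bwd: "C1c (\<Omega> \<times> {0<..}) (\<lambda>z. \<phi> (\<sigma> z)) (\<lambda>z. (fst (D (\<sigma> z)), - snd (D (\<sigma> z))))" if "C1c (\<Omega> \<times> {..<T}) \<phi> D" for \<phi> D
    by (rule C1c_\<sigma>[OF that]) auto
  \<comment> \<open>The time derivative of a reversed test function changes sign, which cancels the
    minus sign in \<open>dual_op\<close>.\<close>
  have key: "ip Q (\<lambda>w. (z (\<sigma> w), k (\<sigma> w))) (rev.dual_op (\<lambda>w. \<phi> (\<sigma> w)) (\<lambda>w. (fst (D (\<sigma> w)), - snd (D (\<sigma> w)))))
      = ip Q (\<lambda>w. (z w, k w)) (?op \<phi> D)"
    if C: "C1c S \<phi> D" and H: "L2H01 \<Omega> T z k" for S \<phi> D k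
    using ip_\<sigma>[OF L2H01_L2(3)[OF H] opL[OF C]] unfolding rev.dual_op_def[abs_def] by simp
  show ?thesis
  proof
    assume "weak_solution_adj \<Omega> T a b q z"
    then obtain k where H: "L2H01 \<Omega> T z k" and k: "\<And>\<phi> D. C1c (\<Omega> \<times> {0<..}) \<phi> D \<Longrightarrow> ip Q (\<lambda>w. (z w, k w)) (?op \<phi> D) = ip Q q \<phi>"
      unfolding adj by blast
    have "rev.weak_pair (\<lambda>w. q (\<sigma> w)) (\<lambda>w. z (\<sigma> w)) (\<lambda>w. k (\<sigma> w))"
      unfolding rev.weak_pair_def
    proof (intro conjI allI impI)
      show "(\<lambda>w. q (\<sigma> w)) \<in> L2 Q" by (rule L2_\<sigma>[OF q])
      show "L2H01 \<Omega> T (\<lambda>w. z (\<sigma> w)) (\<lambda>w. k (\<sigma> w))" by (rule L2H01_\<sigma>[OF H])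
      fix \<phi> D assume C: "C1c (\<Omega> \<times> {..<T}) \<phi> D"
      show "ip Q (\<lambda>w. (z (\<sigma> w), k (\<sigma> w))) (rev.dual_op \<phi> D) = ip Q (\<lambda>w. q (\<sigma> w)) \<phi>"
        using key[OF bwd[OF C] H] k[OF bwd[OF C]] ip_\<sigma>[OF q C1c_L2(1)[OF Q_measurable bwd[OF C]]] by simp
    qed
    then show "\<exists>k. weak_pair_adj q z k" unfolding weak_pair_adj_def by blast
  next
    assume "\<exists>k. weak_pair_adj q z k"
    then obtain k where "rev.weak_pair (\<lambda>w. q (\<sigma> w)) (\<lambda>w. z (\<sigma> w)) (\<lambda>w. k (\<sigma> w))" unfolding weak_pair_adj_def by blast
    then have H': "L2H01 \<Omega> T (\<lambda>w. z (\<sigma> w)) (\<lambda>w. k (\<sigma> w))"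
      and k: "\<And>\<phi> D. C1c (\<Omega> \<times> {..<T}) \<phi> D \<Longrightarrow> ip Q (\<lambda>w. (z (\<sigma> w), k (\<sigma> w))) (rev.dual_op \<phi> D) = ip Q (\<lambda>w. q (\<sigma> w)) \<phi>"
      unfolding rev.weak_pair_def by blast+
    have H: "L2H01 \<Omega> T z k" using L2H01_\<sigma>[OF H'] by simp
    have "ip Q (\<lambda>w. (z w, k w)) (?op \<phi> D) = ip Q q \<phi>" if C: "C1c (\<Omega> \<times> {0<..}) \<phi> D" for \<phi> D
      using key[OF C H] k[OF fwd[OF C]] ip_\<sigma>[OF q C1c_L2(1)[OF Q_measurable C]] by simp
    then show "weak_solution_adj \<Omega> T a b q z" unfolding adj using H by blast
  qed
qed

text \<open>The same function of h has two limits, one from each equation. The terms with a and b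
  are symmetric in the two states, so comparing the limits leaves only the sources.\<close>

lemma duality:
  assumes w: "weak_pair f y g" and wa: "weak_pair_adj q z k"
  shows "ip Q f z = ip Q q y"
proof -
  interpret rev: parabolic \<Omega> T a0 "\<lambda>z. a (\<sigma> z)" "\<lambda>z. b (\<sigma> z)" by (rule reversed)
  have w': "rev.weak_pair (\<lambda>w. q (\<sigma> w)) (\<lambda>w. z (\<sigma> w)) (\<lambda>w. k (\<sigma> w))" using wa unfolding weak_pair_adj_def .
  have q: "q \<in> L2 Q" using L2_\<sigma>[of "\<lambda>w. q (\<sigma> w)"] w' unfolding rev.weak_pair_def by simp
  have Hz: "L2H01 \<Omega> T z k" using L2H01_\<sigma>[of "\<lambda>w. z (\<sigma> w)" "\<lambda>w. k (\<sigma> w)"] w' unfolding rev.weak_pair_def by simp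
  have Hy: "L2H01 \<Omega> T y g" and f: "f \<in> L2 Q" using w unfolding weak_pair_def by blast+
  note y = L2H01_L2(1)[OF Hy] and g = L2H01_L2(2)[OF Hy] and z = L2H01_L2(1)[OF Hz] and k = L2H01_L2(2)[OF Hz]
  \<comment> \<open>Reversal turns the shift of y by h into a shift by -h, and
    \<open>shift_adjoint\<close> moves the latter onto z as a shift by h.\<close>
  have eq: "rev.incr (\<lambda>w. z (\<sigma> w)) (\<lambda>w. y (\<sigma> w)) h = incr y z h" for h
  proof -
    have "shift h (\<lambda>w. y (\<sigma> w)) w = shift (- h) y (\<sigma> w)" for w
      unfolding zext_\<sigma> by (simp add: algebra_simps)
    then have "ip Q (\<lambda>w. z (\<sigma> w)) (shift h (\<lambda>w. y (\<sigma> w))) = ip Q z (shift (- h) y)"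
      using ip_\<sigma>[OF z shift_L2[OF y, of "- h"]] by simp
    also have "\<dots> = ip Q y (shift h z)" using shift_adjoint[OF y z, of h] by (simp add: ip_commute)
    finally show ?thesis unfolding rev.incr_def incr_def ip_\<sigma>[OF z y] by (simp add: ip_commute)
  qed
  have 1: "(incr y z \<longlongrightarrow> ip Q f z - ip Q (\<lambda>w. b w * y w) z - ip Q (\<lambda>w. a w *\<^sub>R g w) k) (at_right 0)"
    using incr_tendsto[OF w Hz] unfolding ip_flux[OF w Hz] .
  have "(rev.incr (\<lambda>w. z (\<sigma> w)) (\<lambda>w. y (\<sigma> w)) \<longlongrightarrow>
     ip Q (\<lambda>w. q (\<sigma> w)) (\<lambda>w. y (\<sigma> w)) - ip Q (\<lambda>w. b (\<sigma> w) * z (\<sigma> w)) (\<lambda>w. y (\<sigma> w))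
       - ip Q (\<lambda>w. a (\<sigma> w) *\<^sub>R k (\<sigma> w)) (\<lambda>w. g (\<sigma> w))) (at_right 0)"
    using rev.incr_tendsto[OF w' L2H01_\<sigma>[OF Hy]] unfolding rev.ip_flux[OF w' L2H01_\<sigma>[OF Hy]] .
  then have 2: "(incr y z \<longlongrightarrow> ip Q q y - ip Q (\<lambda>w. b w * z w) y - ip Q (\<lambda>w. a w *\<^sub>R k w) g) (at_right 0)"
    unfolding eq[abs_def] ip_\<sigma>[OF q y] ip_\<sigma>[OF L2_mult_b[OF z] y] ip_\<sigma>[OF L2_mult_a[OF k] g] .
  have 3: "ip Q (\<lambda>w. b w * z w) y = ip Q (\<lambda>w. b w * y w) z" by (simp add: ip_real mult_ac)
  have 4: "ip Q (\<lambda>w. a w *\<^sub>R k w) g = ip Q (\<lambda>w. a w *\<^sub>R g w) k" by (simp add: ip_def inner_commute)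
  from tendsto_unique[OF _ 1 2] show ?thesis unfolding 3 4 by simp
qed

lemma weak_solution_adj_exists:
  assumes q: "q \<in> L2 Q"
  shows "\<exists>z. weak_solution_adj \<Omega> T a b q z"
proof -
  interpret rev: parabolic \<Omega> T a0 "\<lambda>z. a (\<sigma> z)" "\<lambda>z. b (\<sigma> z)" by (rule reversed)
  obtain y where "weak_solution \<Omega> T (\<lambda>z. a (\<sigma> z)) (\<lambda>z. b (\<sigma> z)) (\<lambda>w. q (\<sigma> w)) (\<lambda>x. 0) y"
    using rev.weak_solution_exists[OF L2_\<sigma>[OF q] L2_zero] by blast
  then obtain g where "rev.weak_pair (\<lambda>w. q (\<sigma> w)) y g" using rev.weak_solution_zero_iff[OF L2_\<sigma>[OF q]] by blast
  then have "weak_pair_adj q (\<lambda>w. y (\<sigma> w)) (\<lambda>w. g (\<sigma> w))" unfolding weak_pair_adj_def by simp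
  then show ?thesis using weak_solution_adj_iff[OF q] by blast
qed

end

section \<open>Saddle points\<close>

lemma L2_divide:
  fixes f k :: "'b::euclidean_space \<Rightarrow> real"
  assumes f: "f \<in> L2 S" and k: "k \<in> borel_measurable (lebesgue_on S)" and m: "0 < m" "\<And>z. z \<in> S \<Longrightarrow> m \<le> k z"
  shows "(\<lambda>z. f z / k z) \<in> L2 S"
proof -
  have "(\<lambda>z. inverse (k z) * f z) \<in> L2 S"
  proof (rule L2_mult_bounded_real[OF f, of _ "inverse m"])
    show "(\<lambda>z. inverse (k z)) \<in> borel_measurable (lebesgue_on S)" using k by measurable
    have "\<bar>inverse (k z)\<bar> \<le> inverse m" if "z \<in> S" for z
      using m(1) m(2)[OF that] by (simp add: le_imp_inverse_le)
    then show "AE z in lebesgue_on S. \<bar>inverse (k z)\<bar> \<le> inverse m" by (intro AE_I2) simp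
  qed
  then show ?thesis by (simp add: divide_inverse mult.commute)
qed

text \<open>The defect of linearity is paired with itself, and the adjoint relation moves each
  occurrence of M into an inner product that is linear in v and w. The roles of M and N may be
  exchanged.\<close>

lemma adjoint_linear:
  fixes M N :: "('b::euclidean_space \<Rightarrow> real) \<Rightarrow> 'b \<Rightarrow> real"
  assumes M: "\<And>v. v \<in> L2 P \<Longrightarrow> M v \<in> L2 Q" and N: "\<And>q. q \<in> L2 Q \<Longrightarrow> N q \<in> L2 P"
    and adj: "\<And>v q. v \<in> L2 P \<Longrightarrow> q \<in> L2 Q \<Longrightarrow> ip Q q (M v) = ip P v (N q)"
    and v: "v \<in> L2 P" and w: "w \<in> L2 P"
  shows "AE z in lebesgue_on Q. M (\<lambda>z. v z + c * w z) z = M v z + c * M w z"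
proof -
  let ?d = "\<lambda>z. M (\<lambda>z. v z + c * w z) z - (M v z + c * M w z)"
  have vw: "(\<lambda>z. v z + c * w z) \<in> L2 P" by (intro L2_add L2_cmult v w)
  have cw: "(\<lambda>z. c * M w z) \<in> L2 Q" by (intro L2_cmult M w)
  have s: "(\<lambda>z. M v z + c * M w z) \<in> L2 Q" by (intro L2_add cw M v)
  have dL: "?d \<in> L2 Q" by (rule L2_diff[OF M[OF vw] s])
  have "ip Q ?d ?d = ip P (\<lambda>z. v z + c * w z) (N ?d) - (ip P v (N ?d) + c * ip P w (N ?d))"
    unfolding ip_diff_right[OF M[OF vw] s dL] ip_add_right[OF M[OF v] cw dL] ip_cmult_right
      adj[OF vw dL] adj[OF v dL] adj[OF w dL] ..
  also have "\<dots> = 0" unfolding ip_add_left[OF v L2_cmult[OF w] N[OF dL]] ip_cmult_left by simp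
  finally have "ip Q ?d ?d \<le> 0" by simp
  from l2norm_eq_0_AE[OF dL this] show ?thesis by eventually_elim simp
qed

text \<open>What remains of the differential equation is a pair of adjoint operators. The weight r
  is bounded above and below, whereas s is only bounded below, so U may be smaller than
  \<open>L2 P\<close>; linearity of M and N is derived from \<open>adj\<close>.\<close>

locale control_problem =
  fixes Q P :: "'b::euclidean_space set" and M N :: "('b \<Rightarrow> real) \<Rightarrow> 'b \<Rightarrow> real"
    and ybar r s :: "'b \<Rightarrow> real" and m R :: real
  assumes Q: "Q \<in> sets lebesgue" and P: "P \<in> sets lebesgue" "P \<subseteq> Q"
    and M_L2: "\<And>v. v \<in> L2 P \<Longrightarrow> M v \<in> L2 Q"
    and N_L2: "\<And>q. q \<in> L2 Q \<Longrightarrow> N q \<in> L2 P"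
    and adj: "\<And>v q. v \<in> L2 P \<Longrightarrow> q \<in> L2 Q \<Longrightarrow> ip Q q (M v) = ip P v (N q)"
    and ybar: "ybar \<in> L2 Q"
    and r: "r \<in> borel_measurable (lebesgue_on Q)" "\<And>z. z \<in> Q \<Longrightarrow> m \<le> r z" "\<And>z. z \<in> Q \<Longrightarrow> r z \<le> R"
    and s: "s \<in> borel_measurable (lebesgue_on P)" "\<And>z. z \<in> P \<Longrightarrow> m \<le> s z"
    and m: "0 < m"
begin

lemma M_lin:
  "v \<in> L2 P \<Longrightarrow> w \<in> L2 P \<Longrightarrow> AE z in lebesgue_on Q. M (\<lambda>z. v z + c * w z) z = M v z + c * M w z"
  by (rule adjoint_linear[OF M_L2 N_L2 adj])

lemma N_lin:
  "p \<in> L2 Q \<Longrightarrow> q \<in> L2 Q \<Longrightarrow> AE z in lebesgue_on P. N (\<lambda>z. p z + c * q z) z = N p z + c * N q z"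
  by (rule adjoint_linear[OF N_L2 M_L2 adj[symmetric]])

definition U where "U = {v \<in> L2 P. (\<lambda>z. s z * v z) \<in> L2 P}"

definition res where "res y v z = M v z + ybar z - y z"

text \<open>The parameter covers both functionals: K = 0 gives the plain Lagrangian.\<close>

definition Lag where
  "Lag K y v q = 1/2 * (LINT z|lebesgue_on Q. (r z)\<^sup>2 * \<bar>y z\<bar>\<^sup>2) + 1/2 * (LINT z|lebesgue_on P. (s z)\<^sup>2 * \<bar>v z\<bar>\<^sup>2)
     - (LINT z|lebesgue_on Q. q z * res y v z) + K/2 * (LINT z|lebesgue_on Q. (res y v z)\<^sup>2)"

definition optimal where
  "optimal y v q \<longleftrightarrow> y \<in> L2 Q \<and> v \<in> U \<and> q \<in> L2 Q \<and> (AE z in lebesgue_on Q. res y v z = 0) \<and>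
     (AE z in lebesgue_on Q. y z = - (q z / (r z)\<^sup>2)) \<and> (AE z in lebesgue_on P. v z = N q z / (s z)\<^sup>2)"

lemma rs_pos: "z \<in> Q \<Longrightarrow> 0 < r z" "z \<in> P \<Longrightarrow> 0 < s z"
  using r(2)[of z] s(2)[of z] m by auto

lemma r_L2: "y \<in> L2 Q \<Longrightarrow> (\<lambda>z. r z * y z) \<in> L2 Q"
  by (rule L2_mult_bounded_real[OF _ r(1), of _ "R"]) (use rs_pos r(3) in \<open>auto intro!: AE_I2 simp: less_imp_le\<close>)

lemma inverse_r_L2: "y \<in> L2 Q \<Longrightarrow> (\<lambda>z. y z / r z) \<in> L2 Q"
  by (rule L2_divide[OF _ r(1) m r(2)])

lemma inverse_s_L2: "v \<in> L2 P \<Longrightarrow> (\<lambda>z. v z / s z) \<in> L2 P"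
  by (rule L2_divide[OF _ s(1) m s(2)])

lemma divide_square_L2:
  "q \<in> L2 Q \<Longrightarrow> (\<lambda>z. q z / (r z)\<^sup>2) \<in> L2 Q" "v \<in> L2 P \<Longrightarrow> (\<lambda>z. v z / (s z)\<^sup>2) \<in> L2 P"
  using inverse_r_L2[OF inverse_r_L2, of q] inverse_s_L2[OF inverse_s_L2, of v] by (simp_all add: power2_eq_square)

text \<open>Multiplication by s gives v / s, which is square integrable because s is bounded away
  from 0. This makes the control built from \<open>N q\<close> admissible.\<close>

lemma divide_square_U:
  assumes v: "v \<in> L2 P"
  shows "(\<lambda>z. v z / (s z)\<^sup>2) \<in> U"
proof -
  have "(\<lambda>z. s z * (v z / (s z)\<^sup>2)) \<in> L2 P"
  proof (rule L2_cong_AE[OF inverse_s_L2[OF v]])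
    show "(\<lambda>z. s z * (v z / (s z)\<^sup>2)) \<in> borel_measurable (lebesgue_on P)"
      using s(1) L2_measurable[OF v] by measurable
    show "AE z in lebesgue_on P. v z / s z = s z * (v z / (s z)\<^sup>2)"
      by (rule AE_I2) (use rs_pos(2) in \<open>force simp: power2_eq_square\<close>)
  qed
  then show ?thesis using divide_square_L2(2)[OF v] by (simp add: U_def)
qed

lemma U_lincomb: "v \<in> U \<Longrightarrow> w \<in> U \<Longrightarrow> (\<lambda>z. v z + c * w z) \<in> U"
proof -
  assume v: "v \<in> U" and w: "w \<in> U"
  have "(\<lambda>z. s z * v z + c * (s z * w z)) \<in> L2 P" using v w unfolding U_def by (intro L2_add L2_cmult) auto
  then have "(\<lambda>z. s z * (v z + c * w z)) \<in> L2 P" by (simp add: algebra_simps)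
  moreover have "(\<lambda>z. v z + c * w z) \<in> L2 P" using v w unfolding U_def by (intro L2_add L2_cmult) auto
  ultimately show ?thesis unfolding U_def by simp
qed

lemma U_zero: "(\<lambda>z. 0) \<in> U"
  by (simp add: U_def L2_zero)

lemma U_L2: "v \<in> U \<Longrightarrow> v \<in> L2 P" "v \<in> U \<Longrightarrow> (\<lambda>z. s z * v z) \<in> L2 P"
  by (simp_all add: U_def)

lemma res_L2: "y \<in> L2 Q \<Longrightarrow> v \<in> U \<Longrightarrow> res y v \<in> L2 Q"
  unfolding res_def[abs_def] by (intro L2_diff L2_add M_L2 ybar U_L2)

lemma Lag_ip: "Lag K y v q = 1/2 * ip Q (\<lambda>z. r z * y z) (\<lambda>z. r z * y z) + 1/2 * ip P (\<lambda>z. s z * v z) (\<lambda>z. s z * v z)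
    - ip Q q (res y v) + K/2 * ip Q (res y v) (res y v)"
  unfolding Lag_def ip_real by (simp add: power2_eq_square mult_ac)

lemma ip_AE_zero:
  fixes f g :: "'b \<Rightarrow> real"
  assumes "AE z in lebesgue_on Q. f z = 0"
  shows "ip Q f g = 0" "ip Q g f = 0"
proof -
  show "ip Q f g = 0" unfolding ip_real
  proof (rule integral_eq_zero_AE)
    show "AE z in lebesgue_on Q. f z * g z = 0" using assms by eventually_elim simp
  qed
  then show "ip Q g f = 0" by (simp add: ip_commute)
qed

text \<open>First variation in the direction \<open>(\<zeta>, \<mu>)\<close> at a point of the
  constraint set, with M already moved onto q.\<close>

definition lin where
  "lin y v q \<zeta> \<mu> = ip Q (\<lambda>z. r z * y z) (\<lambda>z. r z * \<zeta> z) + ip P (\<lambda>z. s z * v z) (\<lambda>z. s z * \<mu> z) - ip P \<mu> (N q) + ip Q q \<zeta>"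

text \<open>Half of the second variation; K enters the expansion of increments only here.\<close>

definition quad where
  "quad K \<zeta> \<mu> = 1/2 * ip Q (\<lambda>z. r z * \<zeta> z) (\<lambda>z. r z * \<zeta> z) + 1/2 * ip P (\<lambda>z. s z * \<mu> z) (\<lambda>z. s z * \<mu> z)
     + K/2 * ip Q (\<lambda>z. M \<mu> z - \<zeta> z) (\<lambda>z. M \<mu> z - \<zeta> z)"

lemma quad_nonneg: "0 \<le> K \<Longrightarrow> 0 \<le> quad K \<zeta> \<mu>"
  unfolding quad_def by (intro add_nonneg_nonneg mult_nonneg_nonneg ip_nonneg) auto

text \<open>On the constraint set the augmentation term has no first-order part, so that the linear part of
  the Lagrangian does not depend on \<open>K\<close>.\<close>

lemma Lag_expand:
  assumes y: "y \<in> L2 Q" and v: "v \<in> U" and q: "q \<in> L2 Q" and res: "AE z in lebesgue_on Q. res y v z = 0"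
    and \<zeta>: "\<zeta> \<in> L2 Q" and \<mu>: "\<mu> \<in> U"
  shows "Lag K (\<lambda>z. y z + t * \<zeta> z) (\<lambda>z. v z + t * \<mu> z) q = Lag K y v q + t * lin y v q \<zeta> \<mu> + t\<^sup>2 * quad K \<zeta> \<mu>"
proof -
  let ?y = "\<lambda>z. y z + t * \<zeta> z" and ?v = "\<lambda>z. v z + t * \<mu> z" and ?d = "\<lambda>z. M \<mu> z - \<zeta> z"
  have y': "?y \<in> L2 Q" by (intro L2_add L2_cmult y \<zeta>)
  have v': "?v \<in> U" by (rule U_lincomb[OF v \<mu>])
  have dL: "?d \<in> L2 Q" by (intro L2_diff M_L2 U_L2 \<mu> \<zeta>)
  have tdL: "(\<lambda>z. t * ?d z) \<in> L2 Q" by (rule L2_cmult[OF dL])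
  have R: "AE z in lebesgue_on Q. res ?y ?v z = t * ?d z"
    using res M_lin[OF U_L2(1)[OF v] U_L2(1)[OF \<mu>], of t]
    by eventually_elim (simp add: res_def algebra_simps)
  have 1: "ip Q (\<lambda>z. r z * ?y z) (\<lambda>z. r z * ?y z) = ip Q (\<lambda>z. r z * y z) (\<lambda>z. r z * y z)
      + 2 * t * ip Q (\<lambda>z. r z * y z) (\<lambda>z. r z * \<zeta> z) + t\<^sup>2 * ip Q (\<lambda>z. r z * \<zeta> z) (\<lambda>z. r z * \<zeta> z)"
    using ip_lincomb_square[OF r_L2[OF y] r_L2[OF \<zeta>], of t] by (simp add: distrib_left mult.left_commute)
  have 2: "ip P (\<lambda>z. s z * ?v z) (\<lambda>z. s z * ?v z) = ip P (\<lambda>z. s z * v z) (\<lambda>z. s z * v z)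
      + 2 * t * ip P (\<lambda>z. s z * v z) (\<lambda>z. s z * \<mu> z) + t\<^sup>2 * ip P (\<lambda>z. s z * \<mu> z) (\<lambda>z. s z * \<mu> z)"
    using ip_lincomb_square[OF U_L2(2)[OF v] U_L2(2)[OF \<mu>], of t] by (simp add: distrib_left mult.left_commute)
  have "ip Q q (res ?y ?v) = ip Q q (\<lambda>z. t * ?d z)"
    by (rule ip_cong_AE[OF _ R q res_L2[OF y' v'] q tdL]) simp
  also have "\<dots> = t * (ip P \<mu> (N q) - ip Q q \<zeta>)"
    unfolding ip_cmult_right ip_diff_right[OF M_L2[OF U_L2(1)[OF \<mu>]] \<zeta> q] adj[OF U_L2(1)[OF \<mu>] q] ..
  finally have 3: "ip Q q (res ?y ?v) = t * (ip P \<mu> (N q) - ip Q q \<zeta>)" .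
  have "ip Q (res ?y ?v) (res ?y ?v) = ip Q (\<lambda>z. t * ?d z) (\<lambda>z. t * ?d z)"
    by (rule ip_cong_AE[OF R R res_L2[OF y' v'] res_L2[OF y' v'] tdL tdL])
  then have 4: "ip Q (res ?y ?v) (res ?y ?v) = t\<^sup>2 * ip Q ?d ?d"
    unfolding ip_cmult_right ip_cmult_left by (simp add: power2_eq_square)
  show ?thesis
    unfolding Lag_ip 1 2 3 4 lin_def quad_def ip_AE_zero[OF res] by (simp add: algebra_simps)
qed

lemma lin_optimal:
  assumes o: "optimal y v q" and \<zeta>: "\<zeta> \<in> L2 Q" and \<mu>: "\<mu> \<in> U"
  shows "lin y v q \<zeta> \<mu> = 0"
proof -
  have y: "y \<in> L2 Q" and v: "v \<in> U" and q: "q \<in> L2 Q" and yq: "AE z in lebesgue_on Q. y z = - (q z / (r z)\<^sup>2)"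
    and vq: "AE z in lebesgue_on P. v z = N q z / (s z)\<^sup>2" using o unfolding optimal_def by blast+
  have "ip Q (\<lambda>z. r z * y z) (\<lambda>z. r z * \<zeta> z) = (LINT z|lebesgue_on Q. - (q z * \<zeta> z))"
    unfolding ip_real
  proof (rule integral_cong_AE)
    show "AE z in lebesgue_on Q. r z * y z * (r z * \<zeta> z) = - (q z * \<zeta> z)"
      using yq AE_space
    proof eventually_elim
      case (elim z)
      then have "r z \<noteq> 0" using rs_pos(1)[of z] by auto
      then show ?case unfolding elim(1) by (simp add: power2_eq_square)
    qed
  qed (use L2_measurable[OF y] L2_measurable[OF q] L2_measurable[OF \<zeta>] r(1) in measurable)
  moreover have "ip P (\<lambda>z. s z * v z) (\<lambda>z. s z * \<mu> z) = ip P \<mu> (N q)"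
    unfolding ip_real
  proof (rule integral_cong_AE)
    show "AE z in lebesgue_on P. s z * v z * (s z * \<mu> z) = \<mu> z * N q z"
      using vq AE_space
    proof eventually_elim
      case (elim z)
      then have "s z \<noteq> 0" using rs_pos(2)[of z] by auto
      then show ?case unfolding elim(1) by (simp add: power2_eq_square)
    qed
  qed (use L2_measurable[OF U_L2(1)[OF v]] L2_measurable[OF N_L2[OF q]] L2_measurable[OF U_L2(1)[OF \<mu>]] s(1) in measurable)
  ultimately show ?thesis unfolding lin_def by (simp add: ip_real)
qed

lemma saddle_point_iff_optimal:
  assumes K: "0 \<le> K"
  shows "saddle_point (L2 Q) U (L2 Q) (Lag K) y v q \<longleftrightarrow> optimal y v q"
proof
  assume sp: "saddle_point (L2 Q) U (L2 Q) (Lag K) y v q"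
  then have y: "y \<in> L2 Q" and v: "v \<in> U" and q: "q \<in> L2 Q"
    and up: "\<And>p. p \<in> L2 Q \<Longrightarrow> Lag K y v p \<le> Lag K y v q"
    and lo: "\<And>z w. z \<in> L2 Q \<Longrightarrow> w \<in> U \<Longrightarrow> Lag K y v q \<le> Lag K z w q"
    unfolding saddle_point_def by blast+
  note resL = res_L2[OF y v]
  \<comment> \<open>Replacing q by q minus the residual raises the Lagrangian by the squared norm of
    the residual, so maximality in q forces the constraint.\<close>
  have "Lag K y v (\<lambda>z. q z - res y v z) \<le> Lag K y v q" by (rule up[OF L2_diff[OF q resL]])
  then have "ip Q (res y v) (res y v) \<le> 0" unfolding Lag_ip ip_diff_left[OF q resL resL] by simp
  from l2norm_eq_0_AE[OF resL this] have res: "AE z in lebesgue_on Q. res y v z = 0" .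
  have lin0: "lin y v q \<zeta> \<mu> = 0" if \<zeta>: "\<zeta> \<in> L2 Q" and \<mu>: "\<mu> \<in> U" for \<zeta> \<mu>
  proof -
    \<comment> \<open>Minimality along a line, written so that the discriminant lemma applies with a
      = 0 and b half the first variation.\<close>
    have "0 \<le> 0 + 2 * t * (lin y v q \<zeta> \<mu> / 2) + t\<^sup>2 * quad K \<zeta> \<mu>" for t
    proof -
      have "Lag K y v q \<le> Lag K (\<lambda>z. y z + t * \<zeta> z) (\<lambda>z. v z + t * \<mu> z) q"
        by (rule lo[OF L2_add[OF y L2_cmult[OF \<zeta>]] U_lincomb[OF v \<mu>]])
      then show ?thesis unfolding Lag_expand[OF y v q res \<zeta> \<mu>] by simp
    qed
    from nonneg_quadratic_discriminant[OF this quad_nonneg[OF K]] show ?thesis by simp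
  qed
  \<comment> \<open>In the direction \<open>(?\<zeta>, 0)\<close> the first variation is the squared
    norm of \<open>?\<zeta>\<close>. The direction is admissible because r is bounded above.\<close>
  let ?\<zeta> = "\<lambda>z. r z * (r z * y z) + q z"
  have \<zeta>L: "?\<zeta> \<in> L2 Q" by (intro L2_add r_L2 y q)
  have "ip Q ?\<zeta> ?\<zeta> = ip Q (\<lambda>z. r z * (r z * y z)) ?\<zeta> + ip Q q ?\<zeta>"
    by (rule ip_add_left[OF r_L2[OF r_L2[OF y]] q \<zeta>L])
  also have "ip Q (\<lambda>z. r z * (r z * y z)) ?\<zeta> = ip Q (\<lambda>z. r z * y z) (\<lambda>z. r z * ?\<zeta> z)"
    unfolding ip_real by (simp add: mult_ac)
  also have "\<dots> + ip Q q ?\<zeta> = lin y v q ?\<zeta> (\<lambda>z. 0)"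
    unfolding lin_def by (simp add: ip_zero_left ip_zero_right)
  also have "\<dots> = 0" by (rule lin0[OF \<zeta>L U_zero])
  finally have "ip Q ?\<zeta> ?\<zeta> \<le> 0" by simp
  from l2norm_eq_0_AE[OF \<zeta>L this] have yq: "AE z in lebesgue_on Q. y z = - (q z / (r z)\<^sup>2)"
    using AE_space
  proof eventually_elim
    case (elim z)
    then have "r z \<noteq> 0" using rs_pos(1)[of z] by auto
    moreover have "(r z)\<^sup>2 * y z = - q z" using elim(1) by (simp add: power2_eq_square eq_neg_iff_add_eq_0)
    ultimately show ?case by (simp add: field_simps)
  qed
  \<comment> \<open>The analogous direction built from s^2 v - N q need not lie in U, since s may be
    unbounded. Dividing by s^2 gives an admissible direction along which the first variation is the
    squared norm of s times it.\<close>
  let ?\<mu> = "\<lambda>z. v z + (-1) * (N q z / (s z)\<^sup>2)"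
  have \<mu>U: "?\<mu> \<in> U" by (rule U_lincomb[OF v divide_square_U[OF N_L2[OF q]]])
  note \<mu>L = U_L2[OF \<mu>U]
  have "ip P (\<lambda>z. s z * ?\<mu> z) (\<lambda>z. s z * ?\<mu> z) = ip P (\<lambda>z. s z * v z - N q z / s z) (\<lambda>z. s z * ?\<mu> z)"
    unfolding ip_def
    by (rule Bochner_Integration.integral_cong) (use rs_pos(2) in \<open>auto simp: power2_eq_square algebra_simps dest: less_imp_neq\<close>)
  also have "\<dots> = ip P (\<lambda>z. s z * v z) (\<lambda>z. s z * ?\<mu> z) - ip P (\<lambda>z. N q z / s z) (\<lambda>z. s z * ?\<mu> z)"
    by (rule ip_diff_left[OF U_L2(2)[OF v] inverse_s_L2[OF N_L2[OF q]] \<mu>L(2)])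
  also have "ip P (\<lambda>z. N q z / s z) (\<lambda>z. s z * ?\<mu> z) = ip P ?\<mu> (N q)"
    unfolding ip_real
  proof (rule Bochner_Integration.integral_cong[OF refl])
    fix z assume "z \<in> space (lebesgue_on P)"
    then have "s z \<noteq> 0" using rs_pos(2)[of z] by auto
    then show "N q z / s z * (s z * ?\<mu> z) = ?\<mu> z * N q z" by simp
  qed
  also have "ip P (\<lambda>z. s z * v z) (\<lambda>z. s z * ?\<mu> z) - ip P ?\<mu> (N q) = lin y v q (\<lambda>z. 0) ?\<mu>"
    unfolding lin_def by (simp add: ip_zero_right)
  also have "\<dots> = 0" by (rule lin0[OF L2_zero \<mu>U])
  finally have "ip P (\<lambda>z. s z * ?\<mu> z) (\<lambda>z. s z * ?\<mu> z) \<le> 0" by simp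
  from l2norm_eq_0_AE[OF \<mu>L(2) this] have vq: "AE z in lebesgue_on P. v z = N q z / (s z)\<^sup>2"
    using AE_space
  proof eventually_elim
    case (elim z)
    then have "s z \<noteq> 0" using rs_pos(2)[of z] by auto
    then show ?case using elim(1) by simp
  qed
  show "optimal y v q" unfolding optimal_def using y v q res yq vq by blast
next
  assume o: "optimal y v q"
  then have y: "y \<in> L2 Q" and v: "v \<in> U" and q: "q \<in> L2 Q" and res: "AE z in lebesgue_on Q. res y v z = 0"
    unfolding optimal_def by blast+
  have "Lag K y v p \<le> Lag K y v q" for p unfolding Lag_ip ip_AE_zero[OF res] by simp
  moreover have "Lag K y v q \<le> Lag K z w q" if z: "z \<in> L2 Q" and w: "w \<in> U" for z w
  proof -
    have \<zeta>: "(\<lambda>x. z x - y x) \<in> L2 Q" by (rule L2_diff[OF z y])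
    have \<mu>: "(\<lambda>x. w x - v x) \<in> U" using U_lincomb[OF w v, of "-1"] by simp
    \<comment> \<open>The expansion is exact, so it may be used at t = 1: the first variation
      vanishes and the gap is the nonnegative quadratic part.\<close>
    have "Lag K z w q = Lag K (\<lambda>x. y x + 1 * (z x - y x)) (\<lambda>x. v x + 1 * (w x - v x)) q" by simp
    also have "\<dots> = Lag K y v q + quad K (\<lambda>x. z x - y x) (\<lambda>x. w x - v x)"
      unfolding Lag_expand[OF y v q res \<zeta> \<mu>] lin_optimal[OF o \<zeta> \<mu>] by simp
    finally show ?thesis using quad_nonneg[OF K, of "\<lambda>x. z x - y x" "\<lambda>x. w x - v x"] by simp
  qed
  ultimately show "saddle_point (L2 Q) U (L2 Q) (Lag K) y v q"
    unfolding saddle_point_def using y v q by blast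
qed

lemma Lag_optimal: "optimal y v q \<Longrightarrow> Lag K y v q = Lag 0 y v q"
  unfolding optimal_def Lag_ip using ip_AE_zero[of "res y v"] by simp

text \<open>For the difference of two solutions, the pairing of its multiplier with M applied to its
  control is minus the squared norm of q / r by the first relation, and plus the squared norm of N q
  / s by adjointness. Both norms therefore vanish.\<close>

lemma optimal_unique:
  assumes o: "optimal y v q" and o': "optimal y' v' q'"
  shows "(AE z in lebesgue_on Q. y z = y' z) \<and> (AE z in lebesgue_on P. v z = v' z) \<and> (AE z in lebesgue_on Q. q z = q' z)"
proof -
  have 1: "y \<in> L2 Q" "v \<in> U" "q \<in> L2 Q" "AE z in lebesgue_on Q. res y v z = 0"
    "AE z in lebesgue_on Q. y z = - (q z / (r z)\<^sup>2)" "AE z in lebesgue_on P. v z = N q z / (s z)\<^sup>2"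
    using o unfolding optimal_def by blast+
  have 2: "y' \<in> L2 Q" "v' \<in> U" "q' \<in> L2 Q" "AE z in lebesgue_on Q. res y' v' z = 0"
    "AE z in lebesgue_on Q. y' z = - (q' z / (r z)\<^sup>2)" "AE z in lebesgue_on P. v' z = N q' z / (s z)\<^sup>2"
    using o' unfolding optimal_def by blast+
  let ?y = "\<lambda>z. y z + (-1) * y' z" and ?v = "\<lambda>z. v z + (-1) * v' z" and ?q = "\<lambda>z. q z + (-1) * q' z"
  have y: "?y \<in> L2 Q" and q: "?q \<in> L2 Q" by (intro L2_add L2_cmult 1 2)+
  have v: "?v \<in> L2 P" by (rule U_L2(1)[OF U_lincomb[OF 1(2) 2(2)]])
  have My: "AE z in lebesgue_on Q. M ?v z = ?y z"
    using M_lin[OF U_L2(1)[OF 1(2)] U_L2(1)[OF 2(2)], of "-1"] 1(4) 2(4)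
    by eventually_elim (simp add: res_def)
  have yq: "AE z in lebesgue_on Q. ?y z = - (?q z / r z / r z)"
    using 1(5) 2(5) by eventually_elim (simp add: power2_eq_square diff_divide_distrib)
  have vq: "AE z in lebesgue_on P. ?v z = N ?q z / s z / s z"
    using 1(6) 2(6) N_lin[OF 1(3) 2(3), of "-1"] by eventually_elim (simp add: power2_eq_square diff_divide_distrib)
  have qr: "(\<lambda>z. ?q z / r z) \<in> L2 Q" by (rule inverse_r_L2[OF q])
  have Ns: "(\<lambda>z. N ?q z / s z) \<in> L2 P" by (rule inverse_s_L2[OF N_L2[OF q]])
  have "ip Q ?q (M ?v) = ip Q ?q (\<lambda>z. - (?q z / r z / r z))"
  proof (rule ip_cong_AE[OF _ _ q M_L2[OF v] q L2_minus[OF inverse_r_L2[OF qr]]])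
    show "AE z in lebesgue_on Q. M ?v z = - (?q z / r z / r z)" using My yq by eventually_elim simp
  qed simp
  also have "\<dots> = - ip Q (\<lambda>z. ?q z / r z) (\<lambda>z. ?q z / r z)" by (simp add: ip_real mult_ac)
  finally have A: "ip Q ?q (M ?v) = - ip Q (\<lambda>z. ?q z / r z) (\<lambda>z. ?q z / r z)" .
  have "ip P ?v (N ?q) = ip P (\<lambda>z. N ?q z / s z / s z) (N ?q)"
    by (rule ip_cong_AE[OF vq _ v N_L2[OF q] inverse_s_L2[OF Ns] N_L2[OF q]]) simp
  also have "\<dots> = ip P (\<lambda>z. N ?q z / s z) (\<lambda>z. N ?q z / s z)" by (simp add: ip_real mult_ac)
  finally have B: "ip P ?v (N ?q) = ip P (\<lambda>z. N ?q z / s z) (\<lambda>z. N ?q z / s z)" .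
  have C: "ip Q ?q (M ?v) = ip P ?v (N ?q)" by (rule adj[OF v q])
  have "ip Q (\<lambda>z. ?q z / r z) (\<lambda>z. ?q z / r z) \<le> 0" "ip P (\<lambda>z. N ?q z / s z) (\<lambda>z. N ?q z / s z) \<le> 0"
    using A B C ip_nonneg[of Q "\<lambda>z. ?q z / r z"] ip_nonneg[of P "\<lambda>z. N ?q z / s z"] by linarith+
  from l2norm_eq_0_AE[OF qr this(1)] l2norm_eq_0_AE[OF Ns this(2)]
  have q0: "AE z in lebesgue_on Q. ?q z / r z = 0" and N0: "AE z in lebesgue_on P. N ?q z / s z = 0" .
  have "AE z in lebesgue_on Q. y z = y' z" using q0 yq
  proof eventually_elim
    case (elim z)
    show ?case using elim(2) unfolding elim(1) by simp
  qed
  moreover have "AE z in lebesgue_on P. v z = v' z" using N0 vq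
  proof eventually_elim
    case (elim z)
    show ?case using elim(2) unfolding elim(1) by simp
  qed
  moreover have "AE z in lebesgue_on Q. q z = q' z"
    using q0 AE_space
  proof eventually_elim
    case (elim z)
    then have "r z \<noteq> 0" using rs_pos(1)[of z] by auto
    then show ?case using elim(1) by simp
  qed
  ultimately show ?thesis by blast
qed

text \<open>The multiplier solves the dual problem
  \<open>(M\<^sup>*q/s, M\<^sup>*p/s) + (q/r, p/r) = - (ybar, p)\<close> for all \<open>p\<close>, whose left-hand side is coercive because
  \<open>r\<close> is bounded.\<close>

lemma optimal_exists: "\<exists>y v q. optimal y v q"
proof -
  \<comment> \<open>With this pair the bilinear form of the dual problem is the inner product of
    \<open>A p\<close> and \<open>A p'\<close>, so \<open>Riesz_family\<close> applies
    directly.\<close>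
  define A where "A p z = (zext P (\<lambda>z. N p z / s z) z, p z / r z)" for p z
  have Z: "zext P (\<lambda>z. N p z / s z) \<in> L2 Q" if "p \<in> L2 Q" for p
    by (rule L2_restrict[OF Q _ _ zext_L2[OF P(1) inverse_s_L2[OF N_L2[OF that]]]]) auto
  have AL: "A p \<in> L2 Q" if "p \<in> L2 Q" for p
    unfolding A_def[abs_def] L2_Pair using Z[OF that] inverse_r_L2[OF that] by blast
  have ZZ: "ip Q (zext P f) (zext P g) = ip P f g" for f g :: "'b \<Rightarrow> real"
    unfolding ip_zext_left[OF Q] ip_zext_left[OF P(1)] unfolding ip_def
    by (rule Bochner_Integration.integral_cong) (use P(2) in \<open>auto simp: zext_def\<close>)
  have AA: "ip Q (A p) (A p') = ip P (N p) (\<lambda>z. N p' z / (s z)\<^sup>2) + ip Q p (\<lambda>z. p' z / (r z)\<^sup>2)"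
    if p: "p \<in> L2 Q" and p': "p' \<in> L2 Q" for p p'
    unfolding A_def[abs_def] ip_Pair[OF Z[OF p] Z[OF p'] inverse_r_L2[OF p] inverse_r_L2[OF p']] ZZ
    by (simp add: ip_real power2_eq_square)
  have R0: "0 \<le> max 0 R" by simp
  \<comment> \<open>Coercivity comes from r being at most R. The maximum with 0 provides for an
    empty Q, in which case the sign of R is not determined.\<close>
  have le: "l2norm Q p \<le> max 0 R * l2norm Q (\<lambda>z. p z / r z)" if p: "p \<in> L2 Q" for p
  proof -
    have "ip Q p p \<le> (LINT z|lebesgue_on Q. (max 0 R)\<^sup>2 * ((p z / r z) \<bullet> (p z / r z)))"
      unfolding ip_def
    proof (rule integral_mono[OF L2_integrable[OF p] integrable_mult_right[OF L2_integrable[OF inverse_r_L2[OF p]]]])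
      fix z assume "z \<in> space (lebesgue_on Q)"
      then have z: "0 < r z" "r z \<le> max 0 R" using rs_pos(1)[of z] r(3)[of z] by auto
      then have "(r z)\<^sup>2 \<le> (max 0 R)\<^sup>2" by (intro power_mono) auto
      from mult_right_mono[OF this, of "(p z / r z) \<bullet> (p z / r z)"]
      have "(r z)\<^sup>2 * ((p z / r z) \<bullet> (p z / r z)) \<le> (max 0 R)\<^sup>2 * ((p z / r z) \<bullet> (p z / r z))" by simp
      also have "(r z)\<^sup>2 * ((p z / r z) \<bullet> (p z / r z)) = p z \<bullet> p z" using z(1) by (simp add: power2_eq_square)
      finally show "p z \<bullet> p z \<le> (max 0 R)\<^sup>2 * ((p z / r z) \<bullet> (p z / r z))" .
    qed
    also have "\<dots> = (max 0 R)\<^sup>2 * ip Q (\<lambda>z. p z / r z) (\<lambda>z. p z / r z)"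
      unfolding ip_def by (rule integral_mult_right_zero)
    finally have "(l2norm Q p)\<^sup>2 \<le> (max 0 R * l2norm Q (\<lambda>z. p z / r z))\<^sup>2"
      by (simp only: l2norm_square power_mult_distrib)
    then show ?thesis by (rule power2_le_imp_le) (simp add: R0)
  qed
  have "\<exists>u t. (\<forall>n. t n \<in> L2 Q) \<and> l2lim Q (\<lambda>n. A (t n)) u \<and> (\<forall>p\<in>L2 Q. ip Q u (A p) = - ip Q ybar p)"
  proof (rule Riesz_family[where C = "l2norm Q ybar * max 0 R", OF _ AL])
    show "L2 Q \<noteq> ({} :: ('b \<Rightarrow> real) set)" using L2_zero by blast
    fix p :: "'b \<Rightarrow> real" assume p: "p \<in> L2 Q"
    have "ip Q (\<lambda>z. p z / r z) (\<lambda>z. p z / r z) \<le> ip Q (A p) (A p)"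
      unfolding A_def[abs_def] ip_Pair[OF Z[OF p] Z[OF p] inverse_r_L2[OF p] inverse_r_L2[OF p]]
      by (simp add: ip_nonneg)
    then have n: "l2norm Q (\<lambda>z. p z / r z) \<le> l2norm Q (A p)" by (simp add: l2norm_def)
    have "\<bar>- ip Q ybar p\<bar> \<le> l2norm Q ybar * l2norm Q p" using ip_Cauchy_Schwarz[OF ybar p] by simp
    also have "\<dots> \<le> l2norm Q ybar * (max 0 R * l2norm Q (A p))"
      by (rule mult_left_mono[OF order_trans[OF le[OF p] mult_left_mono[OF n R0]]]) simp
    finally show "\<bar>- ip Q ybar p\<bar> \<le> l2norm Q ybar * max 0 R * l2norm Q (A p)" by (simp only: mult.assoc)
    fix p' :: "'b \<Rightarrow> real" and c assume p': "p' \<in> L2 Q"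
    have k: "(\<lambda>z. p z + c * p' z) \<in> L2 Q" by (intro L2_add L2_cmult p p')
    show "\<exists>k\<in>L2 Q. (AE z in lebesgue_on Q. A k z = A p z + c *\<^sub>R A p' z) \<and> - ip Q ybar k = - ip Q ybar p + c * - ip Q ybar p'"
    proof (rule bexI[OF _ k], rule conjI)
      have "AE z in lebesgue. z \<in> P \<longrightarrow> N (\<lambda>z. p z + c * p' z) z = N p z + c * N p' z"
        using N_lin[OF p p', of c] P(1) by (simp add: AE_restrict_space_iff)
      then have "AE z in lebesgue. z \<in> Q \<longrightarrow> A (\<lambda>z. p z + c * p' z) z = A p z + c *\<^sub>R A p' z"
        by eventually_elim (auto simp: A_def zext_def add_divide_distrib)
      then show "AE z in lebesgue_on Q. A (\<lambda>z. p z + c * p' z) z = A p z + c *\<^sub>R A p' z"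
        using Q by (simp add: AE_restrict_space_iff)
      show "- ip Q ybar (\<lambda>z. p z + c * p' z) = - ip Q ybar p + c * - ip Q ybar p'"
        unfolding ip_add_right[OF p L2_cmult[OF p'] ybar] ip_cmult_right by simp
    qed
  qed
  then obtain u t where t: "\<And>n. t n \<in> L2 Q" and lim: "l2lim Q (\<lambda>n. A (t n)) u"
    and u: "\<And>p. p \<in> L2 Q \<Longrightarrow> ip Q u (A p) = - ip Q ybar p" by blast
  \<comment> \<open>The second component of \<open>A p\<close> is p / r, so multiplying the second
    component of the limit by r recovers the multiplier; since r is bounded, the minimising sequence
    converges to it in mean square.\<close>
  define q where "q z = r z * snd (u z)" for z
  have uL: "u \<in> L2 Q" using lim unfolding l2lim_def by blast
  then have uL2: "fst \<circ> u \<in> L2 Q" "snd \<circ> u \<in> L2 Q"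
    using L2_Pair[of "fst \<circ> u" "snd \<circ> u" Q] by (simp_all add: comp_def)
  have q: "q \<in> L2 Q" unfolding q_def[abs_def] using r_L2[OF uL2(2)] by (simp add: comp_def)
  have tq: "l2lim Q t q"
    unfolding l2lim_def
  proof (intro conjI allI)
    show "(\<lambda>n. l2norm Q (\<lambda>z. t n z - q z)) \<longlonglongrightarrow> 0"
    proof (rule tendsto_0_le_nonneg)
      have "(\<lambda>n. l2norm Q (\<lambda>z. A (t n) z - u z)) \<longlonglongrightarrow> 0" using lim unfolding l2lim_def by blast
      from tendsto_mult_right_zero[OF this]
      show "(\<lambda>n. max 0 R * l2norm Q (\<lambda>z. A (t n) z - u z)) \<longlonglongrightarrow> 0" .
      show "l2norm Q (\<lambda>z. t n z - q z) \<le> max 0 R * l2norm Q (\<lambda>z. A (t n) z - u z)" for n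
      proof -
        have d: "(\<lambda>z. t n z - q z) \<in> L2 Q" by (rule L2_diff[OF t q])
        have DL: "(\<lambda>z. A (t n) z - u z) \<in> L2 Q" by (rule L2_diff[OF AL[OF t] uL])
        have "ip Q (\<lambda>z. (t n z - q z) / r z) (\<lambda>z. (t n z - q z) / r z) \<le> ip Q (\<lambda>z. A (t n) z - u z) (\<lambda>z. A (t n) z - u z)"
          unfolding ip_def
        proof (rule integral_mono[OF L2_integrable[OF inverse_r_L2[OF d]] L2_integrable[OF DL]])
          fix z assume "z \<in> space (lebesgue_on Q)"
          then have "r z \<noteq> 0" using rs_pos(1)[of z] by auto
          then have "(t n z - q z) / r z = snd (A (t n) z - u z)" by (simp add: A_def q_def diff_divide_distrib)
          then show "((t n z - q z) / r z) \<bullet> ((t n z - q z) / r z) \<le> (A (t n) z - u z) \<bullet> (A (t n) z - u z)"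
            by (simp add: inner_prod_def)
        qed
        then have "l2norm Q (\<lambda>z. (t n z - q z) / r z) \<le> l2norm Q (\<lambda>z. A (t n) z - u z)" by (simp add: l2norm_def)
        from order_trans[OF le[OF d] mult_left_mono[OF this R0]] show ?thesis .
      qed
    qed simp
  qed (use t q in auto)
  let ?v = "\<lambda>z. N q z / (s z)\<^sup>2" and ?y = "\<lambda>z. - (q z / (r z)\<^sup>2)"
  have vU: "?v \<in> U" by (rule divide_square_U[OF N_L2[OF q]])
  have yL: "?y \<in> L2 Q" by (rule L2_minus[OF divide_square_L2(1)[OF q]])
  \<comment> \<open>The limit is taken after \<open>adj\<close> has moved N from \<open>t n\<close>
    to the fixed p, so that only the convergence of \<open>t n\<close> itself enters.\<close>
  have dual: "ip Q q (M (\<lambda>z. N p z / (s z)\<^sup>2)) + ip Q q (\<lambda>z. p z / (r z)\<^sup>2) = - ip Q ybar p" if p: "p \<in> L2 Q" for p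
  proof -
    let ?g = "\<lambda>z. N p z / (s z)\<^sup>2" and ?h = "\<lambda>z. p z / (r z)\<^sup>2"
    have g: "?g \<in> L2 P" by (rule divide_square_L2(2)[OF N_L2[OF p]])
    have h: "?h \<in> L2 Q" by (rule divide_square_L2(1)[OF p])
    have "ip Q (A (t n)) (A p) = ip Q (t n) (M ?g) + ip Q (t n) ?h" for n
      unfolding AA[OF t p] adj[OF g t] by (simp add: ip_commute)
    then have "(\<lambda>n. ip Q (A (t n)) (A p)) \<longlonglongrightarrow> ip Q q (M ?g) + ip Q q ?h"
      using tendsto_add[OF l2lim_ip[OF tq M_L2[OF g]] l2lim_ip[OF tq h]] by simp
    from LIMSEQ_unique[OF this l2lim_ip[OF lim AL[OF p]]] u[OF p] show ?thesis by simp
  qed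
  have resL: "res ?y ?v \<in> L2 Q" by (rule res_L2[OF yL vU])
  have "ip Q (res ?y ?v) (res ?y ?v) = 0"
  proof -
    \<comment> \<open>The dual equation is tested with the residual; adjointness turns its left-hand
      side into the corresponding terms of the squared norm of the residual, and everything
      cancels.\<close>
    let ?p = "res ?y ?v"
    note vL = U_L2(1)[OF vU] and hL = divide_square_L2(1)[OF q]
    have "ip Q ?p ?p = ip Q ?p (\<lambda>z. M ?v z + ybar z + q z / (r z)\<^sup>2)" by (simp add: res_def[abs_def])
    also have "\<dots> = ip Q ?p (M ?v) + ip Q ?p ybar + ip Q ?p (\<lambda>z. q z / (r z)\<^sup>2)"
      unfolding ip_add_right[OF L2_add[OF M_L2[OF vL] ybar] hL resL] ip_add_right[OF M_L2[OF vL] ybar resL] ..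
    also have "ip Q ?p (M ?v) = ip P ?v (N ?p)" by (rule adj[OF vL resL])
    also have "\<dots> = ip P (\<lambda>z. N ?p z / (s z)\<^sup>2) (N q)" by (simp add: ip_real mult_ac)
    also have "\<dots> = ip Q q (M (\<lambda>z. N ?p z / (s z)\<^sup>2))"
      by (rule adj[OF divide_square_L2(2)[OF N_L2[OF resL]] q, symmetric])
    also have "ip Q ?p (\<lambda>z. q z / (r z)\<^sup>2) = ip Q q (\<lambda>z. ?p z / (r z)\<^sup>2)" by (simp add: ip_real mult_ac)
    also have "ip Q ?p ybar = ip Q ybar ?p" by (rule ip_commute)
    finally show ?thesis using dual[OF resL] by linarith
  qed
  then have "AE z in lebesgue_on Q. res ?y ?v z = 0" by (intro l2norm_eq_0_AE[OF resL]) simp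
  then have "optimal ?y ?v q" unfolding optimal_def using yL vU q by simp
  then show ?thesis by blast
qed

end

section \<open>The control problem for the parabolic equation\<close>

context parabolic
begin

text \<open>Existence makes the functions selected by the choice operators actual weak solutions,
  and \<open>duality\<close> holds for whichever solution is selected.\<close>

lemma control_problem_parabolic:
  assumes \<omega>: "open \<omega>" "\<omega> \<subseteq> \<Omega>" and y0: "y0 \<in> L2 \<Omega>"
    and r: "r \<in> borel_measurable (lebesgue_on Q)" "\<And>z. z \<in> Q \<Longrightarrow> m \<le> r z" "\<And>z. z \<in> Q \<Longrightarrow> r z \<le> R"
    and s: "s \<in> borel_measurable (lebesgue_on (cyl \<omega> T))" "\<And>z. z \<in> cyl \<omega> T \<Longrightarrow> m \<le> s z"
    and m: "0 < m"
  shows "control_problem Q (cyl \<omega> T) (Mop \<Omega> \<omega> T a b) (Mop_adj \<Omega> \<omega> T a b) (ybar \<Omega> T a b y0) r s m R"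
proof -
  let ?P = "cyl \<omega> T" and ?M = "Mop \<Omega> \<omega> T a b" and ?N = "Mop_adj \<Omega> \<omega> T a b"
  have P: "?P \<in> sets lebesgue" by (rule cyl_measurable[OF \<omega>(1)])
  have PQ: "?P \<subseteq> Q" using \<omega>(2) by (auto simp: cyl_def)
  have src: "zext ?P v \<in> L2 Q" if "v \<in> L2 ?P" for v :: "'a \<times> real \<Rightarrow> real"
    by (rule L2_restrict[OF Q_measurable _ _ zext_L2[OF P that]]) auto
  have zx: "(\<lambda>z. if z \<in> ?P then v z else 0) = zext ?P v" for v :: "'a \<times> real \<Rightarrow> real"
    by (simp add: zext_def fun_eq_iff)
  have M: "weak_solution \<Omega> T a b (zext ?P v) (\<lambda>x. 0) (?M v)" if "v \<in> L2 ?P" for v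
    unfolding Mop_def zx
    by (rule someI_ex[OF weak_solution_exists[OF src[OF that] L2_zero]])
  have yb: "weak_solution \<Omega> T a b (\<lambda>z. 0) y0 (ybar \<Omega> T a b y0)"
    unfolding ybar_def by (rule someI_ex[OF weak_solution_exists[OF L2_zero y0]])
  define Z where "Z q = (SOME z. weak_solution_adj \<Omega> T a b q z)" for q
  have Z: "weak_solution_adj \<Omega> T a b q (Z q)" if "q \<in> L2 Q" for q
    unfolding Z_def by (rule someI_ex[OF weak_solution_adj_exists[OF that]])
  have ZL: "Z q \<in> L2 Q" if "q \<in> L2 Q" for q
    using Z[OF that] L2H01_L2(1) unfolding weak_solution_adj_def by blast
  have N: "?N q = zext ?P (Z q)" for q
    unfolding Mop_adj_def Z_def Let_def zx ..
  have MQ: "?M v \<in> L2 Q" if "v \<in> L2 ?P" for v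
    using M[OF that] L2H01_L2(1) unfolding weak_solution_def by blast
  have NP: "?N q \<in> L2 ?P" if "q \<in> L2 Q" for q
    unfolding N by (rule L2_restrict[OF P _ _ zext_L2[OF P L2_restrict[OF P PQ Q_measurable ZL[OF that]]]]) auto
  have adj: "ip Q q (?M v) = ip ?P v (?N q)" if v: "v \<in> L2 ?P" and q: "q \<in> L2 Q" for v q
  proof -
    obtain g where g: "weak_pair (zext ?P v) (?M v) g"
      using weak_solution_zero_iff[OF src[OF v]] M[OF v] by blast
    obtain k where k: "weak_pair_adj q (Z q) k" using weak_solution_adj_iff[OF q] Z[OF q] by blast
    have "ip Q q (?M v) = ip Q (zext ?P v) (Z q)" by (rule duality[OF g k, symmetric])
    also have "\<dots> = ip ?P v (?N q)"
      unfolding ip_zext_left[OF Q_measurable] ip_zext_left[OF P] N unfolding ip_def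
      by (rule Bochner_Integration.integral_cong) (use PQ in \<open>auto simp: zext_def\<close>)
    finally show ?thesis .
  qed
  show ?thesis
    by unfold_locales
      (use Q_measurable P PQ MQ NP adj r s m yb L2H01_L2(1) in \<open>unfold weak_solution_def; blast\<close>)+
qed

end

text \<open>The exponential outweighs the vanishing power: exp x is at least x^2/2, and with x = c/t
  the product is at least c^2 / (2 sqrt t), which decreases in t.\<close>

lemma powr_exp_lower_bound:
  fixes t c T :: real
  assumes t: "0 < t" "t < T" and c: "0 < c"
  shows "c\<^sup>2 / (2 * sqrt T) \<le> t powr (3/2) * exp (c / t)"
proof -
  have "c\<^sup>2 / (2 * sqrt T) \<le> c\<^sup>2 / (2 * sqrt t)"
    using t c by (intro divide_left_mono) (auto intro!: mult_pos_pos)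
  also have "\<dots> = t powr (3/2) * ((c / t)\<^sup>2 / 2)"
  proof -
    have "t powr (3/2) = t * sqrt t"
      using t powr_add[of t 1 "1/2"] by (simp add: powr_half_sqrt)
    then show ?thesis using t by (simp add: field_simps power2_eq_square)
  qed
  also have "\<dots> \<le> t powr (3/2) * exp (c / t)"
  proof (rule mult_left_mono)
    have "0 \<le> c / t" using t c by simp
    from exp_lower_Taylor_quadratic[OF this] \<open>0 \<le> c / t\<close> show "(c / t)\<^sup>2 / 2 \<le> exp (c / t)" by linarith
  qed simp
  finally show ?thesis .
qed

text \<open>\<open>K2\<close> exceeds the maximum of \<open>\<eta>\<close> on the compact closure,
  so the numerator of \<open>carleman_alpha\<close> is bounded below by a positive constant. This
  gives lower bounds for both weights up to the singular time t = T.\<close>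

lemma carleman_weights:
  assumes \<Omega>: "open \<Omega>" "bounded \<Omega>" "\<Omega> \<noteq> {}" and T: "T > 0"
    and \<eta>: "continuous_on (closure \<Omega>) \<eta>" "\<forall>x\<in>closure \<Omega>. \<eta> x < K2" and K1: "K1 > 0"
  shows "carleman_rho K1 K2 T \<eta> \<in> borel_measurable (lebesgue_on (cyl \<Omega> T))"
    "carleman_rho0 K1 K2 T \<eta> \<in> borel_measurable (lebesgue_on (cyl \<Omega> T))"
    "\<And>z. z \<in> cyl \<Omega> T \<Longrightarrow> 1 \<le> carleman_rho K1 K2 T \<eta> z"
    "\<exists>m>0. \<forall>z\<in>cyl \<Omega> T. m \<le> carleman_rho0 K1 K2 T \<eta> z"
proof -
  let ?Q = "cyl \<Omega> T"
  have cl: "compact (closure \<Omega>)" "closure \<Omega> \<noteq> {}" using \<Omega> by (simp_all add: compact_closure)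
  obtain x0 where x0: "x0 \<in> closure \<Omega>" "\<And>x. x \<in> closure \<Omega> \<Longrightarrow> \<eta> x \<le> \<eta> x0"
    using continuous_attains_sup[OF cl \<eta>(1)] by blast
  \<comment> \<open>The least value of exp K2 - exp \<open>\<eta>\<close>, attained where
    \<open>\<eta>\<close> is largest.\<close>
  define d where "d = exp K2 - exp (\<eta> x0)"
  have d: "d > 0" using \<eta>(2) x0(1) by (simp add: d_def)
  have Qz: "fst z \<in> closure \<Omega>" "0 < T - snd z" "T - snd z < T" if "z \<in> ?Q" for z
    using that closure_subset[of \<Omega>] by (auto simp: cyl_def)
  have \<rho>: "carleman_rho K1 K2 T \<eta> z = exp (K1 * (exp K2 - exp (\<eta> (fst z))) / (T - snd z))" for z
    by (simp add: carleman_rho_def carleman_alpha_def split_beta)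
  have ge: "exp (K1 * d / (T - snd z)) \<le> carleman_rho K1 K2 T \<eta> z" if "z \<in> ?Q" for z
  proof -
    have "d \<le> exp K2 - exp (\<eta> (fst z))" using x0(2)[OF Qz(1)[OF that]] by (simp add: d_def)
    then have "K1 * d / (T - snd z) \<le> K1 * (exp K2 - exp (\<eta> (fst z))) / (T - snd z)"
      using K1 Qz(2)[OF that] by (intro divide_right_mono mult_left_mono) auto
    then show ?thesis unfolding \<rho> by simp
  qed
  have c: "continuous_on ?Q (carleman_rho K1 K2 T \<eta>)"
    unfolding \<rho>[abs_def]
    by (intro continuous_intros continuous_on_compose2[OF \<eta>(1) continuous_on_fst[OF continuous_on_id]])
      (use Qz in \<open>force+\<close>)
  have c0: "continuous_on ?Q (carleman_rho0 K1 K2 T \<eta>)"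
    unfolding carleman_rho0_def using Qz(2)
    by (intro continuous_on_mult[OF _ c] continuous_on_powr continuous_intros) force
  show "carleman_rho K1 K2 T \<eta> \<in> borel_measurable (lebesgue_on ?Q)"
    "carleman_rho0 K1 K2 T \<eta> \<in> borel_measurable (lebesgue_on ?Q)"
    by (rule continuous_imp_measurable_on_sets_lebesgue[OF _ cyl_measurable[OF \<Omega>(1)]], fact c c0)+
  show "1 \<le> carleman_rho K1 K2 T \<eta> z" if "z \<in> ?Q" for z
  proof -
    have "0 \<le> K1 * d / (T - snd z)" using K1 d Qz(2)[OF that] by simp
    then have "1 \<le> exp (K1 * d / (T - snd z))" by simp
    with ge[OF that] show ?thesis by (rule order_trans[rotated])
  qed
  show "\<exists>m>0. \<forall>z\<in>?Q. m \<le> carleman_rho0 K1 K2 T \<eta> z"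
  proof (intro exI[of _ "(K1 * d)\<^sup>2 / (2 * sqrt T)"] conjI ballI)
    show "0 < (K1 * d)\<^sup>2 / (2 * sqrt T)" using K1 d T by simp
    fix z assume z: "z \<in> ?Q"
    have "(K1 * d)\<^sup>2 / (2 * sqrt T) \<le> (T - snd z) powr (3/2) * exp (K1 * d / (T - snd z))"
      using Qz(2,3)[OF z] K1 d by (intro powr_exp_lower_bound) auto
    also have "\<dots> \<le> carleman_rho0 K1 K2 T \<eta> z"
      unfolding carleman_rho0_def by (rule mult_left_mono[OF ge[OF z]]) simp
    finally show "(K1 * d)\<^sup>2 / (2 * sqrt T) \<le> carleman_rho0 K1 K2 T \<eta> z" .
  qed
qed

theorem theorem3p2:
  fixes \<Omega> \<omega> :: "'a::euclidean_space set"
    and T a0 K1 K2 R K :: real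
    and a b :: "'a \<times> real \<Rightarrow> real"
    and \<eta> y0 :: "'a \<Rightarrow> real"
    and \<rho> \<rho>0 :: "'a \<times> real \<Rightarrow> real"
    and LR LRK :: "('a \<times> real \<Rightarrow> real) \<Rightarrow> ('a \<times> real \<Rightarrow> real) \<Rightarrow> ('a \<times> real \<Rightarrow> real) \<Rightarrow> real"
  assumes domain: "open \<Omega>" "connected \<Omega>" "\<Omega> \<noteq> {}" "bounded \<Omega>" "C2_boundary \<Omega>"
    and T: "T > 0"
    and omega: "open \<omega>" "\<omega> \<noteq> {}" "\<omega> \<subseteq> \<Omega>"
    and a: "a \<in> W1inf (cyl \<Omega> T)" "a0 > 0" "AE z in lebesgue_on (cyl \<Omega> T). a z \<ge> a0"
    and b: "b \<in> Linf (cyl \<Omega> T)"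
    and eta: "carleman_eta \<Omega> \<omega> \<eta>"
    and K1K2: "K1 > 0" "K2 > 0" "\<forall>x\<in>closure \<Omega>. \<eta> x < K2"
    and rho: "\<rho> = carleman_rho K1 K2 T \<eta>"
    and rho0: "\<rho>0 = carleman_rho0 K1 K2 T \<eta>"
    and RK: "R > 0" "K > 0"
    and y0: "y0 \<in> L2 \<Omega>"
    and LR: "LR = Lagr \<Omega> \<omega> T a b y0 \<rho> \<rho>0 R"
    and LRK: "LRK = Lagr_aug \<Omega> \<omega> T a b y0 \<rho> \<rho>0 R K"
  shows
    "(\<forall>y v q. saddle_point (L2 (cyl \<Omega> T)) (Uspace \<omega> T \<rho>0) (L2 (cyl \<Omega> T)) LR y v q \<longleftrightarrow>
              saddle_point (L2 (cyl \<Omega> T)) (Uspace \<omega> T \<rho>0) (L2 (cyl \<Omega> T)) LRK y v q) \<and>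
     (\<exists>yR vR qR.
        saddle_point (L2 (cyl \<Omega> T)) (Uspace \<omega> T \<rho>0) (L2 (cyl \<Omega> T)) LRK yR vR qR \<and>
        (\<forall>y v q. saddle_point (L2 (cyl \<Omega> T)) (Uspace \<omega> T \<rho>0) (L2 (cyl \<Omega> T)) LRK y v q \<longrightarrow>
           (AE z in lebesgue_on (cyl \<Omega> T). y z = yR z) \<and>
           (AE z in lebesgue_on (cyl \<omega> T). v z = vR z) \<and>
           (AE z in lebesgue_on (cyl \<Omega> T). q z = qR z)) \<and>
        (AE z in lebesgue_on (cyl \<Omega> T). yR z = - (qR z / (rho_trunc R \<rho> z)\<^sup>2)) \<and>
        (AE z in lebesgue_on (cyl \<omega> T). vR z = Mop_adj \<Omega> \<omega> T a b qR z / (\<rho>0 z)\<^sup>2) \<and>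
        LRK yR vR qR = LR yR vR qR)"
proof -
  interpret parabolic \<Omega> T a0 a b
    by unfold_locales (use domain T a b in \<open>auto simp: W1inf_def\<close>)
  let ?P = "cyl \<omega> T"
  have \<eta>: "continuous_on (closure \<Omega>) \<eta>" using eta unfolding carleman_eta_def C2bar_def by blast
  note W = carleman_weights[OF \<Omega> domain(3) T \<eta> K1K2(3,1), folded rho rho0]
  obtain m0 where m0: "m0 > 0" "\<And>z. z \<in> Q \<Longrightarrow> m0 \<le> \<rho>0 z" using W(4) by blast
  \<comment> \<open>A common lower bound for both weights: \<open>\<rho>\<close> is at least 1, so
    its truncation is at least min R 1, and \<open>\<rho>0\<close> is at least
    \<open>m0\<close>.\<close>
  define m where "m = min m0 (min R 1)"
  have PQ: "?P \<subseteq> Q" using omega(3) by (auto simp: cyl_def)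
  interpret control_problem Q ?P "Mop \<Omega> \<omega> T a b" "Mop_adj \<Omega> \<omega> T a b" "ybar \<Omega> T a b y0" "rho_trunc R \<rho>" \<rho>0 m R
  proof (rule control_problem_parabolic[OF omega(1,3) y0])
    show "rho_trunc R \<rho> \<in> borel_measurable (lebesgue_on Q)" using W(1) unfolding rho_trunc_def by measurable
    show "m \<le> rho_trunc R \<rho> z" if "z \<in> Q" for z using W(3)[OF that] by (auto simp: rho_trunc_def m_def)
    show "rho_trunc R \<rho> z \<le> R" for z by (simp add: rho_trunc_def)
    show "\<rho>0 \<in> borel_measurable (lebesgue_on ?P)" by (rule measurable_restrict_mono[OF W(2) PQ])
    show "m \<le> \<rho>0 z" if "z \<in> ?P" for z using m0(2)[of z] that PQ by (auto simp: m_def)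
    show "0 < m" using m0 RK by (simp add: m_def)
  qed
  have U: "Uspace \<omega> T \<rho>0 = U" by (simp add: Uspace_def U_def)
  have L: "LR = Lag 0" "LRK = Lag K"
    unfolding LR LRK Lagr_aug_def[abs_def] Lagr_def[abs_def] Lag_def[abs_def] res_def[abs_def] by (simp_all add: fun_eq_iff)
  have iff: "saddle_point (L2 Q) U (L2 Q) (Lag 0) y v q \<longleftrightarrow> optimal y v q"
    "saddle_point (L2 Q) U (L2 Q) (Lag K) y v q \<longleftrightarrow> optimal y v q" for y v q
    using RK by (intro saddle_point_iff_optimal; simp)+
  obtain yR vR qR where o: "optimal yR vR qR" using optimal_exists by blast
  \<comment> \<open>Once both saddle-point conditions are rewritten to \<open>optimal\<close>, the
    equivalence in (a) is reflexive and the rest concerns \<open>optimal\<close> alone.\<close>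
  show ?thesis
    unfolding U L iff
  proof (rule conjI, intro allI refl, rule exI[of _ yR], rule exI[of _ vR], rule exI[of _ qR], intro conjI allI)
    show "optimal yR vR qR" by (rule o)
    show "Lag K yR vR qR = Lag 0 yR vR qR" by (rule Lag_optimal[OF o])
    show "AE z in lebesgue_on Q. yR z = - (qR z / (rho_trunc R \<rho> z)\<^sup>2)"
      "AE z in lebesgue_on ?P. vR z = Mop_adj \<Omega> \<omega> T a b qR z / (\<rho>0 z)\<^sup>2"
      using o unfolding optimal_def by blast+
    show "optimal y v q \<longrightarrow> (AE z in lebesgue_on Q. y z = yR z) \<and> (AE z in lebesgue_on ?P. v z = vR z) \<and>
        (AE z in lebesgue_on Q. q z = qR z)" for y v q
      using optimal_unique[OF _ o] by blast
  qed
qed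

end
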